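(* Let $\Gamma$ be a countable amenable discrete group. Suppose that $f\in\mathbb{Z}\Gamma$ is invertible in $\ell^1(\Gamma)$ and has no left inverse in $\mathbb{Z}\Gamma$. Then $\det_{\mathcal{L}\Gamma}f>1$.
   Context: $\mathbb{Z}\Gamma$ is the integral group ring; $\ell^1(\Gamma)$ is the Banach algebra of absolutely summable real-valued functions on $\Gamma$ under convolution, containing $\mathbb{Z}\Gamma$. $\mathcal{L}\Gamma$ is the group von Neumann algebra of $\Gamma$, acting on $\ell^2_{\mathbb{C}}(\Gamma)$ and containing $\ell^1(\Gamma)$ via convolution operators, with canonical trace $\mathrm{tr}(a)=\langle a\delta_{e_\Gamma},\delta_{e_\Gamma}\rangle$. For $f$ invertible in $\mathcal{L}\Gamma$ (which holds if $f$ is invertible in $\ell^1(\Gamma)$), the Fuglede--Kadison determinant is $\det_{\mathcal{L}\Gamma}f=\exp(\mathrm{tr}(\log|f|))>0$, where $|f|=(f^*f)^{1/2}$. *)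

theory Defs
  imports
    "HOL-Analysis.Analysis"
    "HOL-Algebra.Coset"
    "HOL-Algebra.Ring"
    "HOL-Computational_Algebra.Polynomial"
begin

section \<open>Amenability\<close>

text \<open>The Folner condition: every finite set of translations almost fixes some nonempty
  finite set, up to an arbitrarily small proportion.\<close>

definition amenable :: "('a, 'c) monoid_scheme \<Rightarrow> bool" where
  "amenable G \<longleftrightarrow>
    (\<forall>K \<epsilon>. finite K \<and> K \<subseteq> carrier G \<and> 0 < (\<epsilon>::real) \<longrightarrow>
      (\<exists>F. finite F \<and> F \<noteq> {} \<and> F \<subseteq> carrier G \<and>
        (\<forall>k\<in>K. real (card (sym_diff (k <#\<^bsub>G\<^esub> F) F)) \<le> \<epsilon> * real (card F))))"


section \<open>Convolution algebras\<close>

text \<open>Functions on the group are functions on the whole type that vanish off the carrier, so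
  that equality of functions on the group is equality in HOL.\<close>

definition convolution ::
    "('a, 'c) monoid_scheme \<Rightarrow> ('a \<Rightarrow> 'b::real_normed_field) \<Rightarrow> ('a \<Rightarrow> 'b) \<Rightarrow> 'a \<Rightarrow> 'b" where
  "convolution G f g =
    (\<lambda>s. if s \<in> carrier G then \<Sum>\<^sub>\<infinity>t\<in>carrier G. f t * g (inv\<^bsub>G\<^esub> t \<otimes>\<^bsub>G\<^esub> s) else 0)"

definition point_mass :: "'a \<Rightarrow> 'a \<Rightarrow> 'b::zero_neq_one" where
  "point_mass a = (\<lambda>s. if s = a then 1 else 0)"

definition ell1_algebra :: "('a, 'c) monoid_scheme \<Rightarrow> ('a \<Rightarrow> real) ring" where
  "ell1_algebra G =
    \<lparr>carrier = {f. (\<forall>s. s \<notin> carrier G \<longrightarrow> f s = 0) \<and> (\<lambda>s. \<bar>f s\<bar>) summable_on carrier G},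
     mult = convolution G,
     one = point_mass \<one>\<^bsub>G\<^esub>,
     zero = (\<lambda>_. 0),
     add = (\<lambda>f g s. f s + g s)\<rparr>"

text \<open>The integral group ring, as the subring of the finitely supported integer-valued elements
  of the \<open>\<ell>\<^sup>1\<close> algebra.\<close>

definition int_group_ring :: "('a, 'c) monoid_scheme \<Rightarrow> ('a \<Rightarrow> real) ring" where
  "int_group_ring G = (ell1_algebra G)
    \<lparr>carrier := {f. (\<forall>s. s \<notin> carrier G \<longrightarrow> f s = 0) \<and> finite {s. f s \<noteq> 0} \<and> (\<forall>s. f s \<in> \<int>)}\<rparr>"


section \<open>Bounded operators on a complex \<open>\<ell>\<^sup>2\<close> space\<close>

definition ell2 :: "'a set \<Rightarrow> ('a \<Rightarrow> complex) set" where
  "ell2 S = {x. (\<forall>i. i \<notin> S \<longrightarrow> x i = 0) \<and> (\<lambda>i. (cmod (x i))\<^sup>2) summable_on S}"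

definition ell2_inner :: "'a set \<Rightarrow> ('a \<Rightarrow> complex) \<Rightarrow> ('a \<Rightarrow> complex) \<Rightarrow> complex" where
  "ell2_inner S x y = (\<Sum>\<^sub>\<infinity>i\<in>S. x i * cnj (y i))"

definition ell2_norm :: "'a set \<Rightarrow> ('a \<Rightarrow> complex) \<Rightarrow> real" where
  "ell2_norm S x = sqrt (\<Sum>\<^sub>\<infinity>i\<in>S. (cmod (x i))\<^sup>2)"

type_synonym 'a ell2_op = "('a \<Rightarrow> complex) \<Rightarrow> ('a \<Rightarrow> complex)"

text \<open>An operator is a function on all complex families; its value off \<open>ell2 S\<close> is fixed to be
  zero, so that two bounded operators are equal as soon as they agree on \<open>ell2 S\<close>.\<close>

definition bounded_ops :: "'a set \<Rightarrow> 'a ell2_op set" where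
  "bounded_ops S = {T.
    (\<forall>x\<in>ell2 S. T x \<in> ell2 S) \<and>
    (\<forall>x\<in>ell2 S. \<forall>y\<in>ell2 S. T (\<lambda>i. x i + y i) = (\<lambda>i. T x i + T y i)) \<and>
    (\<forall>c. \<forall>x\<in>ell2 S. T (\<lambda>i. c * x i) = (\<lambda>i. c * T x i)) \<and>
    (\<exists>B. \<forall>x\<in>ell2 S. ell2_norm S (T x) \<le> B * ell2_norm S x) \<and>
    (\<forall>x. x \<notin> ell2 S \<longrightarrow> T x = (\<lambda>_. 0))}"

definition op_norm :: "'a set \<Rightarrow> 'a ell2_op \<Rightarrow> real" where
  "op_norm S T = Sup {ell2_norm S (T x) |x. x \<in> ell2 S \<and> ell2_norm S x \<le> 1}"

definition op_adjoint :: "'a set \<Rightarrow> 'a ell2_op \<Rightarrow> 'a ell2_op" where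
  "op_adjoint S T = (THE T'. T' \<in> bounded_ops S \<and>
    (\<forall>x\<in>ell2 S. \<forall>y\<in>ell2 S. ell2_inner S (T x) y = ell2_inner S x (T' y)))"

definition spectrum :: "'a set \<Rightarrow> 'a ell2_op \<Rightarrow> complex set" where
  "spectrum S T = {z. \<not> (\<exists>R\<in>bounded_ops S. \<forall>x\<in>ell2 S.
    R (\<lambda>i. T x i - z * x i) = x \<and> (\<lambda>i. T (R x) i - z * R x i) = x)}"

definition op_poly :: "'a set \<Rightarrow> real poly \<Rightarrow> 'a ell2_op \<Rightarrow> 'a ell2_op" where
  "op_poly S p T = (\<lambda>x. if x \<in> ell2 S
    then (\<lambda>i. \<Sum>k\<le>degree p. of_real (coeff p k) * (T ^^ k) x i) else (\<lambda>_. 0))"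

text \<open>Continuous functional calculus, for a self-adjoint operator \<open>T\<close> and a real function \<open>h\<close>
  that is continuous on the (real) spectrum of \<open>T\<close>: \<open>h(T)\<close> is the limit in operator norm of
  \<open>p\<^sub>n(T)\<close>, for any real polynomials \<open>p\<^sub>n\<close> converging to \<open>h\<close> uniformly on the spectrum. Such
  polynomials exist by the Weierstrass theorem, and the limit exists and does not depend on them
  because the norm of \<open>p(T)\<close> is the supremum of \<open>\<bar>p\<bar>\<close> on the spectrum.\<close>

definition functional_calculus :: "'a set \<Rightarrow> (real \<Rightarrow> real) \<Rightarrow> 'a ell2_op \<Rightarrow> 'a ell2_op" where
  "functional_calculus S h T = (THE A. A \<in> bounded_ops S \<and>
    (\<forall>p :: nat \<Rightarrow> real poly.
      uniform_limit {r. complex_of_real r \<in> spectrum S T} (\<lambda>n. poly (p n)) h sequentially \<longrightarrow>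
      (\<lambda>n. op_norm S (\<lambda>x i. op_poly S (p n) T x i - A x i)) \<longlonglongrightarrow> 0))"

definition op_abs :: "'a set \<Rightarrow> 'a ell2_op \<Rightarrow> 'a ell2_op" where
  "op_abs S T = functional_calculus S sqrt (op_adjoint S T \<circ> T)"


section \<open>The Fuglede--Kadison determinant\<close>

text \<open>Left convolution, through which \<open>\<ell>\<^sup>1\<close> functions act as elements of the (left) group von
  Neumann algebra.\<close>

definition convolution_op :: "('a, 'c) monoid_scheme \<Rightarrow> ('a \<Rightarrow> real) \<Rightarrow> 'a ell2_op" where
  "convolution_op G f = (\<lambda>x. if x \<in> ell2 (carrier G)
    then convolution G (\<lambda>s. complex_of_real (f s)) x else (\<lambda>_. 0))"

definition group_trace :: "('a, 'c) monoid_scheme \<Rightarrow> 'a ell2_op \<Rightarrow> complex" where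
  "group_trace G T =
    ell2_inner (carrier G) (T (point_mass \<one>\<^bsub>G\<^esub>)) (point_mass \<one>\<^bsub>G\<^esub>)"

text \<open>Meaningful for \<open>T\<close> invertible in the group von Neumann algebra. The trace of the
  self-adjoint operator \<open>log \<bar>T\<bar>\<close> is real, so that taking its real part loses nothing.\<close>

definition fuglede_kadison_det :: "('a, 'c) monoid_scheme \<Rightarrow> 'a ell2_op \<Rightarrow> real" where
  "fuglede_kadison_det G T =
    exp (Re (group_trace G (functional_calculus (carrier G) ln (op_abs (carrier G) T))))"

end

theory Submission
  imports Defs "Jordan_Normal_Form.Schur_Decomposition"
begin

text \<open>Let \<open>L = f\<^sup>* f\<close>, a positive operator with \<open>c \<le> L \<le> C\<close> and \<open>c > 0\<close>, so that the logarithm of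
  the determinant is \<open>tr (log L) / 2\<close>. For a Folner set \<open>F\<close> the compression \<open>M\<close> of \<open>L\<close> to \<open>F\<close> is
  an integer matrix with eigenvalues in \<open>[c, C]\<close>, and approximating the logarithm by polynomials
  shows that \<open>log (det M) / |F|\<close> is asymptotically at most \<open>tr (log L)\<close>. On the other hand
  \<open>|det M|\<close> bounds the number of pairwise incongruent integer vectors modulo the lattice
  spanned by \<open>M\<close>. As \<open>f\<close> has no left inverse in the integral group ring, its \<open>\<ell>\<^sup>1\<close> inverse has a
  non-integral value. Hence the indicator functions of the subsets of a sufficiently separated
  set \<open>A\<close> in the interior of \<open>F\<close> are incongruent, so \<open>det M \<ge> 2 ^ |A|\<close>, and \<open>A\<close> can be chosen to
  have at least a fixed positive proportion of the points of \<open>F\<close>.\<close>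

section \<open>The space of square-summable families\<close>

text \<open>The approximate solution of the compressed equation is accurate only relative to the
  norm of the right-hand side, whose square is the number of its nonzero entries. A comparison with
  integers at a single point would therefore prove nothing: every nonzero entry must contribute the
  same distance \<open>d\<close> from the integers at a place of its own, and the squares of these
  distances are added. Separation provides the places. It is a condition on finitely many
  translations because the summable inverse is truncated to a finite support that keeps one
  non-integral value. A single polynomial close to half the logarithm on all of
  \<open>[c, C]\<close> controls both the eigenvalues of the matrices and the trace of the operator.
  The gain per point of \<open>F\<close> is fixed before the polynomial and the Folner set are
  chosen, so every remaining error can be made a small fraction of it. Adjoint, square root and
  logarithm are definite descriptions, so the calculus has to be shown to exist and to be unique.
  The starting point is that the square of the norm of a self-adjoint operator is an approximate
  eigenvalue of its square.\<close>

lemma ell2_summable: "x \<in> ell2 S \<Longrightarrow> (\<lambda>i. (cmod (x i))\<^sup>2) summable_on S"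
  by (simp add: ell2_def)

lemma ell2_outside: "x \<in> ell2 S \<Longrightarrow> i \<notin> S \<Longrightarrow> x i = 0"
  by (simp add: ell2_def)

lemma ell2_zero [simp]: "(\<lambda>_. 0) \<in> ell2 S"
  by (simp add: ell2_def)

lemma ell2_scale: "x \<in> ell2 S \<Longrightarrow> (\<lambda>i. c * x i) \<in> ell2 S"
  by (auto simp: ell2_def norm_mult power_mult_distrib intro: summable_on_cmult_right)

lemma ell2_add:
  assumes "x \<in> ell2 S" "y \<in> ell2 S"
  shows "(\<lambda>i. x i + y i) \<in> ell2 S"
proof -
  have "(\<lambda>i. (cmod (x i + y i))\<^sup>2) summable_on S"
  proof (rule summable_on_comparison_test)
    show "(\<lambda>i. 2 * (cmod (x i))\<^sup>2 + 2 * (cmod (y i))\<^sup>2) summable_on S"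
      using assms by (intro summable_on_add summable_on_cmult_right ell2_summable)
    fix i
    have "(cmod (x i + y i))\<^sup>2 \<le> (cmod (x i) + cmod (y i))\<^sup>2"
      by (intro power_mono norm_triangle_ineq) auto
    also have "\<dots> \<le> 2 * (cmod (x i))\<^sup>2 + 2 * (cmod (y i))\<^sup>2"
      using sum_squares_bound[of "cmod (x i)" "cmod (y i)"] by (simp add: power2_sum)
    finally show "(cmod (x i + y i))\<^sup>2 \<le> 2 * (cmod (x i))\<^sup>2 + 2 * (cmod (y i))\<^sup>2" .
  qed auto
  then show ?thesis using assms by (simp add: ell2_def)
qed

lemma ell2_diff: "x \<in> ell2 S \<Longrightarrow> y \<in> ell2 S \<Longrightarrow> (\<lambda>i. x i - y i) \<in> ell2 S"
  using ell2_add[OF _ ell2_scale[of y S "-1"]] by simp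

lemma ell2_sum:
  "(\<And>k. k \<in> A \<Longrightarrow> f k \<in> ell2 S) \<Longrightarrow> (\<lambda>i. \<Sum>k\<in>A. f k i) \<in> ell2 S"
  by (induction A rule: infinite_finite_induct) (auto intro: ell2_add)

lemma ell2_finite_support:
  assumes "finite {i. x i \<noteq> 0}" "{i. x i \<noteq> 0} \<subseteq> S"
  shows "x \<in> ell2 S"
proof -
  have "(\<lambda>i. (cmod (x i))\<^sup>2) summable_on S \<longleftrightarrow> (\<lambda>i. (cmod (x i))\<^sup>2) summable_on {i. x i \<noteq> 0}"
    using assms by (intro summable_on_cong_neutral) auto
  then show ?thesis using assms by (auto simp: ell2_def)
qed

lemma ell2_norm_finite_support:
  assumes "finite F" "{i. x i \<noteq> 0} \<subseteq> F" "F \<subseteq> S"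
  shows "(ell2_norm S x)\<^sup>2 = (\<Sum>i\<in>F. (cmod (x i))\<^sup>2)"
proof -
  have "(\<Sum>\<^sub>\<infinity>i\<in>S. (cmod (x i))\<^sup>2) = (\<Sum>\<^sub>\<infinity>i\<in>F. (cmod (x i))\<^sup>2)"
    using assms by (intro infsum_cong_neutral) auto
  also have "\<dots> = (\<Sum>i\<in>F. (cmod (x i))\<^sup>2)" using assms by simp
  finally show ?thesis by (simp add: ell2_norm_def sum_nonneg)
qed

lemma ell2_inner_finite_support:
  assumes "finite F" "{i. x i \<noteq> 0} \<inter> {i. y i \<noteq> 0} \<subseteq> F" "F \<subseteq> S"
  shows "ell2_inner S x y = (\<Sum>i\<in>F. x i * cnj (y i))"
proof -
  have "(\<Sum>\<^sub>\<infinity>i\<in>S. x i * cnj (y i)) = (\<Sum>\<^sub>\<infinity>i\<in>F. x i * cnj (y i))"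
    using assms by (intro infsum_cong_neutral) auto
  then show ?thesis using assms by (simp add: ell2_inner_def)
qed

lemma ell2_norm_nonneg [simp]: "0 \<le> ell2_norm S x"
  by (simp add: ell2_norm_def infsum_nonneg)

lemma ell2_norm_sq: "(ell2_norm S x)\<^sup>2 = (\<Sum>\<^sub>\<infinity>i\<in>S. (cmod (x i))\<^sup>2)"
  by (simp add: ell2_norm_def infsum_nonneg)

lemma ell2_norm_zero [simp]: "ell2_norm S (\<lambda>_. 0) = 0"
  by (simp add: ell2_norm_def)

lemma finite_sum_le_ell2_norm_sq:
  "x \<in> ell2 S \<Longrightarrow> finite F \<Longrightarrow> F \<subseteq> S \<Longrightarrow> (\<Sum>i\<in>F. (cmod (x i))\<^sup>2) \<le> (ell2_norm S x)\<^sup>2"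
  unfolding ell2_norm_sq by (intro finite_sum_le_infsum ell2_summable) auto

lemma cmod_le_ell2_norm:
  assumes "x \<in> ell2 S"
  shows "cmod (x i) \<le> ell2_norm S x"
proof (cases "i \<in> S")
  case True
  then have "(cmod (x i))\<^sup>2 \<le> (ell2_norm S x)\<^sup>2"
    using finite_sum_le_ell2_norm_sq[OF assms, of "{i}"] by simp
  then show ?thesis by (rule power2_le_imp_le) simp
qed (simp add: ell2_outside[OF assms])

lemma ell2_norm_eq_0: "x \<in> ell2 S \<Longrightarrow> ell2_norm S x = 0 \<Longrightarrow> x = (\<lambda>_. 0)"
  using cmod_le_ell2_norm[of x S] by fastforce

text \<open>Plays the role of Fatou's lemma: a bound on sums over finite sets of coordinates
  survives coordinatewise limits, and membership and norm of the limit can then be read off from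
  it.\<close>

lemma ell2_of_finite_sum_bounds:
  assumes "\<And>i. i \<notin> S \<Longrightarrow> y i = 0" "0 \<le> B"
    and b: "\<And>F. finite F \<Longrightarrow> F \<subseteq> S \<Longrightarrow> (\<Sum>i\<in>F. (cmod (y i))\<^sup>2) \<le> B\<^sup>2"
  shows "y \<in> ell2 S" "ell2_norm S y \<le> B"
proof -
  have s: "(\<lambda>i. (cmod (y i))\<^sup>2) summable_on S"
    using b by (intro nonneg_bdd_above_summable_on bdd_aboveI2[where M = "B\<^sup>2"]) auto
  then show "y \<in> ell2 S" using assms(1) by (simp add: ell2_def)
  have "(ell2_norm S y)\<^sup>2 \<le> B\<^sup>2"
    unfolding ell2_norm_sq using s b by (intro infsum_le_finite_sums)
  then show "ell2_norm S y \<le> B" using assms(2) by (rule power2_le_imp_le)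
qed

lemma ell2_norm_scale: "ell2_norm S (\<lambda>i. c * x i) = cmod c * ell2_norm S x"
  by (simp add: ell2_norm_def norm_mult power_mult_distrib infsum_cmult_right' real_sqrt_mult)

lemma ell2_norm_uminus: "ell2_norm S (\<lambda>i. - x i) = ell2_norm S x"
  by (simp add: ell2_norm_def)

lemma ell2_norm_minus_commute: "ell2_norm S (\<lambda>i. x i - y i) = ell2_norm S (\<lambda>i. y i - x i)"
  by (simp add: ell2_norm_def norm_minus_commute)

section \<open>Inner products, the Cauchy-Schwarz inequality and the triangle inequality\<close>

lemma ell2_inner_abs_summable:
  assumes "x \<in> ell2 S" "y \<in> ell2 S"
  shows "(\<lambda>i. cmod (x i * cnj (y i))) summable_on S"
proof (rule Infinite_Sum.abs_summable_on_comparison_test')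
  show "(\<lambda>i. (cmod (x i))\<^sup>2 + (cmod (y i))\<^sup>2) summable_on S"
    using assms by (intro summable_on_add ell2_summable)
  fix i
  have "2 * (cmod (x i) * cmod (y i)) \<le> (cmod (x i))\<^sup>2 + (cmod (y i))\<^sup>2"
    using sum_squares_bound[of "cmod (x i)" "cmod (y i)"] by simp
  moreover have "0 \<le> cmod (x i) * cmod (y i)" by simp
  ultimately show "norm (x i * cnj (y i)) \<le> (cmod (x i))\<^sup>2 + (cmod (y i))\<^sup>2"
    unfolding norm_mult complex_mod_cnj by linarith
qed

lemma ell2_inner_summable:
  "x \<in> ell2 S \<Longrightarrow> y \<in> ell2 S \<Longrightarrow> (\<lambda>i. x i * cnj (y i)) summable_on S"
  by (rule Infinite_Sum.abs_summable_summable[OF ell2_inner_abs_summable])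

lemma ell2_inner_add_left:
  assumes "x \<in> ell2 S" "y \<in> ell2 S" "z \<in> ell2 S"
  shows "ell2_inner S (\<lambda>i. x i + y i) z = ell2_inner S x z + ell2_inner S y z"
  unfolding ell2_inner_def using assms
  by (simp add: distrib_right infsum_add ell2_inner_summable)

lemma ell2_inner_scale_left: "ell2_inner S (\<lambda>i. c * x i) y = c * ell2_inner S x y"
  unfolding ell2_inner_def by (simp add: mult.assoc infsum_cmult_right')

lemma ell2_inner_commute: "ell2_inner S x y = cnj (ell2_inner S y x)"
  unfolding ell2_inner_def infsum_cnj[symmetric] by (simp add: mult.commute)

lemma ell2_inner_diff_left:
  assumes "x \<in> ell2 S" "y \<in> ell2 S" "z \<in> ell2 S"
  shows "ell2_inner S (\<lambda>i. x i - y i) z = ell2_inner S x z - ell2_inner S y z"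
  using ell2_inner_add_left[OF assms(1) ell2_scale[OF assms(2), of "-1"] assms(3)]
    ell2_inner_scale_left[of S "-1" y z] by simp

lemma ell2_inner_add_right:
  assumes "x \<in> ell2 S" "y \<in> ell2 S" "z \<in> ell2 S"
  shows "ell2_inner S z (\<lambda>i. x i + y i) = ell2_inner S z x + ell2_inner S z y"
  using ell2_inner_add_left[OF assms] by (metis complex_cnj_add ell2_inner_commute)

lemma ell2_inner_diff_right:
  assumes "x \<in> ell2 S" "y \<in> ell2 S" "z \<in> ell2 S"
  shows "ell2_inner S z (\<lambda>i. x i - y i) = ell2_inner S z x - ell2_inner S z y"
  using ell2_inner_diff_left[OF assms] by (metis complex_cnj_diff ell2_inner_commute)

lemma ell2_inner_scale_right: "ell2_inner S y (\<lambda>i. c * x i) = cnj c * ell2_inner S y x"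
  by (metis complex_cnj_mult ell2_inner_commute ell2_inner_scale_left)

lemma ell2_inner_self:
  assumes "x \<in> ell2 S"
  shows "ell2_inner S x x = of_real ((ell2_norm S x)\<^sup>2)"
proof -
  have "ell2_inner S x x = (\<Sum>\<^sub>\<infinity>i\<in>S. of_real ((cmod (x i))\<^sup>2))"
    unfolding ell2_inner_def by (simp only: complex_norm_square)
  also have "\<dots> = of_real (\<Sum>\<^sub>\<infinity>i\<in>S. (cmod (x i))\<^sup>2)"
    by (intro infsumI has_sum_of_real has_sum_infsum ell2_summable assms)
  finally show ?thesis unfolding ell2_norm_sq .
qed

lemma ell2_Cauchy_Schwarz:
  assumes x: "x \<in> ell2 S" and y: "y \<in> ell2 S"
  shows "cmod (ell2_inner S x y) \<le> ell2_norm S x * ell2_norm S y"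
proof (cases "ell2_norm S x = 0 \<or> ell2_norm S y = 0")
  case True
  then have "x = (\<lambda>_. 0) \<or> y = (\<lambda>_. 0)" using ell2_norm_eq_0 assms by blast
  then show ?thesis by (auto simp: ell2_inner_def)
next
  case False
  define a b where "a = ell2_norm S x" and "b = ell2_norm S y"
  have ab: "a > 0" "b > 0" using False ell2_norm_nonneg[of S] by (auto simp: a_def b_def less_le)
  have "cmod (ell2_inner S x y) \<le> (\<Sum>\<^sub>\<infinity>i\<in>S. cmod (x i * cnj (y i)))"
    unfolding ell2_inner_def by (rule norm_infsum_bound[OF ell2_inner_abs_summable[OF x y]])
  \<comment> \<open>The arithmetic-geometric inequality is weighted by \<open>b / (2 * a)\<close>
    and \<open>a / (2 * b)\<close>, so that after summation each of the two terms contributes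
    exactly \<open>a * b / 2\<close>.\<close>
  also have "\<dots> \<le> (\<Sum>\<^sub>\<infinity>i\<in>S. b / (2 * a) * (cmod (x i))\<^sup>2 + a / (2 * b) * (cmod (y i))\<^sup>2)"
  proof (rule infsum_mono[OF ell2_inner_abs_summable[OF x y]])
    show "(\<lambda>i. b / (2 * a) * (cmod (x i))\<^sup>2 + a / (2 * b) * (cmod (y i))\<^sup>2) summable_on S"
      using x y by (intro summable_on_add summable_on_cmult_right ell2_summable)
    fix i
    have "0 \<le> (b * cmod (x i) - a * cmod (y i))\<^sup>2" by simp
    then have "2 * (a * b) * (cmod (x i) * cmod (y i)) \<le> (b * cmod (x i))\<^sup>2 + (a * cmod (y i))\<^sup>2"
      by (simp add: power2_diff algebra_simps)
    then show "cmod (x i * cnj (y i)) \<le> b / (2 * a) * (cmod (x i))\<^sup>2 + a / (2 * b) * (cmod (y i))\<^sup>2"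
      using ab by (simp add: norm_mult field_simps power2_eq_square)
  qed
  also have "\<dots> = b / (2 * a) * a\<^sup>2 + a / (2 * b) * b\<^sup>2"
    unfolding a_def b_def ell2_norm_sq using x y
    by (subst infsum_add) (auto intro: summable_on_cmult_right ell2_summable simp:
        infsum_cmult_right' simp del: times_divide_eq_left)
  also have "\<dots> = a * b" using ab by (simp add: power2_eq_square)
  finally show ?thesis by (simp add: a_def b_def)
qed

lemma ell2_norm_sq_add:
  assumes "x \<in> ell2 S" "y \<in> ell2 S"
  shows "(ell2_norm S (\<lambda>i. x i + y i))\<^sup>2 =
    (ell2_norm S x)\<^sup>2 + 2 * Re (ell2_inner S x y) + (ell2_norm S y)\<^sup>2"
proof -
  have xy: "(\<lambda>i. x i + y i) \<in> ell2 S" using assms by (rule ell2_add)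
  have "complex_of_real ((ell2_norm S (\<lambda>i. x i + y i))\<^sup>2) =
      (ell2_inner S x x + ell2_inner S y x) + (ell2_inner S x y + ell2_inner S y y)"
    unfolding ell2_inner_self[OF xy, symmetric] ell2_inner_add_right[OF assms xy]
      ell2_inner_add_left[OF assms assms(1)] ell2_inner_add_left[OF assms assms(2)] ..
  then have "(ell2_norm S (\<lambda>i. x i + y i))\<^sup>2 =
      (Re (ell2_inner S x x) + Re (ell2_inner S y x)) + (Re (ell2_inner S x y) + Re (ell2_inner S
          y y))"
    by (metis Re_complex_of_real plus_complex.sel(1))
  moreover have "Re (ell2_inner S y x) = Re (ell2_inner S x y)"
    using ell2_inner_commute[of S y x] by simp
  ultimately show ?thesis
    using assms by (simp add: ell2_inner_self)
qed

lemma ell2_norm_triangle: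
  assumes "x \<in> ell2 S" "y \<in> ell2 S"
  shows "ell2_norm S (\<lambda>i. x i + y i) \<le> ell2_norm S x + ell2_norm S y"
proof (rule power2_le_imp_le)
  have "Re (ell2_inner S x y) \<le> ell2_norm S x * ell2_norm S y"
    using complex_Re_le_cmod ell2_Cauchy_Schwarz[OF assms] by (rule order_trans)
  then show "(ell2_norm S (\<lambda>i. x i + y i))\<^sup>2 \<le> (ell2_norm S x + ell2_norm S y)\<^sup>2"
    by (simp add: ell2_norm_sq_add[OF assms] power2_sum)
qed simp

lemma ell2_norm_triangle_diff:
  assumes "x \<in> ell2 S" "y \<in> ell2 S" "z \<in> ell2 S"
  shows "ell2_norm S (\<lambda>i. x i - z i) \<le> ell2_norm S (\<lambda>i. x i - y i) + ell2_norm S (\<lambda>i. y i - z i)"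
  using ell2_norm_triangle[OF ell2_diff[OF assms(1,2)] ell2_diff[OF assms(2,3)]] by simp

lemma ell2_norm_triangle':
  assumes "x \<in> ell2 S" "y \<in> ell2 S"
  shows "ell2_norm S x \<le> ell2_norm S (\<lambda>i. x i - y i) + ell2_norm S y"
  using ell2_norm_triangle[OF ell2_diff[OF assms] assms(2)] by simp

lemma ell2_norm_diff_le:
  assumes "x \<in> ell2 S" "y \<in> ell2 S"
  shows "ell2_norm S (\<lambda>i. x i - y i) \<le> ell2_norm S x + ell2_norm S y"
  using ell2_norm_triangle[OF assms(1) ell2_scale[OF assms(2), of "-1"]]
  by (simp add: ell2_norm_uminus)

lemma ell2_norm_sq_diff:
  assumes "x \<in> ell2 S" "y \<in> ell2 S"
  shows "(ell2_norm S (\<lambda>i. x i - y i))\<^sup>2 =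
    (ell2_norm S x)\<^sup>2 - 2 * Re (ell2_inner S x y) + (ell2_norm S y)\<^sup>2"
  using ell2_norm_sq_add[OF assms(1) ell2_scale[OF assms(2), of "-1"]]
    ell2_inner_scale_right[of S x "-1" y]
  by (simp add: ell2_norm_uminus)

lemma ell2_norm_sum:
  "(\<And>k. k \<in> A \<Longrightarrow> f k \<in> ell2 S) \<Longrightarrow>
    ell2_norm S (\<lambda>i. \<Sum>k\<in>A. f k i) \<le> (\<Sum>k\<in>A. ell2_norm S (f k))"
proof (induction A rule: infinite_finite_induct)
  case (insert a A)
  then show ?case
    using ell2_norm_triangle[of "f a" S "\<lambda>i. \<Sum>k\<in>A. f k i"] by (fastforce intro: ell2_sum)
qed auto

lemma ell2_eqI_inner:
  assumes "x \<in> ell2 S" "y \<in> ell2 S" "\<And>z. z \<in> ell2 S \<Longrightarrow> ell2_inner S z x = ell2_inner S z y"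
  shows "x = y"
proof -
  let ?d = "\<lambda>i. x i - y i"
  have d: "?d \<in> ell2 S" using assms by (intro ell2_diff)
  have "ell2_inner S ?d ?d = 0"
    using ell2_inner_diff_right[OF assms(1,2) d] assms(3)[OF d] by simp
  then have "?d = (\<lambda>_. 0)" using ell2_inner_self[OF d] by (intro ell2_norm_eq_0[OF d]) simp
  then show ?thesis by (metis eq_iff_diff_eq_0 ext)
qed

section \<open>Bounded operators and polynomials of an operator\<close>

lemma bounded_ops_mem: "T \<in> bounded_ops S \<Longrightarrow> x \<in> ell2 S \<Longrightarrow> T x \<in> ell2 S"
  by (simp add: bounded_ops_def)

lemma bounded_ops_add: "T \<in> bounded_ops S \<Longrightarrow> x \<in> ell2 S \<Longrightarrow> y \<in> ell2 S \<Longrightarrow>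
    T (\<lambda>i. x i + y i) = (\<lambda>i. T x i + T y i)"
  by (simp add: bounded_ops_def)

lemma bounded_ops_scale: "T \<in> bounded_ops S \<Longrightarrow> x \<in> ell2 S \<Longrightarrow> T (\<lambda>i. c * x i) = (\<lambda>i. c * T x i)"
  by (simp add: bounded_ops_def)

lemma bounded_ops_diff:
  assumes "T \<in> bounded_ops S" "x \<in> ell2 S" "y \<in> ell2 S"
  shows "T (\<lambda>i. x i - y i) = (\<lambda>i. T x i - T y i)"
  using bounded_ops_add[OF assms(1,2) ell2_scale[OF assms(3), of "-1"]]
    bounded_ops_scale[OF assms(1,3), of "-1"] by simp

lemma bounded_ops_zero: "T \<in> bounded_ops S \<Longrightarrow> T (\<lambda>_. 0) = (\<lambda>_. 0)"
  using bounded_ops_scale[of T S "\<lambda>_. 0" 0] by simp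

lemma bounded_ops_outside: "T \<in> bounded_ops S \<Longrightarrow> x \<notin> ell2 S \<Longrightarrow> T x = (\<lambda>_. 0)"
  by (simp add: bounded_ops_def)

lemma bounded_ops_bound:
  assumes "T \<in> bounded_ops S"
  obtains B where "0 \<le> B" "\<And>x. x \<in> ell2 S \<Longrightarrow> ell2_norm S (T x) \<le> B * ell2_norm S x"
proof -
  obtain B where B: "\<forall>x\<in>ell2 S. ell2_norm S (T x) \<le> B * ell2_norm S x"
    using assms unfolding bounded_ops_def by blast
  then have "ell2_norm S (T x) \<le> max B 0 * ell2_norm S x" if "x \<in> ell2 S" for x
    using that by (meson ell2_norm_nonneg max.cobounded1 mult_right_mono order_trans)
  then show thesis using that[of "max B 0"] by auto
qed

lemma bounded_opsI:
  assumes "\<And>x. x \<in> ell2 S \<Longrightarrow> T x \<in> ell2 S"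
    and "\<And>x y. x \<in> ell2 S \<Longrightarrow> y \<in> ell2 S \<Longrightarrow> T (\<lambda>i. x i + y i) = (\<lambda>i. T x i + T y i)"
    and "\<And>c x. x \<in> ell2 S \<Longrightarrow> T (\<lambda>i. c * x i) = (\<lambda>i. c * T x i)"
    and "\<And>x. x \<in> ell2 S \<Longrightarrow> ell2_norm S (T x) \<le> B * ell2_norm S x"
    and "\<And>x. x \<notin> ell2 S \<Longrightarrow> T x = (\<lambda>_. 0)"
  shows "T \<in> bounded_ops S"
  using assms unfolding bounded_ops_def by blast

lemma bounded_ops_eqI:
  assumes "A \<in> bounded_ops S" "B \<in> bounded_ops S" "\<And>x. x \<in> ell2 S \<Longrightarrow> A x = B x"
  shows "A = B"
  using assms bounded_ops_outside by (metis ext)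

section \<open>The operator norm\<close>

lemma op_norm_le:
  assumes "0 \<le> B" "\<And>x. x \<in> ell2 S \<Longrightarrow> ell2_norm S (T x) \<le> B * ell2_norm S x"
  shows "op_norm S T \<le> B"
  unfolding op_norm_def
proof (rule cSup_least)
  show "{ell2_norm S (T x) |x. x \<in> ell2 S \<and> ell2_norm S x \<le> 1} \<noteq> {}"
    by (auto intro: exI[of _ "\<lambda>_. 0"])
  fix r assume "r \<in> {ell2_norm S (T x) |x. x \<in> ell2 S \<and> ell2_norm S x \<le> 1}"
  then obtain x where "r = ell2_norm S (T x)" "x \<in> ell2 S" "ell2_norm S x \<le> 1" by blast
  then show "r \<le> B" using assms(2)[of x] mult_left_le[of "ell2_norm S x" B] assms(1) by simp
qed

lemma op_norm_bdd_above:
  assumes "\<And>x. x \<in> ell2 S \<Longrightarrow> ell2_norm S (T x) \<le> B * ell2_norm S x"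
  shows "bdd_above {ell2_norm S (T x) |x. x \<in> ell2 S \<and> ell2_norm S x \<le> 1}"
proof (rule bdd_aboveI)
  fix r assume "r \<in> {ell2_norm S (T x) |x. x \<in> ell2 S \<and> ell2_norm S x \<le> 1}"
  then obtain x where "r = ell2_norm S (T x)" "x \<in> ell2 S" "ell2_norm S x \<le> 1" by blast
  moreover have "B * ell2_norm S x \<le> \<bar>B\<bar> * 1"
    using \<open>ell2_norm S x \<le> 1\<close> by (meson abs_ge_self abs_ge_zero ell2_norm_nonneg mult_mono)
  ultimately show "r \<le> \<bar>B\<bar>" using assms[of x] by simp
qed

lemma op_norm_nonneg:
  assumes "\<And>x. x \<in> ell2 S \<Longrightarrow> ell2_norm S (T x) \<le> B * ell2_norm S x"
  shows "0 \<le> op_norm S T"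
proof -
  have "ell2_norm S (T (\<lambda>_. 0)) \<le> op_norm S T"
    unfolding op_norm_def using op_norm_bdd_above[OF assms]
    by (intro cSup_upper) (auto intro: exI[of _ "\<lambda>_. 0"])
  then show ?thesis by (meson ell2_norm_nonneg order_trans)
qed

text \<open>Rescaling to norm one. Homogeneity and some bound \<open>B\<close> are asked for instead
  of membership in \<open>bounded_ops\<close>, so that the lemma applies directly to differences of
  operators such as those in \<open>functional_calculus\<close>; \<open>B\<close> makes the supremum
  meaningful.\<close>

lemma op_norm_bound:
  assumes b: "\<And>x. x \<in> ell2 S \<Longrightarrow> ell2_norm S (T x) \<le> B * ell2_norm S x"
    and hom: "\<And>c x. x \<in> ell2 S \<Longrightarrow> T (\<lambda>i. c * x i) = (\<lambda>i. c * T x i)"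
    and x: "x \<in> ell2 S"
  shows "ell2_norm S (T x) \<le> op_norm S T * ell2_norm S x"
proof (cases "ell2_norm S x = 0")
  case True
  then show ?thesis using b[OF x] by simp
next
  case False
  define n where "n = ell2_norm S x"
  have n: "n > 0" using False ell2_norm_nonneg[of S x] by (simp add: n_def less_le)
  let ?y = "\<lambda>i. of_real (1 / n) * x i"
  have y: "?y \<in> ell2 S" using x by (rule ell2_scale)
  have "ell2_norm S ?y = 1" using n by (simp only: ell2_norm_scale norm_of_real) (simp add: n_def)
  then have "ell2_norm S (T ?y) \<le> op_norm S T"
    unfolding op_norm_def using y op_norm_bdd_above[OF b] by (intro cSup_upper) auto
  moreover have "ell2_norm S (T ?y) = ell2_norm S (T x) / n"
    using n by (simp only: hom[OF x] ell2_norm_scale norm_of_real) simp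
  ultimately show ?thesis using n by (simp add: n_def field_simps)
qed

lemma op_norm_witness:
  assumes "m < op_norm S T"
  obtains x where "x \<in> ell2 S" "ell2_norm S x \<le> 1" "m < ell2_norm S (T x)"
proof -
  have "\<exists>r\<in>{ell2_norm S (T x) |x. x \<in> ell2 S \<and> ell2_norm S x \<le> 1}. m < r"
    using assms unfolding op_norm_def by (rule less_cSupD[rotated]) (auto intro: exI[of _ "\<lambda>_. 0"])
  then show thesis using that by blast
qed

text \<open>Complex coefficients allow factorization into linear factors. Unlike
  \<open>op_poly\<close> there is no cut-off outside \<open>ell2 S\<close>, so the Horner recursion
  \<open>cpoly_op_pCons\<close> holds for every vector and carries the inductions below.\<close>

definition cpoly_op :: "complex poly \<Rightarrow> 'a ell2_op \<Rightarrow> 'a ell2_op" where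
  "cpoly_op p T x = (\<lambda>i. \<Sum>k\<le>degree p. coeff p k * (T ^^ k) x i)"

lemma cpoly_op_0 [simp]: "cpoly_op 0 T x = (\<lambda>_. 0)"
  by (simp add: cpoly_op_def)

lemma cpoly_op_pCons: "cpoly_op (pCons a p) T x = (\<lambda>i. a * x i + cpoly_op p T (T x) i)"
proof (cases "p = 0")
  case False
  then show ?thesis
    by (simp add: cpoly_op_def sum.atMost_Suc_shift funpow_Suc_right del: funpow.simps
        sum.atMost_Suc)
qed (simp add: cpoly_op_def)

lemma op_poly_eq_cpoly_op:
  "x \<in> ell2 S \<Longrightarrow> op_poly S p T x = cpoly_op (map_poly of_real p) T x"
  by (simp add: op_poly_def cpoly_op_def degree_map_poly coeff_map_poly)

lemma op_poly_outside: "x \<notin> ell2 S \<Longrightarrow> op_poly S p T x = (\<lambda>_. 0)"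
  by (simp add: op_poly_def)

context
  fixes S :: "'a set" and T :: "'a ell2_op"
  assumes T: "T \<in> bounded_ops S"
begin

lemma cpoly_op_mem: "x \<in> ell2 S \<Longrightarrow> cpoly_op p T x \<in> ell2 S"
  by (induction p arbitrary: x)
     (auto simp: cpoly_op_pCons intro!: ell2_add ell2_scale bounded_ops_mem[OF T])

lemma cpoly_op_apply: "x \<in> ell2 S \<Longrightarrow> T (cpoly_op p T x) = cpoly_op p T (T x)"
proof (induction p arbitrary: x)
  case 0
  then show ?case using bounded_ops_zero[OF T] by simp
next
  case (pCons a p)
  then show ?case
    by (simp add: cpoly_op_pCons bounded_ops_add[OF T] bounded_ops_scale[OF T] ell2_scale
      cpoly_op_mem bounded_ops_mem[OF T])
qed

lemma cpoly_op_vadd: "x \<in> ell2 S \<Longrightarrow> y \<in> ell2 S \<Longrightarrow>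
    cpoly_op p T (\<lambda>i. x i + y i) = (\<lambda>i. cpoly_op p T x i + cpoly_op p T y i)"
proof (induction p arbitrary: x y)
  case (pCons a p)
  show ?case
    unfolding cpoly_op_pCons bounded_ops_add[OF T pCons.prems]
    using pCons.IH[OF bounded_ops_mem[OF T pCons.prems(1)] bounded_ops_mem[OF T pCons.prems(2)]]
    by (auto simp: algebra_simps)
qed simp

lemma cpoly_op_vscale: "x \<in> ell2 S \<Longrightarrow>
    cpoly_op p T (\<lambda>i. c * x i) = (\<lambda>i. c * cpoly_op p T x i)"
proof (induction p arbitrary: x)
  case (pCons a p)
  show ?case
    unfolding cpoly_op_pCons bounded_ops_scale[OF T pCons.prems]
    using pCons.IH[OF bounded_ops_mem[OF T pCons.prems(1)]]
    by (auto simp: algebra_simps)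
qed simp

lemma cpoly_op_bound:
  obtains B where "0 \<le> B" "\<And>x. x \<in> ell2 S \<Longrightarrow> ell2_norm S (cpoly_op p T x) \<le> B * ell2_norm S x"
proof -
  have "\<exists>B\<ge>0. \<forall>x\<in>ell2 S. ell2_norm S (cpoly_op p T x) \<le> B * ell2_norm S x"
  proof (induction p)
    case (pCons a p)
    obtain B where B: "0 \<le> B" "\<And>x. x \<in> ell2 S \<Longrightarrow> ell2_norm S (cpoly_op p T x) \<le> B * ell2_norm S x"
      using pCons by blast
    obtain C where C: "0 \<le> C" "\<And>x. x \<in> ell2 S \<Longrightarrow> ell2_norm S (T x) \<le> C * ell2_norm S x"
      using bounded_ops_bound[OF T] by blast
    have "ell2_norm S (cpoly_op (pCons a p) T x) \<le> (cmod a + B * C) * ell2_norm S x"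
      if x: "x \<in> ell2 S" for x
    proof -
      have "ell2_norm S (cpoly_op (pCons a p) T x)
          \<le> cmod a * ell2_norm S x + ell2_norm S (cpoly_op p T (T x))"
        unfolding cpoly_op_pCons
        using ell2_norm_triangle[OF ell2_scale[OF x] cpoly_op_mem[OF bounded_ops_mem[OF T x]]]
        by (simp add: ell2_norm_scale)
      also have "ell2_norm S (cpoly_op p T (T x)) \<le> B * (C * ell2_norm S x)"
        using B(2)[OF bounded_ops_mem[OF T x]] C(2)[OF x] B(1) by (meson mult_left_mono order_trans)
      finally show ?thesis by (simp add: algebra_simps)
    qed
    then show ?case using B(1) C(1) by (intro exI[of _ "cmod a + B * C"]) auto
  qed auto
  then show thesis using that by blast
qed

lemma cpoly_op_add: "cpoly_op (p + q) T x = (\<lambda>i. cpoly_op p T x i + cpoly_op q T x i)"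
  by (induction p q arbitrary: x rule: poly_induct2) (auto simp: cpoly_op_pCons algebra_simps)

lemma cpoly_op_smult: "cpoly_op (Polynomial.smult c p) T x = (\<lambda>i. c * cpoly_op p T x i)"
  by (induction p arbitrary: x) (auto simp: cpoly_op_pCons algebra_simps)

lemma cpoly_op_diff: "cpoly_op (p - q) T x = (\<lambda>i. cpoly_op p T x i - cpoly_op q T x i)"
  using cpoly_op_add[of p "Polynomial.smult (-1) q" x] cpoly_op_smult[of "-1" q x] by simp

lemma cpoly_op_mult: "x \<in> ell2 S \<Longrightarrow> cpoly_op (p * q) T x = cpoly_op p T (cpoly_op q T x)"
proof (induction p arbitrary: x)
  case (pCons a p)
  show ?case
    using pCons.IH[OF bounded_ops_mem[OF T pCons.prems]]
    by (simp add: mult_pCons_left cpoly_op_add cpoly_op_smult cpoly_op_pCons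
      cpoly_op_apply pCons.prems)
qed simp

lemma bounded_ops_op_poly: "op_poly S p T \<in> bounded_ops S"
proof -
  obtain B where B: "0 \<le> B" "\<And>x. x \<in> ell2 S \<Longrightarrow>
      ell2_norm S (cpoly_op (map_poly of_real p) T x) \<le> B * ell2_norm S x"
    using cpoly_op_bound by blast
  show ?thesis
    by (rule bounded_opsI[where B = B])
       (simp_all add: op_poly_eq_cpoly_op cpoly_op_mem cpoly_op_vadd cpoly_op_vscale
        ell2_add ell2_scale B op_poly_outside)
qed

lemma op_poly_pCons: "x \<in> ell2 S \<Longrightarrow>
    op_poly S (pCons a p) T x = (\<lambda>i. of_real a * x i + op_poly S p T (T x) i)"
  by (simp add: op_poly_eq_cpoly_op bounded_ops_mem[OF T] Polynomial.map_poly_pCons cpoly_op_pCons)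

lemma op_poly_diff: "x \<in> ell2 S \<Longrightarrow>
    op_poly S (p - q) T x = (\<lambda>i. op_poly S p T x i - op_poly S q T x i)"
proof -
  have "map_poly complex_of_real (p - q) = map_poly of_real p - map_poly of_real q"
    by (intro poly_eqI) (simp add: coeff_map_poly)
  then show "x \<in> ell2 S \<Longrightarrow> ?thesis" by (simp add: op_poly_eq_cpoly_op cpoly_op_diff)
qed

lemma op_poly_mult: "x \<in> ell2 S \<Longrightarrow> op_poly S (p * q) T x = op_poly S p T (op_poly S q T x)"
proof -
  have "map_poly complex_of_real (p * q) = map_poly of_real p * map_poly of_real q"
    by (intro poly_eqI) (simp add: coeff_map_poly coeff_mult)
  then show "x \<in> ell2 S \<Longrightarrow> ?thesis"
    by (simp add: op_poly_eq_cpoly_op cpoly_op_mult cpoly_op_mem)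
qed

lemma op_poly_apply: "x \<in> ell2 S \<Longrightarrow> T (op_poly S p T x) = op_poly S p T (T x)"
  by (simp add: op_poly_eq_cpoly_op cpoly_op_apply bounded_ops_mem[OF T])

end

lemma op_poly_0: "op_poly S 0 T = (\<lambda>x. (\<lambda>_. 0))"
  by (auto simp: op_poly_def)

lemma op_poly_const: "x \<in> ell2 S \<Longrightarrow> op_poly S [:a:] T x = (\<lambda>i. of_real a * x i)"
  by (simp add: op_poly_def)

section \<open>Self-adjoint operators and the approximate point spectrum\<close>

definition self_adjoint :: "'a set \<Rightarrow> 'a ell2_op \<Rightarrow> bool" where
  "self_adjoint S T \<longleftrightarrow> (\<forall>x\<in>ell2 S. \<forall>y\<in>ell2 S. ell2_inner S (T x) y = ell2_inner S x (T y))"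

lemma self_adjoint_op_poly:
  assumes T: "T \<in> bounded_ops S" and sa: "self_adjoint S T"
  shows "self_adjoint S (op_poly S p T)"
proof -
  have "ell2_inner S (op_poly S p T x) y = ell2_inner S x (op_poly S p T y)"
    if "x \<in> ell2 S" "y \<in> ell2 S" for x y
    using that
  proof (induction p arbitrary: x y)
    case 0
    then show ?case by (simp add: op_poly_0 ell2_inner_def)
  next
    case (pCons a p)
    have p: "op_poly S p T z \<in> ell2 S" if "z \<in> ell2 S" for z
      using that bounded_ops_mem[OF bounded_ops_op_poly[OF T]] by blast
    have "ell2_inner S (op_poly S p T (T x)) y = ell2_inner S x (op_poly S p T (T y))"
      using pCons.IH[OF bounded_ops_mem[OF T pCons.prems(1)] pCons.prems(2)] sa pCons.prems
        op_poly_apply[OF T pCons.prems(2), of p] p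
      by (simp add: self_adjoint_def)
    then show ?case using pCons.prems p bounded_ops_mem[OF T]
      by (simp add: op_poly_pCons[OF T] ell2_inner_add_left ell2_inner_add_right
        ell2_inner_scale_left ell2_inner_scale_right ell2_scale)
  qed
  then show ?thesis by (simp add: self_adjoint_def)
qed

text \<open>The strict inequality excludes the zero vector. For self-adjoint operators, approximate
  eigenvalues supply spectral points without any construction of resolvents.\<close>

definition approx_eigenvalue :: "'a set \<Rightarrow> 'a ell2_op \<Rightarrow> complex \<Rightarrow> bool" where
  "approx_eigenvalue S T z \<longleftrightarrow>
    (\<forall>\<delta>>0. \<exists>x\<in>ell2 S. ell2_norm S (\<lambda>i. T x i - z * x i) < \<delta> * ell2_norm S x)"

text \<open>Being bounded below is preserved by composition: if every linear factor
  \<open>T - z\<close> of \<open>q(T)\<close> were bounded below, then so would be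
  \<open>q(T)\<close>. This is the half of the spectral mapping theorem used for the norm of a
  polynomial in \<open>T\<close>.\<close>

lemma approx_eigenvalue_of_poly:
  assumes T: "T \<in> bounded_ops S" and q: "q \<noteq> 0"
    and small: "\<And>\<delta>. \<delta> > 0 \<Longrightarrow> \<exists>x\<in>ell2 S. ell2_norm S (cpoly_op q T x) < \<delta> * ell2_norm S x"
  shows "\<exists>z. poly q z = 0 \<and> approx_eigenvalue S T z"
proof -
  obtain as where as: "Polynomial.smult (coeff q (degree q)) (\<Prod>a\<leftarrow>as. [:- a, 1:]) = q"
    using fundamental_theorem_algebra_factorized[of q] by blast
  define c where "c = coeff q (degree q)"
  have c: "c \<noteq> 0" using q by (simp add: c_def)
  have "\<exists>z\<in>set bs. approx_eigenvalue S T z"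
    if "\<And>\<delta>. \<delta> > 0 \<Longrightarrow> \<exists>x\<in>ell2 S.
      ell2_norm S (cpoly_op (Polynomial.smult c (\<Prod>a\<leftarrow>bs. [:- a, 1:])) T x) < \<delta> * ell2_norm S x" for
          bs
    using that
  proof (induction bs)
    case Nil
    \<comment> \<open>The empty product leaves the scalar \<open>c\<close>, which multiplies norms
      by exactly \<open>cmod c\<close>; smallness with this value of \<delta> is
      contradictory.\<close>
    from Nil[of "cmod c"] c show ?case
      by (auto simp: one_pCons cpoly_op_pCons ell2_norm_scale)
  next
    case (Cons b bs)
    show ?case
    proof (cases "approx_eigenvalue S T b")
      case False
      then obtain \<delta> where \<delta>: "\<delta> > 0"
        "\<And>x. x \<in> ell2 S \<Longrightarrow> ell2_norm S (\<lambda>i. T x i - b * x i) \<ge> \<delta> * ell2_norm S x"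
        unfolding approx_eigenvalue_def by (meson not_le)
      let ?p = "Polynomial.smult c (\<Prod>a\<leftarrow>bs. [:- a, 1:])"
      \<comment> \<open>\<open>T - b\<close> is bounded below by \<delta>, so smallness
        \<open>\<delta> * e\<close> of the full product forces smallness \<open>e\<close> of the
        product over the remaining roots.\<close>
      have "\<exists>z\<in>set bs. approx_eigenvalue S T z"
      proof (rule Cons.IH)
        fix e :: real assume "e > 0"
        then obtain x where x: "x \<in> ell2 S"
          "ell2_norm S (cpoly_op (Polynomial.smult c (\<Prod>a\<leftarrow>b # bs. [:- a, 1:])) T x) < (\<delta> * e) *
              ell2_norm S x"
          using Cons.prems[of "\<delta> * e"] \<delta>(1) by auto
        have "Polynomial.smult c (\<Prod>a\<leftarrow>b # bs. [:- a, 1:]) = [:- b, 1:] * ?p"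
          by (metis list.simps(9) mult_smult_right prod_list.Cons)
        then have "cpoly_op (Polynomial.smult c (\<Prod>a\<leftarrow>b # bs. [:- a, 1:])) T x =
            (\<lambda>i. T (cpoly_op ?p T x) i - b * cpoly_op ?p T x i)"
          using cpoly_op_mult[OF T x(1), of "[:- b, 1:]" ?p] by (simp add: cpoly_op_pCons)
        then have "\<delta> * ell2_norm S (cpoly_op ?p T x) < \<delta> * (e * ell2_norm S x)"
          using x(2) \<delta>(2)[OF cpoly_op_mem[OF T x(1), of ?p]] by (simp add: mult.assoc)
        then show "\<exists>x\<in>ell2 S. ell2_norm S (cpoly_op ?p T x) < e * ell2_norm S x"
          using \<delta>(1) x(1) by auto
      qed
      then show ?thesis by auto
    qed auto
  qed
  from this[of as] small as obtain z where z: "z \<in> set as" "approx_eigenvalue S T z"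
    unfolding c_def by metis
  have "poly (\<Prod>a\<leftarrow>as. [:- a, 1:]) z = 0" using z(1) by (induction as) auto
  then have "poly q z = 0" by (metis as poly_smult mult_zero_right)
  then show ?thesis using z(2) by blast
qed

text \<open>An approximate eigenvalue is a limit of Rayleigh quotients; these are real by
  self-adjointness and lie in \<open>[c, C]\<close> by the bounds on the quadratic form.\<close>

lemma approx_eigenvalue_real:
  assumes T: "T \<in> bounded_ops S" and sa: "self_adjoint S T"
    and bounds: "\<And>x. x \<in> ell2 S \<Longrightarrow> c * (ell2_norm S x)\<^sup>2 \<le> Re (ell2_inner S (T x) x)"
      "\<And>x. x \<in> ell2 S \<Longrightarrow> Re (ell2_inner S (T x) x) \<le> C * (ell2_norm S x)\<^sup>2"
    and z: "approx_eigenvalue S T z"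
  shows "z = of_real (Re z)" "c \<le> Re z" "Re z \<le> C"
proof -
  have key: "\<exists>x\<in>ell2 S. ell2_norm S x > 0 \<and>
      cmod (ell2_inner S (T x) x - z * of_real ((ell2_norm S x)\<^sup>2)) \<le> \<delta> * (ell2_norm S x)\<^sup>2"
    if "\<delta> > 0" for \<delta>
  proof -
    obtain x where x: "x \<in> ell2 S" "ell2_norm S (\<lambda>i. T x i - z * x i) < \<delta> * ell2_norm S x"
      using z \<open>\<delta> > 0\<close> unfolding approx_eigenvalue_def by blast
    have Tx: "T x \<in> ell2 S" and zx: "(\<lambda>i. z * x i) \<in> ell2 S"
      using x(1) T by (auto intro: bounded_ops_mem ell2_scale)
    have n: "ell2_norm S x > 0"
      using x(2) \<open>\<delta> > 0\<close> ell2_norm_nonneg[of S] by (metis less_le_not_le mult_zero_right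
          order_less_le)
    have "ell2_inner S (\<lambda>i. T x i - z * x i) x = ell2_inner S (T x) x - z * of_real ((ell2_norm S
        x)\<^sup>2)"
      using ell2_inner_diff_left[OF Tx zx x(1)] by (simp add: ell2_inner_scale_left
          ell2_inner_self x(1))
    then have "cmod (ell2_inner S (T x) x - z * of_real ((ell2_norm S x)\<^sup>2))
        \<le> ell2_norm S (\<lambda>i. T x i - z * x i) * ell2_norm S x"
      using ell2_Cauchy_Schwarz[OF ell2_diff[OF Tx zx] x(1)] by simp
    also have "\<dots> \<le> (\<delta> * ell2_norm S x) * ell2_norm S x"
      using x(2) by (intro mult_right_mono) auto
    finally show ?thesis using x(1) n by (intro bexI[of _ x]) (auto simp: power2_eq_square
        mult.assoc)
  qed
  have real: "Im (ell2_inner S (T x) x) = 0" if "x \<in> ell2 S" for x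
    using sa that ell2_inner_commute[of S "T x" x] unfolding self_adjoint_def
    by (metis cnj.simps(2) equal_neg_zero)
  have *: "\<bar>Im z\<bar> \<le> \<delta> \<and> c \<le> Re z + \<delta> \<and> Re z \<le> C + \<delta>" if d: "\<delta> > 0" for \<delta>
  proof -
    obtain x where x: "x \<in> ell2 S" "ell2_norm S x > 0"
      "cmod (ell2_inner S (T x) x - z * of_real ((ell2_norm S x)\<^sup>2)) \<le> \<delta> * (ell2_norm S x)\<^sup>2"
      using key[OF d] by blast
    define n where "n = (ell2_norm S x)\<^sup>2"
    have n: "n > 0" using x(2) by (simp add: n_def)
    have "\<bar>Im z * n\<bar> \<le> \<delta> * n"
      using abs_Im_le_cmod[of "ell2_inner S (T x) x - z * of_real n"] x(3) real[OF x(1)]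
      by (simp add: n_def)
    moreover have "\<bar>Re (ell2_inner S (T x) x) - Re z * n\<bar> \<le> \<delta> * n"
      using abs_Re_le_cmod[of "ell2_inner S (T x) x - z * of_real n"] x(3)
      by (simp add: n_def)
    then have "c * n \<le> (Re z + \<delta>) * n" "Re z * n \<le> (C + \<delta>) * n"
      using bounds[OF x(1)] by (auto simp: n_def algebra_simps)
    ultimately show ?thesis using n by (simp add: abs_mult)
  qed
  have "\<bar>Im z\<bar> \<le> 0" by (rule field_le_epsilon) (simp add: *)
  moreover have "c \<le> Re z" by (rule field_le_epsilon) (simp add: *)
  moreover have "Re z \<le> C" by (rule field_le_epsilon) (simp add: *)
  ultimately show "z = of_real (Re z)" "c \<le> Re z" "Re z \<le> C" by (auto simp: complex_eq_iff)
qed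

text \<open>A bounded inverse \<open>R\<close> of \<open>T - z\<close> would bound
  \<open>T - z\<close> from below, against the approximate eigenvectors.\<close>

lemma approx_eigenvalue_spectrum:
  assumes T: "T \<in> bounded_ops S" and z: "approx_eigenvalue S T z"
  shows "z \<in> spectrum S T"
proof (rule ccontr)
  assume "z \<notin> spectrum S T"
  then obtain R where R: "R \<in> bounded_ops S" "\<And>x. x \<in> ell2 S \<Longrightarrow> R (\<lambda>i. T x i - z * x i) = x"
    unfolding spectrum_def by blast
  obtain B where B: "0 \<le> B" "\<And>x. x \<in> ell2 S \<Longrightarrow> ell2_norm S (R x) \<le> B * ell2_norm S x"
    using bounded_ops_bound[OF R(1)] by blast
  have "1 / (B + 1) > 0" using B(1) by simp
  then obtain x where x: "x \<in> ell2 S"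
      "ell2_norm S (\<lambda>i. T x i - z * x i) < 1 / (B + 1) * ell2_norm S x"
    using z unfolding approx_eigenvalue_def by blast
  have y: "(\<lambda>i. T x i - z * x i) \<in> ell2 S"
    by (rule ell2_diff[OF bounded_ops_mem[OF T x(1)] ell2_scale[OF x(1)]])
  have "ell2_norm S x \<le> B * ell2_norm S (\<lambda>i. T x i - z * x i)"
    using B(2)[OF y] R(2)[OF x(1)] by simp
  also have "\<dots> \<le> (B + 1) * ell2_norm S (\<lambda>i. T x i - z * x i)"
    by (intro mult_right_mono) auto
  also have "\<dots> < ell2_norm S x" using x(2) B(1) by (simp add: field_simps)
  finally show False by simp
qed

section \<open>Functional calculus of a bounded self-adjoint operator\<close>

lemma Weierstrass_poly:
  fixes h :: "real \<Rightarrow> real"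
  assumes "continuous_on {c..C} h" "e > 0"
  obtains p where "\<And>r. c \<le> r \<Longrightarrow> r \<le> C \<Longrightarrow> \<bar>poly p r - h r\<bar> \<le> e"
proof -
  obtain g where g: "real_polynomial_function g" "\<And>r. r \<in> {c..C} \<Longrightarrow> \<bar>h r - g r\<bar> < e"
    using Stone_Weierstrass_real_polynomial_function[OF compact_Icc assms] by blast
  obtain a n where a: "g = (\<lambda>x. \<Sum>i\<le>n. a i * x ^ i)"
    using g(1) real_polynomial_function_iff_sum by blast
  have "poly (\<Sum>i\<le>n. monom (a i) i) r = g r" for r
    by (simp add: a poly_sum poly_monom)
  then have "\<bar>poly (\<Sum>i\<le>n. monom (a i) i) r - h r\<bar> \<le> e" if "c \<le> r" "r \<le> C" for r
    using g(2)[of r] that by (simp add: abs_minus_commute less_imp_le)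
  then show thesis using that by blast
qed

text \<open>Coordinates form Cauchy sequences, and the estimate passes to the limit in
  \<open>m\<close> on each finite set of coordinates before the full norm is taken. The explicit
  rate \<open>e n\<close> is retained because the calculus has to be compared with polynomials
  quantitatively.\<close>

lemma bounded_ops_complete:
  fixes T :: "nat \<Rightarrow> 'a ell2_op"
  assumes T: "\<And>n. T n \<in> bounded_ops S" and e: "e \<longlonglongrightarrow> 0" "\<And>n. 0 \<le> e n"
    and cauchy: "\<And>n m x. x \<in> ell2 S \<Longrightarrow> ell2_norm S (\<lambda>i. T n x i - T m x i) \<le> (e n + e m) *
        ell2_norm S x"
  obtains A where "A \<in> bounded_ops S"
    "\<And>n x. x \<in> ell2 S \<Longrightarrow> ell2_norm S (\<lambda>i. T n x i - A x i) \<le> e n * ell2_norm S x"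
proof -
  define A where "A x = (if x \<in> ell2 S then (\<lambda>i. lim (\<lambda>n. T n x i)) else (\<lambda>_. 0))" for x
  have mem: "(\<lambda>i. T n x i - T m x i) \<in> ell2 S" if "x \<in> ell2 S" for x n m
    using ell2_diff[OF bounded_ops_mem[OF T that] bounded_ops_mem[OF T that]] .
  have lim: "(\<lambda>n. T n x i) \<longlonglongrightarrow> A x i" if x: "x \<in> ell2 S" for x i
  proof -
    have "Cauchy (\<lambda>n. T n x i)"
    proof (rule metric_CauchyI)
      fix \<epsilon> :: real assume "\<epsilon> > 0"
      define d where "d = \<epsilon> / (2 * (ell2_norm S x + 1))"
      have nx: "ell2_norm S x + 1 > 0" by (simp add: add_nonneg_pos)
      have "d > 0" unfolding d_def using \<open>\<epsilon> > 0\<close>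
        by (intro divide_pos_pos mult_pos_pos add_nonneg_pos) auto
      then obtain N where N: "\<And>n. n \<ge> N \<Longrightarrow> \<bar>e n\<bar> < d"
        using e(1) by (auto simp: LIMSEQ_iff)
      have "dist (T n x i) (T m x i) < \<epsilon>" if "n \<ge> N" "m \<ge> N" for n m
      proof -
        have "dist (T n x i) (T m x i) \<le> (e n + e m) * ell2_norm S x"
          using cmod_le_ell2_norm[OF mem[OF x, of n m], of i] cauchy[OF x, of n m]
          by (simp add: dist_norm)
        also have "\<dots> \<le> (2 * d) * ell2_norm S x"
          using N[OF that(1)] N[OF that(2)] by (intro mult_right_mono) auto
        also have "\<dots> < (2 * d) * (ell2_norm S x + 1)" using \<open>d > 0\<close> by simp
        also have "\<dots> = \<epsilon>" using nx unfolding d_def by (metis mult.commute nonzero_divide_eq_eq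
              mult_divide_mult_cancel_left less_irrefl times_divide_eq_right zero_neq_numeral)
        finally show ?thesis .
      qed
      then show "\<exists>M. \<forall>m\<ge>M. \<forall>n\<ge>M. dist (T m x i) (T n x i) < \<epsilon>" by blast
    qed
    then show ?thesis using x by (simp add: A_def Cauchy_convergent_iff convergent_LIMSEQ_iff)
  qed
  have near: "(\<lambda>i. T n x i - A x i) \<in> ell2 S \<and> ell2_norm S (\<lambda>i. T n x i - A x i) \<le> e n * ell2_norm
      S x"
    if x: "x \<in> ell2 S" for n x
  proof -
    have "(\<Sum>i\<in>F. (cmod (T n x i - A x i))\<^sup>2) \<le> (e n * ell2_norm S x)\<^sup>2" if F: "finite F" "F \<subseteq> S"
        for F
    proof (rule LIMSEQ_le)
      show "(\<lambda>m. \<Sum>i\<in>F. (cmod (T n x i - T m x i))\<^sup>2) \<longlonglongrightarrow> (\<Sum>i\<in>F. (cmod (T n x i - A x i))\<^sup>2)"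
        by (intro tendsto_intros lim x)
      show "(\<lambda>m. ((e n + e m) * ell2_norm S x)\<^sup>2) \<longlonglongrightarrow> (e n * ell2_norm S x)\<^sup>2"
        using e(1) by (auto intro!: tendsto_eq_intros)
      have "(\<Sum>i\<in>F. (cmod (T n x i - T m x i))\<^sup>2) \<le> ((e n + e m) * ell2_norm S x)\<^sup>2" for m
        by (rule order_trans[OF finite_sum_le_ell2_norm_sq[OF mem[OF x] F]
              power_mono[OF cauchy[OF x] ell2_norm_nonneg]])
      then show "\<exists>N. \<forall>m\<ge>N. (\<Sum>i\<in>F. (cmod (T n x i - T m x i))\<^sup>2) \<le> ((e n + e m) * ell2_norm S x)\<^sup>2"
        by blast
    qed
    moreover have "T n x i - A x i = 0" if i: "i \<notin> S" for i
    proof -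
      have "(\<lambda>n. T n x i) = (\<lambda>n. 0)" using ell2_outside[OF bounded_ops_mem[OF T x] i] by blast
      then have "A x i = 0" using lim[OF x, of i] by (simp add: LIMSEQ_const_iff)
      then show ?thesis using ell2_outside[OF bounded_ops_mem[OF T x] i] by simp
    qed
    ultimately show ?thesis
      using ell2_of_finite_sum_bounds[of S "\<lambda>i. T n x i - A x i" "e n * ell2_norm S x"] e(2)[of n]
          by simp
  qed
  have memA: "A x \<in> ell2 S" if x: "x \<in> ell2 S" for x
    using ell2_diff[OF bounded_ops_mem[OF T[of 0] x] conjunct1[OF near[OF x, of 0]]] by simp
  obtain B where B: "\<And>x. x \<in> ell2 S \<Longrightarrow> ell2_norm S (T 0 x) \<le> B * ell2_norm S x"
    using bounded_ops_bound[OF T] by blast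
  have "A \<in> bounded_ops S"
  proof (rule bounded_opsI[where B = "e 0 + B"])
    fix x assume x: "x \<in> ell2 S"
    show "A x \<in> ell2 S" using x by (rule memA)
    show "ell2_norm S (A x) \<le> (e 0 + B) * ell2_norm S x"
      using ell2_norm_triangle'[OF memA[OF x] bounded_ops_mem[OF T[of 0] x]] near[OF x, of 0] B[OF
          x]
      by (simp add: ell2_norm_minus_commute[of S "A x"] distrib_right)
    show "A (\<lambda>i. c * x i) = (\<lambda>i. c * A x i)" for c
    proof
      fix i
      have "(\<lambda>n. c * T n x i) \<longlonglongrightarrow> c * A x i" by (intro tendsto_intros lim x)
      moreover have "(\<lambda>n. c * T n x i) \<longlonglongrightarrow> A (\<lambda>i. c * x i) i"
        using lim[OF ell2_scale[OF x], of c i] by (simp add: bounded_ops_scale[OF T x])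
      ultimately show "A (\<lambda>i. c * x i) i = c * A x i" using LIMSEQ_unique by blast
    qed
    fix y assume y: "y \<in> ell2 S"
    show "A (\<lambda>i. x i + y i) = (\<lambda>i. A x i + A y i)"
    proof
      fix i
      have "(\<lambda>n. T n x i + T n y i) \<longlonglongrightarrow> A x i + A y i" by (intro tendsto_intros lim x y)
      moreover have "(\<lambda>n. T n x i + T n y i) \<longlonglongrightarrow> A (\<lambda>i. x i + y i) i"
        using lim[OF ell2_add[OF x y], of i] by (simp add: bounded_ops_add[OF T x y])
      ultimately show "A (\<lambda>i. x i + y i) i = A x i + A y i" using LIMSEQ_unique by blast
    qed
  qed (simp add: A_def)
  then show thesis using that near by blast
qed

text \<open>The restriction to \<open>e \<le> 1\<close> allows a product of two errors to be
  absorbed into a multiple of \<open>e\<close>.\<close>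

lemma le_of_le_add_small:
  fixes a b K :: real
  assumes "\<And>e. e > 0 \<Longrightarrow> e \<le> 1 \<Longrightarrow> a \<le> b + e * K" "0 \<le> K"
  shows "a \<le> b"
proof (rule field_le_epsilon)
  fix e :: real assume e: "e > 0"
  define d where "d = min 1 (e / (K + 1))"
  have "d > 0" "d \<le> 1" using e assms(2) by (auto simp: d_def)
  have "d * K \<le> e / (K + 1) * (K + 1)" using assms(2) \<open>d > 0\<close> by (intro mult_mono) (auto simp:
      d_def)
  also have "\<dots> = e" using assms(2) by simp
  finally show "a \<le> b + e" using assms(1)[OF \<open>d > 0\<close> \<open>d \<le> 1\<close>] by simp
qed

text \<open>The interval is prescribed through the quadratic form, which can be estimated directly
  for the operators in question; that the spectrum lies in \<open>[c, C]\<close> is derived in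
  \<open>spectrum_bounds\<close>. Nonemptiness of \<open>S\<close> provides a unit vector, and with
  it a spectral point.\<close>

locale bounded_self_adjoint =
  fixes S :: "'a set" and T :: "'a ell2_op" and c C :: real
  assumes S: "S \<noteq> {}" and T: "T \<in> bounded_ops S" and sa: "self_adjoint S T"
    and lower: "\<And>x. x \<in> ell2 S \<Longrightarrow> c * (ell2_norm S x)\<^sup>2 \<le> Re (ell2_inner S (T x) x)"
    and upper: "\<And>x. x \<in> ell2 S \<Longrightarrow> Re (ell2_inner S (T x) x) \<le> C * (ell2_norm S x)\<^sup>2"
begin

section \<open>The norm of a polynomial in \<open>T\<close> and its values on the spectrum\<close>

lemma op_poly_mem: "x \<in> ell2 S \<Longrightarrow> op_poly S p T x \<in> ell2 S"
  by (rule bounded_ops_mem[OF bounded_ops_op_poly[OF T]])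

text \<open>With \<open>m\<close> the norm of \<open>P\<close>, expanding the square gives
  \<open>|P P x - m^2 x|^2 \<le> m^2 (m^2 |x|^2 - |P x|^2)\<close>, which is small for vectors at
  which the norm is almost attained. The square of \<open>P\<close> appears because the sign of the
  extremal spectral value is unknown.\<close>

lemma op_norm_approx_eigenvalue:
  assumes P: "P \<in> bounded_ops S" and saP: "self_adjoint S P" and d: "\<delta> > 0"
  shows "\<exists>x\<in>ell2 S. ell2_norm S (\<lambda>i. P (P x) i - of_real ((op_norm S P)\<^sup>2) * x i) < \<delta> * ell2_norm
      S x"
proof -
  define m where "m = op_norm S P"
  obtain B where B: "0 \<le> B" "\<And>x. x \<in> ell2 S \<Longrightarrow> ell2_norm S (P x) \<le> B * ell2_norm S x"
    using bounded_ops_bound[OF P] by blast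
  have bd: "ell2_norm S (P x) \<le> m * ell2_norm S x" if "x \<in> ell2 S" for x
    unfolding m_def using op_norm_bound[OF B(2) _ that] bounded_ops_scale[OF P] by blast
  have m0: "0 \<le> m" unfolding m_def using op_norm_nonneg[OF B(2)] .
  have est: "(ell2_norm S (\<lambda>i. P (P x) i - of_real (m\<^sup>2) * x i))\<^sup>2
      \<le> m\<^sup>2 * (m\<^sup>2 * (ell2_norm S x)\<^sup>2 - (ell2_norm S (P x))\<^sup>2)" if x: "x \<in> ell2 S" for x
  proof -
    have Px: "P x \<in> ell2 S" and PPx: "P (P x) \<in> ell2 S" using bounded_ops_mem[OF P] x by auto
    have "Re (ell2_inner S (P (P x)) (\<lambda>i. of_real (m\<^sup>2) * x i)) = m\<^sup>2 * (ell2_norm S (P x))\<^sup>2"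
      using saP x Px unfolding self_adjoint_def by (simp add: ell2_inner_scale_right
          ell2_inner_self)
    moreover have "(ell2_norm S (P (P x)))\<^sup>2 \<le> (m * ell2_norm S (P x))\<^sup>2"
      using bd[OF Px] by (intro power_mono) auto
    moreover have "ell2_norm S (\<lambda>i. of_real (m\<^sup>2) * x i) = m\<^sup>2 * ell2_norm S x"
      by (simp only: ell2_norm_scale norm_of_real) simp
    ultimately show ?thesis
      using ell2_norm_sq_diff[OF PPx ell2_scale[OF x], of "of_real (m\<^sup>2)"]
      by (simp add: power_mult_distrib algebra_simps power2_eq_square)
  qed
  show ?thesis
  proof (cases "m = 0")
    case True
    \<comment> \<open>For \<open>m = 0\<close> the estimate makes the difference vanish at every
      vector, and any point mass serves.\<close>
    obtain s where s: "s \<in> S" using S by blast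
    define x :: "'a \<Rightarrow> complex" where "x = point_mass s"
    have x: "x \<in> ell2 S" and n: "(ell2_norm S x)\<^sup>2 = 1"
      using ell2_finite_support[of x S] ell2_norm_finite_support[of "{s}" x S] s
      by (auto simp: x_def point_mass_def)
    then have "ell2_norm S (\<lambda>i. P (P x) i - of_real (m\<^sup>2) * x i) = 0" using est[OF x] True by simp
    moreover have "0 < ell2_norm S x" using n ell2_norm_nonneg[of S x] by (metis less_le
        power_zero_numeral zero_neq_one)
    ultimately show ?thesis using x d by (intro bexI[of _ x]) (auto simp: m_def)
  next
    case False
    then have m: "m > 0" using m0 by simp
    \<comment> \<open>\<open>k\<close> is so close to \<open>m\<close> that
      \<open>m^2 (m^2 - k^2) \<le> \<delta>^2 / 2\<close>, by \<open>m + k \<le> 2 m\<close>; the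
      maximum with 0 keeps squaring monotone.\<close>
    define k where "k = max 0 (m - \<delta>\<^sup>2 / (4 * m ^ 3))"
    have k: "0 \<le> k" "k < m" using m d by (auto simp: k_def)
    have "m\<^sup>2 - k\<^sup>2 = (m - k) * (m + k)" by (simp add: power2_eq_square algebra_simps)
    also have "\<dots> \<le> (\<delta>\<^sup>2 / (4 * m ^ 3)) * (2 * m)"
      using k m by (intro mult_mono) (auto simp: k_def)
    finally have "m\<^sup>2 * (m\<^sup>2 - k\<^sup>2) \<le> m\<^sup>2 * ((\<delta>\<^sup>2 / (4 * m ^ 3)) * (2 * m))"
      by (rule mult_left_mono) simp
    also have "\<dots> = \<delta>\<^sup>2 / 2" using m by (simp add: power2_eq_square power3_eq_cube)
    also have "\<dots> < \<delta>\<^sup>2" using d by simp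
    finally have mk: "m\<^sup>2 * (m\<^sup>2 - k\<^sup>2) < \<delta>\<^sup>2" .
    obtain x where x: "x \<in> ell2 S" "ell2_norm S x \<le> 1" "k < ell2_norm S (P x)"
      using op_norm_witness[of k S P] k(2) unfolding m_def by blast
    have nx: "ell2_norm S x > 0"
      using x(3) bd[OF x(1)] k(1) by (cases "ell2_norm S x = 0") (auto simp: less_le)
    have "k * ell2_norm S x \<le> ell2_norm S (P x)"
      using x(2,3) k(1) mult_left_le[of "ell2_norm S x" k] by simp
    then have "(k * ell2_norm S x)\<^sup>2 \<le> (ell2_norm S (P x))\<^sup>2"
      using k(1) by (intro power_mono) auto
    then have "m\<^sup>2 * (m\<^sup>2 * (ell2_norm S x)\<^sup>2 - (ell2_norm S (P x))\<^sup>2)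
        \<le> m\<^sup>2 * (m\<^sup>2 * (ell2_norm S x)\<^sup>2 - (k * ell2_norm S x)\<^sup>2)"
      by (intro mult_left_mono) auto
    also have "\<dots> = (m\<^sup>2 * (m\<^sup>2 - k\<^sup>2)) * (ell2_norm S x)\<^sup>2"
      by (simp add: power_mult_distrib algebra_simps)
    also have "\<dots> < \<delta>\<^sup>2 * (ell2_norm S x)\<^sup>2" using mk nx by simp
    finally have "(ell2_norm S (\<lambda>i. P (P x) i - of_real (m\<^sup>2) * x i))\<^sup>2 < (\<delta> * ell2_norm S x)\<^sup>2"
      using est[OF x(1)] by (simp add: power_mult_distrib)
    then have "ell2_norm S (\<lambda>i. P (P x) i - of_real (m\<^sup>2) * x i) < \<delta> * ell2_norm S x"
      by (rule power2_less_imp_less) (use d in simp)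
    then show ?thesis using x(1) unfolding m_def by blast
  qed
qed

lemma poly_map_of_real: "poly (map_poly complex_of_real p) (of_real r) = of_real (poly p r)"
  by (induction p) (simp_all add: Polynomial.map_poly_pCons)

text \<open>The square of \<open>p(T)\<close> minus its squared norm is not bounded below, so some
  root of the polynomial in the hypothesis is an approximate eigenvalue of \<open>T\<close>, hence
  real, in \<open>[c, C]\<close> and spectral.\<close>

lemma op_norm_poly_root_aux:
  assumes "p * p - [:(op_norm S (op_poly S p T))\<^sup>2:] \<noteq> 0"
  obtains r where "c \<le> r" "r \<le> C" "complex_of_real r \<in> spectrum S T"
    "(poly p r)\<^sup>2 = (op_norm S (op_poly S p T))\<^sup>2"
proof -
  define P where "P = op_poly S p T"
  define q where "q = p * p - [:(op_norm S P)\<^sup>2:]"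
  have P: "P \<in> bounded_ops S" "self_adjoint S P"
    unfolding P_def using T sa by (auto intro: bounded_ops_op_poly self_adjoint_op_poly)
  have eq: "cpoly_op (map_poly of_real q) T x = (\<lambda>i. P (P x) i - of_real ((op_norm S P)\<^sup>2) * x i)"
    if x: "x \<in> ell2 S" for x
    unfolding q_def
    by (simp only: op_poly_eq_cpoly_op[OF x, symmetric] op_poly_diff[OF T x] op_poly_mult[OF T x]
      op_poly_const[OF x] P_def)
  have "map_poly complex_of_real q \<noteq> 0"
    using assms by (simp add: q_def P_def map_poly_eq_0_iff)
  then have "\<exists>z. poly (map_poly of_real q) z = 0 \<and> approx_eigenvalue S T z"
  proof (rule approx_eigenvalue_of_poly[OF T])
    fix \<delta> :: real assume "\<delta> > 0"
    then show "\<exists>x\<in>ell2 S. ell2_norm S (cpoly_op (map_poly of_real q) T x) < \<delta> * ell2_norm S x"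
      using op_norm_approx_eigenvalue[OF P] eq by fastforce
  qed
  then obtain z where z: "poly (map_poly of_real q) z = 0" "approx_eigenvalue S T z" by blast
  note ev = approx_eigenvalue_real[OF T sa lower upper z(2)]
  show thesis
  proof (rule that[of "Re z"])
    show "c \<le> Re z" "Re z \<le> C" using ev by auto
    show "complex_of_real (Re z) \<in> spectrum S T"
      using approx_eigenvalue_spectrum[OF T z(2)] ev(1) by simp
    have "poly q (Re z) = 0" using z(1) ev(1) poly_map_of_real[of q "Re z"] by simp
    then show "(poly p (Re z))\<^sup>2 = (op_norm S (op_poly S p T))\<^sup>2"
      by (simp add: q_def P_def power2_eq_square)
  qed
qed

text \<open>Evaluation of polynomials at \<open>T\<close> is thereby contractive for the supremum
  norm on the part of the spectrum in \<open>[c, C]\<close>, and the whole calculus rests on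
  this.\<close>

lemma op_poly_norm_bound:
  obtains r where "c \<le> r" "r \<le> C" "complex_of_real r \<in> spectrum S T"
    "\<And>x. x \<in> ell2 S \<Longrightarrow> ell2_norm S (op_poly S p T x) \<le> \<bar>poly p r\<bar> * ell2_norm S x"
proof -
  define m where "m = op_norm S (op_poly S p T)"
  obtain r where r: "c \<le> r" "r \<le> C" "complex_of_real r \<in> spectrum S T" "(poly p r)\<^sup>2 = m\<^sup>2"
  proof (cases "p * p - [:m\<^sup>2:] = 0")
    case True
    \<comment> \<open>Here \<open>p^2\<close> is constant, so any spectral point in
      \<open>[c, C]\<close> will do. One is produced by applying the preceding lemma to the
      polynomial \<open>t\<close>, for which \<open>t^2 - a\<close> is never the zero
      polynomial.\<close>
    have "degree ([:0, 1:] * [:0, 1:] - [:a:] :: real poly) = 2" for a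
      by simp
    then have "[:0, 1:] * [:0, 1:] - [:a:] \<noteq> (0 :: real poly)" for a
      by (metis degree_0 zero_neq_numeral)
    then obtain r where r: "c \<le> r" "r \<le> C" "complex_of_real r \<in> spectrum S T"
      using op_norm_poly_root_aux by blast
    have "poly (p * p - [:m\<^sup>2:]) r = 0" using True by simp
    then show thesis using that r by (simp add: power2_eq_square)
  next
    case False
    then show thesis using op_norm_poly_root_aux that unfolding m_def by blast
  qed
  obtain B where B: "0 \<le> B" "\<And>x. x \<in> ell2 S \<Longrightarrow> ell2_norm S (op_poly S p T x) \<le> B * ell2_norm S x"
    using bounded_ops_bound[OF bounded_ops_op_poly[OF T]] by blast
  have "m = \<bar>poly p r\<bar>"
    using r(4) op_norm_nonneg[OF B(2)] unfolding m_def[symmetric] by (metis abs_of_nonneg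
        power2_eq_iff abs_minus_cancel)
  then have "ell2_norm S (op_poly S p T x) \<le> \<bar>poly p r\<bar> * ell2_norm S x" if "x \<in> ell2 S" for x
    using op_norm_bound[OF B(2) _ that] bounded_ops_scale[OF bounded_ops_op_poly[OF T]]
    unfolding m_def by metis
  then show thesis using that r by blast
qed

lemma op_poly_diff_bound:
  assumes "\<And>r. c \<le> r \<Longrightarrow> r \<le> C \<Longrightarrow> complex_of_real r \<in> spectrum S T \<Longrightarrow> \<bar>poly p r - poly q r\<bar> \<le> e"
    and x: "x \<in> ell2 S"
  shows "ell2_norm S (\<lambda>i. op_poly S p T x i - op_poly S q T x i) \<le> e * ell2_norm S x"
proof -
  obtain r where r: "c \<le> r" "r \<le> C" "complex_of_real r \<in> spectrum S T"
    "\<And>x. x \<in> ell2 S \<Longrightarrow> ell2_norm S (op_poly S (p - q) T x) \<le> \<bar>poly (p - q) r\<bar> * ell2_norm S x"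
    using op_poly_norm_bound by blast
  have "ell2_norm S (op_poly S (p - q) T x) \<le> e * ell2_norm S x"
    using r(4)[OF x] assms(1)[OF r(1-3)] mult_right_mono[of "\<bar>poly (p - q) r\<bar>" e "ell2_norm S x"]
    by simp
  then show ?thesis by (simp add: op_poly_diff[OF T x])
qed

text \<open>\<open>A\<close> is the value at \<open>T\<close> of the functional calculus of \<open>h\<close>. The conditions \<open>c \<le> r \<le> C\<close>
  become redundant once the spectrum is known to lie in \<open>[c, C]\<close>, but that is itself deduced from
  the existence of the calculus, applied to \<open>1 / (t - r)\<close>.\<close>

definition is_calculus :: "(real \<Rightarrow> real) \<Rightarrow> 'a ell2_op \<Rightarrow> bool" where
  "is_calculus h A \<longleftrightarrow> A \<in> bounded_ops S \<and> (\<forall>p e.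
    (\<forall>r. c \<le> r \<longrightarrow> r \<le> C \<longrightarrow> complex_of_real r \<in> spectrum S T \<longrightarrow> \<bar>poly p r - h r\<bar> \<le> e) \<longrightarrow>
    (\<forall>x\<in>ell2 S. ell2_norm S (\<lambda>i. op_poly S p T x i - A x i) \<le> e * ell2_norm S x))"

section \<open>Existence and uniqueness of the functional calculus\<close>

lemma is_calculusD:
  assumes "is_calculus h A"
    "\<And>r. c \<le> r \<Longrightarrow> r \<le> C \<Longrightarrow> complex_of_real r \<in> spectrum S T \<Longrightarrow> \<bar>poly p r - h r\<bar> \<le> e"
    "x \<in> ell2 S"
  shows "ell2_norm S (\<lambda>i. op_poly S p T x i - A x i) \<le> e * ell2_norm S x"
  using assms unfolding is_calculus_def by blast

text \<open>Weierstrass polynomials of \<open>h\<close> give a Cauchy sequence of operators by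
  \<open>op_poly_diff_bound\<close>. Any other polynomial \<open>p\<close>, with its own error
  \<open>d\<close>, is compared with this sequence on the spectrum, and the errors of the sequence
  tend to zero.\<close>

lemma is_calculus_exists:
  assumes h: "continuous_on {c..C} h"
  obtains A where "is_calculus h A"
proof -
  define e where "e n = 1 / real (Suc n)" for n
  have e: "e \<longlonglongrightarrow> 0" "\<And>n. e n > 0"
    unfolding e_def using lim_1_over_n[THEN LIMSEQ_Suc] by auto
  have "\<exists>p. \<forall>r. c \<le> r \<longrightarrow> r \<le> C \<longrightarrow> \<bar>poly p r - h r\<bar> \<le> e n" for n
    using Weierstrass_poly[OF h e(2)[of n]] by metis
  then obtain s where s: "\<And>n r. c \<le> r \<Longrightarrow> r \<le> C \<Longrightarrow> \<bar>poly (s n) r - h r\<bar> \<le> e n"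
    by metis
  have cauchy: "ell2_norm S (\<lambda>i. op_poly S (s n) T x i - op_poly S (s m) T x i) \<le> (e n + e m) *
      ell2_norm S x"
    if "x \<in> ell2 S" for n m x
  proof (rule op_poly_diff_bound[OF _ that])
    fix r assume "c \<le> r" "r \<le> C"
    then show "\<bar>poly (s n) r - poly (s m) r\<bar> \<le> e n + e m"
      using s[of r n] s[of r m] by linarith
  qed
  obtain A where A: "A \<in> bounded_ops S"
    "\<And>n x. x \<in> ell2 S \<Longrightarrow> ell2_norm S (\<lambda>i. op_poly S (s n) T x i - A x i) \<le> e n * ell2_norm S x"
    using bounded_ops_complete[of "\<lambda>n. op_poly S (s n) T", OF bounded_ops_op_poly[OF T] e(1)
        less_imp_le[OF e(2)] cauchy] by blast
  have "ell2_norm S (\<lambda>i. op_poly S p T x i - A x i) \<le> d * ell2_norm S x"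
    if p: "\<And>r. c \<le> r \<Longrightarrow> r \<le> C \<Longrightarrow> complex_of_real r \<in> spectrum S T \<Longrightarrow> \<bar>poly p r - h r\<bar> \<le> d"
      and x: "x \<in> ell2 S" for p d x
  proof (rule LIMSEQ_le_const)
    show "(\<lambda>n. (d + e n) * ell2_norm S x + e n * ell2_norm S x) \<longlonglongrightarrow> d * ell2_norm S x"
      using e(1) by (auto intro!: tendsto_eq_intros)
    have "ell2_norm S (\<lambda>i. op_poly S p T x i - A x i) \<le> (d + e n) * ell2_norm S x + e n *
        ell2_norm S x" for n
    proof -
      have "ell2_norm S (\<lambda>i. op_poly S p T x i - op_poly S (s n) T x i) \<le> (d + e n) * ell2_norm S x"
      proof (rule op_poly_diff_bound[OF _ x])
        fix r assume "c \<le> r" "r \<le> C" "complex_of_real r \<in> spectrum S T"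
        then show "\<bar>poly p r - poly (s n) r\<bar> \<le> d + e n" using s[of r n] p[of r] by linarith
      qed
      then show ?thesis
        using ell2_norm_triangle_diff[OF op_poly_mem[OF x, of p] op_poly_mem[OF x, of "s n"]
            bounded_ops_mem[OF A(1) x]]
          A(2)[OF x, of n] by linarith
    qed
    then show "\<exists>N. \<forall>n\<ge>N. ell2_norm S (\<lambda>i. op_poly S p T x i - A x i) \<le> (d + e n) * ell2_norm S x +
        e n * ell2_norm S x"
      by blast
  qed
  then show thesis using that A(1) unfolding is_calculus_def by blast
qed

lemma is_calculus_approx:
  assumes "is_calculus h A" "continuous_on {c..C} h" "e > 0"
  obtains p where "\<And>r. c \<le> r \<Longrightarrow> r \<le> C \<Longrightarrow> \<bar>poly p r - h r\<bar> \<le> e"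
    "\<And>x. x \<in> ell2 S \<Longrightarrow> ell2_norm S (\<lambda>i. op_poly S p T x i - A x i) \<le> e * ell2_norm S x"
proof -
  obtain p where p: "\<And>r. c \<le> r \<Longrightarrow> r \<le> C \<Longrightarrow> \<bar>poly p r - h r\<bar> \<le> e"
    using Weierstrass_poly[OF assms(2,3)] by blast
  then show thesis using that[of p] is_calculusD[OF assms(1)] by blast
qed

lemma is_calculus_bounded_ops: "is_calculus h A \<Longrightarrow> A \<in> bounded_ops S"
  by (simp add: is_calculus_def)

text \<open>Multiplicativity of the calculus is not yet available. That \<open>A\<close> inverts
  \<open>T - r\<close> on both sides is therefore checked through polynomials \<open>p\<close> near
  \<open>h\<close>, for which \<open>p(t) (t - r)\<close> is near 1, with the error tending to
  zero.\<close>

lemma spectrum_bounds: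
  assumes r: "complex_of_real r \<in> spectrum S T"
  shows "c \<le> r \<and> r \<le> C"
proof (rule ccontr)
  assume out: "\<not> (c \<le> r \<and> r \<le> C)"
  define h where "h t = 1 / (t - r)" for t
  have h: "continuous_on {c..C} h" unfolding h_def using out by (intro continuous_intros) auto
  obtain A where A: "is_calculus h A" using is_calculus_exists[OF h] by blast
  note Ab = is_calculus_bounded_ops[OF A]
  \<comment> \<open>\<open>D\<close> bounds the distance from \<open>r\<close> to points of
    \<open>[c, C]\<close>, whatever the signs of the endpoints.\<close>
  define D where "D = \<bar>c\<bar> + \<bar>C\<bar> + \<bar>r\<bar>"
  define U where "U x = (\<lambda>i. T x i - of_real r * x i)" for x
  have Um: "U x \<in> ell2 S" if "x \<in> ell2 S" for x
    unfolding U_def by (rule ell2_diff[OF bounded_ops_mem[OF T that] ell2_scale[OF that]])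
  obtain B where B: "0 \<le> B" "\<And>x. x \<in> ell2 S \<Longrightarrow> ell2_norm S (T x) \<le> B * ell2_norm S x"
    using bounded_ops_bound[OF T] by blast
  have UB: "ell2_norm S (U x) \<le> (B + \<bar>r\<bar>) * ell2_norm S x" if "x \<in> ell2 S" for x
    using ell2_norm_diff_le[OF bounded_ops_mem[OF T that] ell2_scale[OF that, of "of_real r"]]
        B(2)[OF that]
    unfolding U_def by (simp add: ell2_norm_scale distrib_right)
  have Udiff: "U (\<lambda>i. x i - y i) = (\<lambda>i. U x i - U y i)" if "x \<in> ell2 S" "y \<in> ell2 S" for x y
    unfolding U_def bounded_ops_diff[OF T that] by (auto simp: algebra_simps)
  have q: "op_poly S (p * [:- r, 1:]) T x = op_poly S p T (U x)"
    "op_poly S ([:- r, 1:] * p) T x = U (op_poly S p T x)" if x: "x \<in> ell2 S" for p x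
    unfolding op_poly_mult[OF T x] U_def
    using x op_poly_mem[OF x, of p] bounded_ops_mem[OF T]
    by (simp_all add: op_poly_pCons[OF T] op_poly_0)
  have near: "ell2_norm S (\<lambda>i. op_poly S (p * [:- r, 1:]) T x i - x i) \<le> (e * D) * ell2_norm S x"
    if p: "\<And>t. c \<le> t \<Longrightarrow> t \<le> C \<Longrightarrow> \<bar>poly p t - h t\<bar> \<le> e" and e: "e > 0" and x: "x \<in> ell2 S" for p e x
  proof -
    have "ell2_norm S (\<lambda>i. op_poly S (p * [:- r, 1:]) T x i - op_poly S [:1:] T x i) \<le> (e * D) *
        ell2_norm S x"
    proof (rule op_poly_diff_bound[OF _ x])
      fix t assume t: "c \<le> t" "t \<le> C"
      have "t \<noteq> r" using t out by auto
      then have "poly (p * [:- r, 1:]) t - poly [:1:] t = (poly p t - h t) * (t - r)"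
        by (simp add: h_def field_simps)
      moreover have "\<bar>(poly p t - h t) * (t - r)\<bar> \<le> e * D"
        unfolding abs_mult using p[OF t] t e by (intro mult_mono) (auto simp: D_def)
      ultimately show "\<bar>poly (p * [:- r, 1:]) t - poly [:1:] t\<bar> \<le> e * D" by simp
    qed
    then show ?thesis by (simp add: op_poly_const[OF x])
  qed
  have "A (U x) = x \<and> U (A x) = x" if x: "x \<in> ell2 S" for x
  proof -
    have "ell2_norm S (\<lambda>i. A (U x) i - x i) \<le> 0"
    proof (rule le_of_le_add_small)
      fix e :: real assume e: "e > 0"
      obtain p where p: "\<And>t. c \<le> t \<Longrightarrow> t \<le> C \<Longrightarrow> \<bar>poly p t - h t\<bar> \<le> e"
        "\<And>x. x \<in> ell2 S \<Longrightarrow> ell2_norm S (\<lambda>i. op_poly S p T x i - A x i) \<le> e * ell2_norm S x"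
        using is_calculus_approx[OF A h e] by blast
      have "ell2_norm S (\<lambda>i. A (U x) i - x i)
          \<le> ell2_norm S (\<lambda>i. A (U x) i - op_poly S p T (U x) i) + ell2_norm S (\<lambda>i. op_poly S p T
              (U x) i - x i)"
        by (rule ell2_norm_triangle_diff[OF bounded_ops_mem[OF Ab Um[OF x]] op_poly_mem[OF Um[OF
            x]] x])
      also have "\<dots> \<le> e * ell2_norm S (U x) + (e * D) * ell2_norm S x"
        using p(2)[OF Um[OF x]] near[OF p(1) e x] unfolding q(1)[OF x]
        by (subst ell2_norm_minus_commute) (rule add_mono)
      finally show "ell2_norm S (\<lambda>i. A (U x) i - x i) \<le> 0 + e * (ell2_norm S (U x) + D * ell2_norm
          S x)"
        by (simp add: algebra_simps)
    qed (auto simp: D_def)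
    moreover have "ell2_norm S (\<lambda>i. U (A x) i - x i) \<le> 0"
    proof (rule le_of_le_add_small)
      fix e :: real assume e: "e > 0"
      obtain p where p: "\<And>t. c \<le> t \<Longrightarrow> t \<le> C \<Longrightarrow> \<bar>poly p t - h t\<bar> \<le> e"
        "\<And>x. x \<in> ell2 S \<Longrightarrow> ell2_norm S (\<lambda>i. op_poly S p T x i - A x i) \<le> e * ell2_norm S x"
        using is_calculus_approx[OF A h e] by blast
      note Ax = bounded_ops_mem[OF Ab x] and px = op_poly_mem[OF x, of p]
      have "ell2_norm S (\<lambda>i. U (A x) i - x i)
          \<le> ell2_norm S (\<lambda>i. U (A x) i - U (op_poly S p T x) i) + ell2_norm S (\<lambda>i. U (op_poly S p
              T x) i - x i)"
        by (rule ell2_norm_triangle_diff[OF Um[OF Ax] Um[OF px] x])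
      also have "ell2_norm S (\<lambda>i. U (A x) i - U (op_poly S p T x) i)
          \<le> (B + \<bar>r\<bar>) * ell2_norm S (\<lambda>i. A x i - op_poly S p T x i)"
        using UB[OF ell2_diff[OF Ax px]] unfolding Udiff[OF Ax px] .
      also have "\<dots> \<le> (B + \<bar>r\<bar>) * (e * ell2_norm S x)"
        using p(2)[OF x] B(1) by (subst ell2_norm_minus_commute) (intro mult_left_mono, auto)
      also have "ell2_norm S (\<lambda>i. U (op_poly S p T x) i - x i) \<le> (e * D) * ell2_norm S x"
        using near[OF p(1) e x] q(2)[OF x, of p] by (simp add: mult.commute)
      finally show "ell2_norm S (\<lambda>i. U (A x) i - x i) \<le> 0 + e * ((B + \<bar>r\<bar>) * ell2_norm S x + D *
          ell2_norm S x)"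
        by (simp add: algebra_simps)
    qed (use B(1) in \<open>auto simp: D_def\<close>)
    ultimately have "(\<lambda>i. A (U x) i - x i) = (\<lambda>_. 0)" "(\<lambda>i. U (A x) i - x i) = (\<lambda>_. 0)"
      using ell2_norm_eq_0[OF ell2_diff[OF bounded_ops_mem[OF Ab Um[OF x]] x]]
        ell2_norm_eq_0[OF ell2_diff[OF Um[OF bounded_ops_mem[OF Ab x]] x]]
      by (simp_all add: antisym)
    then show ?thesis by (metis eq_iff_diff_eq_0 ext)
  qed
  then have "complex_of_real r \<notin> spectrum S T" using Ab unfolding spectrum_def U_def by blast
  then show False using r by blast
qed

text \<open>The approximating polynomial may depend on the vector as well as on \<open>e\<close>,
  and the error may carry a constant \<open>K\<close>; this covers both competitors given by norm
  limits and products of two calculi.\<close>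

lemma is_calculus_unique:
  assumes A: "is_calculus h A" and h: "continuous_on {c..C} h" and B: "B \<in> bounded_ops S"
    and small: "\<And>e x. e > 0 \<Longrightarrow> e \<le> 1 \<Longrightarrow> x \<in> ell2 S \<Longrightarrow> \<exists>p. (\<forall>r. c \<le> r \<longrightarrow> r \<le> C \<longrightarrow> \<bar>poly p r - h r\<bar> \<le> e) \<and>
      ell2_norm S (\<lambda>i. op_poly S p T x i - B x i) \<le> e * K * ell2_norm S x" and K: "0 \<le> K"
  shows "B = A"
proof (rule bounded_ops_eqI[OF B is_calculus_bounded_ops[OF A]])
  fix x assume x: "x \<in> ell2 S"
  note Ax = bounded_ops_mem[OF is_calculus_bounded_ops[OF A] x] and Bx = bounded_ops_mem[OF B x]
  have "ell2_norm S (\<lambda>i. B x i - A x i) \<le> 0"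
  proof (rule le_of_le_add_small)
    fix e :: real assume e: "e > 0" "e \<le> 1"
    obtain p where p: "\<forall>r. c \<le> r \<longrightarrow> r \<le> C \<longrightarrow> \<bar>poly p r - h r\<bar> \<le> e"
      "ell2_norm S (\<lambda>i. op_poly S p T x i - B x i) \<le> e * K * ell2_norm S x"
      using small[OF e x] by blast
    have "ell2_norm S (\<lambda>i. op_poly S p T x i - A x i) \<le> e * ell2_norm S x"
      using is_calculusD[OF A _ x] p(1) by blast
    then show "ell2_norm S (\<lambda>i. B x i - A x i) \<le> 0 + e * (ell2_norm S x + K * ell2_norm S x)"
      using ell2_norm_triangle_diff[OF Bx op_poly_mem[OF x, of p] Ax] p(2)
      by (simp add: ell2_norm_minus_commute[of S "B x"] algebra_simps)
  qed (use K in auto)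
  then have "(\<lambda>i. B x i - A x i) = (\<lambda>_. 0)"
    using ell2_norm_eq_0[OF ell2_diff[OF Bx Ax]] ell2_norm_nonneg by (metis antisym)
  then show "B x = A x" by (metis eq_iff_diff_eq_0 ext)
qed

text \<open>Discharges the definite description. A competitor \<open>B\<close> is tested on
  Weierstrass polynomials for \<open>[c, C]\<close>, which converge uniformly on the spectrum
  because \<open>spectrum_bounds\<close> places it inside that interval.\<close>

lemma functional_calculus_eq:
  assumes A: "is_calculus h A" and h: "continuous_on {c..C} h"
  shows "functional_calculus S h T = A"
  unfolding functional_calculus_def
proof (rule the_equality, intro conjI allI impI)
  show Ab: "A \<in> bounded_ops S" using is_calculus_bounded_ops[OF A] .
  fix p :: "nat \<Rightarrow> real poly"
  assume lim: "uniform_limit {r. complex_of_real r \<in> spectrum S T} (\<lambda>n. poly (p n)) h sequentially"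
  show "(\<lambda>n. op_norm S (\<lambda>x i. op_poly S (p n) T x i - A x i)) \<longlonglongrightarrow> 0"
  proof (rule LIMSEQ_I)
    fix e :: real assume e: "0 < e"
    from uniform_limitD[OF lim, of "e / 2"] e
    obtain N where N: "\<And>n r. n \<ge> N \<Longrightarrow> complex_of_real r \<in> spectrum S T \<Longrightarrow> dist (poly (p n) r) (h r)
        < e / 2"
      unfolding eventually_sequentially by auto
    have "norm (op_norm S (\<lambda>x i. op_poly S (p n) T x i - A x i) - 0) < e" if n: "n \<ge> N" for n
    proof -
      have b: "ell2_norm S (\<lambda>i. op_poly S (p n) T x i - A x i) \<le> e / 2 * ell2_norm S x" if "x \<in>
          ell2 S" for x
        by (rule is_calculusD[OF A _ that]) (use N[OF n] in \<open>auto simp: dist_real_def intro: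
            less_imp_le\<close>)
      have "op_norm S (\<lambda>x i. op_poly S (p n) T x i - A x i) \<le> e / 2"
        using b e by (intro op_norm_le) auto
      moreover have "0 \<le> op_norm S (\<lambda>x i. op_poly S (p n) T x i - A x i)"
        by (rule op_norm_nonneg[OF b])
      ultimately show ?thesis using e by simp
    qed
    then show "\<exists>N. \<forall>n\<ge>N. norm (op_norm S (\<lambda>x i. op_poly S (p n) T x i - A x i) - 0) < e" by blast
  qed
next
  fix B assume "B \<in> bounded_ops S \<and> (\<forall>p. uniform_limit {r. complex_of_real r \<in> spectrum S T} (\<lambda>n.
      poly (p n)) h sequentially \<longrightarrow>
    (\<lambda>n. op_norm S (\<lambda>x i. op_poly S (p n) T x i - B x i)) \<longlonglongrightarrow> 0)"
  then have B: "B \<in> bounded_ops S" and Blim: "\<And>p. uniform_limit {r. complex_of_real r \<in> spectrum S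
      T} (\<lambda>n. poly (p n)) h sequentially \<Longrightarrow>
    (\<lambda>n. op_norm S (\<lambda>x i. op_poly S (p n) T x i - B x i)) \<longlonglongrightarrow> 0" by auto
  have "\<exists>p. \<forall>r. c \<le> r \<longrightarrow> r \<le> C \<longrightarrow> \<bar>poly p r - h r\<bar> \<le> 1 / real (Suc n)" for n
    using Weierstrass_poly[OF h, of "1 / real (Suc n)"] by (metis of_nat_0_less_iff zero_less_Suc
        zero_less_divide_1_iff)
  then obtain p where p: "\<And>n r. c \<le> r \<Longrightarrow> r \<le> C \<Longrightarrow> \<bar>poly (p n) r - h r\<bar> \<le> 1 / real (Suc n)" by metis
  have "uniform_limit {r. complex_of_real r \<in> spectrum S T} (\<lambda>n. poly (p n)) h sequentially"
  proof (rule uniform_limitI)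
    fix e :: real assume "e > 0"
    then have "\<forall>\<^sub>F n in sequentially. 1 / real (Suc n) < e"
      by (rule order_tendstoD(2)[OF LIMSEQ_Suc[OF lim_1_over_n]])
    then show "\<forall>\<^sub>F n in sequentially. \<forall>r\<in>{r. complex_of_real r \<in> spectrum S T}. dist (poly (p n)
        r) (h r) < e"
    proof (rule eventually_mono, intro ballI)
      fix n r assume n: "1 / real (Suc n) < e" and "r \<in> {r. complex_of_real r \<in> spectrum S T}"
      then have "c \<le> r" "r \<le> C" using spectrum_bounds by auto
      then show "dist (poly (p n) r) (h r) < e"
        using p[of r n] n unfolding dist_real_def by linarith
    qed
  qed
  note conv = Blim[OF this]
  show "B = A"
  proof (rule is_calculus_unique[OF A h B])
    fix e :: real and x :: "'a \<Rightarrow> complex" assume e: "e > 0" and x: "x \<in> ell2 S"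
    have "\<forall>\<^sub>F n in sequentially. 1 / real (Suc n) < e"
      by (rule order_tendstoD(2)[OF LIMSEQ_Suc[OF lim_1_over_n] e(1)])
    moreover have "\<forall>\<^sub>F n in sequentially. op_norm S (\<lambda>x i. op_poly S (p n) T x i - B x i) < e"
      using conv e by (auto simp: order_tendsto_iff)
    ultimately have "\<forall>\<^sub>F n in sequentially. 1 / real (Suc n) < e \<and> op_norm S (\<lambda>x i. op_poly S (p
        n) T x i - B x i) < e"
      by eventually_elim simp
    then obtain n where n: "1 / real (Suc n) < e" "op_norm S (\<lambda>x i. op_poly S (p n) T x i - B x i)
        < e"
      by (auto simp: eventually_sequentially)
    note P = bounded_ops_op_poly[OF T, of "p n"]
    obtain K1 where K1: "\<And>x. x \<in> ell2 S \<Longrightarrow> ell2_norm S (op_poly S (p n) T x) \<le> K1 * ell2_norm S x"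
      using bounded_ops_bound[OF P] by blast
    obtain K2 where K2: "\<And>x. x \<in> ell2 S \<Longrightarrow> ell2_norm S (B x) \<le> K2 * ell2_norm S x"
      using bounded_ops_bound[OF B] by blast
    have "ell2_norm S (\<lambda>i. op_poly S (p n) T x i - B x i) \<le> op_norm S (\<lambda>x i. op_poly S (p n) T x i
        - B x i) * ell2_norm S x"
    proof (rule op_norm_bound[OF _ _ x])
      show "ell2_norm S (\<lambda>i. op_poly S (p n) T x i - B x i) \<le> (K1 + K2) * ell2_norm S x" if x: "x
          \<in> ell2 S" for x
        using ell2_norm_diff_le[OF bounded_ops_mem[OF P x] bounded_ops_mem[OF B x]] K1[OF x] K2[OF
            x]
        by (simp add: distrib_right)
      show "(\<lambda>i. op_poly S (p n) T (\<lambda>i. a * x i) i - B (\<lambda>i. a * x i) i) = (\<lambda>i. a * (op_poly S (p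
          n) T x i - B x i))"
        if x: "x \<in> ell2 S" for a x
        unfolding bounded_ops_scale[OF P x] bounded_ops_scale[OF B x] by (simp add: algebra_simps)
    qed
    also have "\<dots> \<le> e * ell2_norm S x" using n(2) by (intro mult_right_mono) auto
    finally show "\<exists>p. (\<forall>r. c \<le> r \<longrightarrow> r \<le> C \<longrightarrow> \<bar>poly p r - h r\<bar> \<le> e) \<and>
        ell2_norm S (\<lambda>i. op_poly S p T x i - B x i) \<le> e * 1 * ell2_norm S x"
      using order_trans[OF p less_imp_le[OF n(1)]] by (intro exI[of _ "p n"]) simp
  qed simp
qed

section \<open>Self-adjointness, order bounds and products in the calculus\<close>

lemma is_calculus_self_adjoint:
  assumes A: "is_calculus h A" and h: "continuous_on {c..C} h"
  shows "self_adjoint S A"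
  unfolding self_adjoint_def
proof (intro ballI)
  fix x y assume x: "x \<in> ell2 S" and y: "y \<in> ell2 S"
  note Ax = bounded_ops_mem[OF is_calculus_bounded_ops[OF A] x]
    and Ay = bounded_ops_mem[OF is_calculus_bounded_ops[OF A] y]
  have "cmod (ell2_inner S (A x) y - ell2_inner S x (A y)) \<le> 0"
  proof (rule le_of_le_add_small)
    fix e :: real assume e: "e > 0"
    obtain p where "\<And>r. c \<le> r \<Longrightarrow> r \<le> C \<Longrightarrow> \<bar>poly p r - h r\<bar> \<le> e"
      and p: "\<And>x. x \<in> ell2 S \<Longrightarrow> ell2_norm S (\<lambda>i. op_poly S p T x i - A x i) \<le> e * ell2_norm S x"
      using is_calculus_approx[OF A h e] by blast
    note px = op_poly_mem[OF x, of p] and py = op_poly_mem[OF y, of p]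
    have eq: "ell2_inner S (A x) y - ell2_inner S x (A y) =
        ell2_inner S x (\<lambda>i. op_poly S p T y i - A y i) - ell2_inner S (\<lambda>i. op_poly S p T x i - A x
            i) y"
      unfolding ell2_inner_diff_left[OF px Ax y] ell2_inner_diff_right[OF py Ay x]
      using self_adjoint_op_poly[OF T sa, of p] x y by (simp add: self_adjoint_def)
    have "cmod (ell2_inner S (A x) y - ell2_inner S x (A y))
        \<le> cmod (ell2_inner S x (\<lambda>i. op_poly S p T y i - A y i))
          + cmod (ell2_inner S (\<lambda>i. op_poly S p T x i - A x i) y)"
      unfolding eq by (rule norm_triangle_ineq4)
    also have "\<dots> \<le> ell2_norm S x * ell2_norm S (\<lambda>i. op_poly S p T y i - A y i)
        + ell2_norm S (\<lambda>i. op_poly S p T x i - A x i) * ell2_norm S y"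
      using ell2_Cauchy_Schwarz[OF x ell2_diff[OF py Ay]] ell2_Cauchy_Schwarz[OF ell2_diff[OF px
          Ax] y]
      by (rule add_mono)
    also have "\<dots> \<le> ell2_norm S x * (e * ell2_norm S y) + (e * ell2_norm S x) * ell2_norm S y"
      using mult_left_mono[OF p[OF y] ell2_norm_nonneg[of S x]]
        mult_right_mono[OF p[OF x] ell2_norm_nonneg[of S y]] by (rule add_mono)
    finally show "cmod (ell2_inner S (A x) y - ell2_inner S x (A y)) \<le> 0 + e * (2 * (ell2_norm S x
        * ell2_norm S y))"
      by (simp add: algebra_simps)
  qed auto
  then show "ell2_inner S (A x) y = ell2_inner S x (A y)" by simp
qed

text \<open>Comparison with a constant: the midpoint \<open>k\<close> of \<open>[m, M]\<close> is
  within half the length \<open>e\<close> of \<open>h\<close>, and Cauchy-Schwarz turns the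
  resulting operator estimate into the bounds \<open>k - e\<close> and \<open>k + e\<close> on the
  quadratic form.\<close>

lemma is_calculus_inner_bounds:
  assumes A: "is_calculus h A" and h: "\<And>r. c \<le> r \<Longrightarrow> r \<le> C \<Longrightarrow> m \<le> h r \<and> h r \<le> M" and x: "x \<in> ell2 S"
  shows "m * (ell2_norm S x)\<^sup>2 \<le> Re (ell2_inner S (A x) x)"
    "Re (ell2_inner S (A x) x) \<le> M * (ell2_norm S x)\<^sup>2"
proof -
  define k where "k = (m + M) / 2"
  define e where "e = (M - m) / 2"
  note Ax = bounded_ops_mem[OF is_calculus_bounded_ops[OF A] x]
  have "ell2_norm S (\<lambda>i. op_poly S [:k:] T x i - A x i) \<le> e * ell2_norm S x"
  proof (rule is_calculusD[OF A _ x])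
    fix r assume "c \<le> r" "r \<le> C"
    then have "m \<le> h r" "h r \<le> M" using h by auto
    then have "k - h r \<le> e" "h r - k \<le> e" by (simp_all add: k_def e_def field_simps)
    then show "\<bar>poly [:k:] r - h r\<bar> \<le> e" by (simp add: abs_le_iff)
  qed
  then have n: "ell2_norm S (\<lambda>i. of_real k * x i - A x i) \<le> e * ell2_norm S x"
    by (simp add: op_poly_const[OF x])
  have "cmod (of_real k * of_real ((ell2_norm S x)\<^sup>2) - ell2_inner S (A x) x) \<le> (e * ell2_norm S
      x) * ell2_norm S x"
    using ell2_Cauchy_Schwarz[OF ell2_diff[OF ell2_scale[OF x] Ax] x, of "of_real k"]
      mult_right_mono[OF n, of "ell2_norm S x"]
    by (simp add: ell2_inner_diff_left[OF ell2_scale[OF x] Ax x] ell2_inner_scale_left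
        ell2_inner_self[OF x])
  then have "\<bar>k * (ell2_norm S x)\<^sup>2 - Re (ell2_inner S (A x) x)\<bar> \<le> e * (ell2_norm S x)\<^sup>2"
    using abs_Re_le_cmod[of "of_real k * of_real ((ell2_norm S x)\<^sup>2) - ell2_inner S (A x) x"]
    by (simp add: power2_eq_square mult.assoc)
  moreover have "m = k - e" "M = k + e" by (simp_all add: k_def e_def field_simps)
  ultimately show "m * (ell2_norm S x)\<^sup>2 \<le> Re (ell2_inner S (A x) x)"
    "Re (ell2_inner S (A x) x) \<le> M * (ell2_norm S x)\<^sup>2"
    by (simp_all add: left_diff_distrib distrib_right abs_le_iff)
qed

text \<open>\<open>a + h1 h2\<close> is one Horner step, the form consumed by the induction in
  \<open>is_calculus_poly_comp\<close>. The candidate operator is identified with the already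
  existing calculus of the function through \<open>is_calculus_unique\<close>.\<close>

lemma is_calculus_const_add_mult:
  assumes A1: "is_calculus h1 A1" and A2: "is_calculus h2 A2"
    and h1: "continuous_on {c..C} h1" and h2: "continuous_on {c..C} h2"
  shows "is_calculus (\<lambda>t. a + h1 t * h2 t)
    (\<lambda>x. if x \<in> ell2 S then (\<lambda>i. of_real a * x i + A1 (A2 x) i) else (\<lambda>_. 0))" (is "is_calculus ?h
        ?B")
proof -
  note b1 = is_calculus_bounded_ops[OF A1] and b2 = is_calculus_bounded_ops[OF A2]
  have h: "continuous_on {c..C} ?h" using h1 h2 by (intro continuous_intros)
  obtain A where A: "is_calculus ?h A" using is_calculus_exists[OF h] by blast
  obtain B1 where B1: "0 \<le> B1" "\<And>x. x \<in> ell2 S \<Longrightarrow> ell2_norm S (A1 x) \<le> B1 * ell2_norm S x"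
    using bounded_ops_bound[OF b1] by blast
  obtain B2 where B2: "0 \<le> B2" "\<And>x. x \<in> ell2 S \<Longrightarrow> ell2_norm S (A2 x) \<le> B2 * ell2_norm S x"
    using bounded_ops_bound[OF b2] by blast
  have "bounded (h1 ` {c..C})" "bounded (h2 ` {c..C})"
    using h1 h2 by (auto intro!: compact_imp_bounded compact_continuous_image)
  then obtain M1 M2 where "\<forall>y\<in>h1 ` {c..C}. norm y \<le> M1" "\<forall>y\<in>h2 ` {c..C}. norm y \<le> M2"
    unfolding bounded_iff by blast
  then have M0: "\<And>r. c \<le> r \<Longrightarrow> r \<le> C \<Longrightarrow> \<bar>h1 r\<bar> \<le> M1" "\<And>r. c \<le> r \<Longrightarrow> r \<le> C \<Longrightarrow> \<bar>h2 r\<bar> \<le> M2"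
    by auto
  define M where "M = \<bar>M1\<bar> + \<bar>M2\<bar>"
  have M: "\<And>r. c \<le> r \<Longrightarrow> r \<le> C \<Longrightarrow> \<bar>h1 r\<bar> \<le> M" "\<And>r. c \<le> r \<Longrightarrow> r \<le> C \<Longrightarrow> \<bar>h2 r\<bar> \<le> M" "0 \<le> M"
    using M0 by (force simp: M_def)+
  have A12: "A1 (A2 x) \<in> ell2 S" if "x \<in> ell2 S" for x
    using that b1 b2 by (blast intro: bounded_ops_mem)
  have "?B \<in> bounded_ops S"
  proof (rule bounded_opsI[where B = "\<bar>a\<bar> + B1 * B2"])
    fix x assume x: "x \<in> ell2 S"
    have ax: "(\<lambda>i. of_real a * x i) \<in> ell2 S" using x by (rule ell2_scale)
    show "?B x \<in> ell2 S" using x ell2_add[OF ax A12[OF x]] by simp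
    have "ell2_norm S (A1 (A2 x)) \<le> B1 * (B2 * ell2_norm S x)"
      using B1(2)[OF bounded_ops_mem[OF b2 x]] B2(2)[OF x] B1(1) by (meson mult_left_mono
          order_trans)
    then show "ell2_norm S (?B x) \<le> (\<bar>a\<bar> + B1 * B2) * ell2_norm S x"
      using x ell2_norm_triangle[OF ax A12[OF x]] by (simp add: ell2_norm_scale algebra_simps)
    show "?B (\<lambda>i. k * x i) = (\<lambda>i. k * ?B x i)" for k
      using x bounded_ops_mem[OF b2 x]
      by (simp add: ell2_scale bounded_ops_scale[OF b1] bounded_ops_scale[OF b2] algebra_simps)
    fix y assume y: "y \<in> ell2 S"
    show "?B (\<lambda>i. x i + y i) = (\<lambda>i. ?B x i + ?B y i)"
      using x y bounded_ops_mem[OF b2 x] bounded_ops_mem[OF b2 y]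
      by (simp add: ell2_add bounded_ops_add[OF b1] bounded_ops_add[OF b2] algebra_simps)
  qed simp
  then have "?B = A"
  proof (rule is_calculus_unique[OF A h])
    fix e :: real and x :: "'a \<Rightarrow> complex" assume e: "e > 0" "e \<le> 1" and x: "x \<in> ell2 S"
    \<comment> \<open>The product of two approximations with error \<open>d\<close> has error at
      most \<open>d^2 + 2 M d\<close>, which is at most \<open>d (2 M + 1)\<close> since
      \<open>d \<le> 1\<close>. The denominator \<open>2 M + 2\<close> makes this at most
      \<open>e\<close> and also gives \<open>d \<le> e\<close>.\<close>
    define d where "d = e / (2 * M + 2)"
    have M1: "2 * M + 2 > 0" using M(3) by simp
    have d: "d > 0" "d \<le> e" "d * (2 * M + 1) \<le> e"
    proof -
      show "d > 0" using e M1 by (simp add: d_def)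
      have ed: "e = d * (2 * M + 2)" using M1 by (simp add: d_def)
      show "d \<le> e" "d * (2 * M + 1) \<le> e"
        unfolding ed using \<open>d > 0\<close> M(3) by (auto intro!: mult_left_mono simp: mult_le_cancel_left1)
    qed
    obtain p1 where p1: "\<And>r. c \<le> r \<Longrightarrow> r \<le> C \<Longrightarrow> \<bar>poly p1 r - h1 r\<bar> \<le> d"
      "\<And>x. x \<in> ell2 S \<Longrightarrow> ell2_norm S (\<lambda>i. op_poly S p1 T x i - A1 x i) \<le> d * ell2_norm S x"
      using is_calculus_approx[OF A1 h1 d(1)] by blast
    obtain p2 where p2: "\<And>r. c \<le> r \<Longrightarrow> r \<le> C \<Longrightarrow> \<bar>poly p2 r - h2 r\<bar> \<le> d"
      "\<And>x. x \<in> ell2 S \<Longrightarrow> ell2_norm S (\<lambda>i. op_poly S p2 T x i - A2 x i) \<le> d * ell2_norm S x"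
      using is_calculus_approx[OF A2 h2 d(1)] by blast
    let ?p = "[:a:] + p1 * p2"
    have "\<bar>poly ?p r - ?h r\<bar> \<le> e" if r: "c \<le> r" "r \<le> C" for r
    proof -
      have "poly ?p r - ?h r = (poly p1 r - h1 r) * (poly p2 r - h2 r) + (poly p1 r - h1 r) * h2 r
          + h1 r * (poly p2 r - h2 r)"
        by (simp add: algebra_simps)
      also have "\<bar>\<dots>\<bar> \<le> d * d + d * M + M * d"
        using p1(1)[OF r] p2(1)[OF r] M(1,2)[OF r] d(1) M(3)
        by (intro order_trans[OF abs_triangle_ineq] add_mono) (auto simp: abs_mult intro!:
            mult_mono)
      also have "\<dots> \<le> d * (2 * M + 1)"
        using d(1,2) e(2) mult_left_mono[of d 1 d] by (simp add: algebra_simps)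
      finally show ?thesis using d(3) by simp
    qed
    moreover have "ell2_norm S (\<lambda>i. op_poly S ?p T x i - ?B x i) \<le> e * (M + 1 + B2) * ell2_norm S x"
    proof -
      note p2x = op_poly_mem[OF x, of p2] and A2x = bounded_ops_mem[OF b2 x]
      note p1p2x = op_poly_mem[OF p2x, of p1] and p1A2x = op_poly_mem[OF A2x, of p1] and A1A2x =
          A12[OF x]
      have dd: "?p - [:a:] = p1 * p2" by simp
      have eq: "(\<lambda>i. op_poly S ?p T x i - ?B x i) = (\<lambda>i. op_poly S p1 T (op_poly S p2 T x) i - A1
          (A2 x) i)"
        using op_poly_diff[OF T x, of ?p "[:a:]"] x unfolding dd op_poly_mult[OF T x]
            op_poly_const[OF x]
        by (auto simp: fun_eq_iff algebra_simps)
      have t: "ell2_norm S (\<lambda>i. op_poly S p1 T (op_poly S p2 T x) i - A1 (A2 x) i)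
          \<le> ell2_norm S (\<lambda>i. op_poly S p1 T (op_poly S p2 T x) i - op_poly S p1 T (A2 x) i)
          + ell2_norm S (\<lambda>i. op_poly S p1 T (A2 x) i - A1 (A2 x) i)"
        by (rule ell2_norm_triangle_diff[OF p1p2x p1A2x A1A2x])
      have "d * ell2_norm S (A2 x) \<le> e * (B2 * ell2_norm S x)"
        using d(1,2) B2(2)[OF x] by (intro mult_mono) auto
      then have t1: "ell2_norm S (\<lambda>i. op_poly S p1 T (A2 x) i - A1 (A2 x) i) \<le> e * (B2 * ell2_norm
          S x)"
        using p1(2)[OF A2x] by (rule order_trans[rotated])
      let ?y = "\<lambda>i. op_poly S p2 T x i - A2 x i"
      have y: "?y \<in> ell2 S" by (rule ell2_diff[OF p2x A2x])
      \<comment> \<open>On \<open>[c, C]\<close> the polynomial \<open>p1\<close> is within 1 of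
        \<open>h1\<close>, hence bounded by \<open>M + 1\<close>; so \<open>p1(T)\<close> has norm
        at most \<open>M + 1\<close>, uniformly in \<open>e\<close>.\<close>
      have "ell2_norm S (\<lambda>i. op_poly S p1 T ?y i - op_poly S 0 T ?y i) \<le> (M + 1) * ell2_norm S ?y"
      proof (rule op_poly_diff_bound[OF _ y])
        fix r assume r: "c \<le> r" "r \<le> C"
        show "\<bar>poly p1 r - poly 0 r\<bar> \<le> M + 1"
          using p1(1)[OF r] M(1)[OF r] d(2) e(2) unfolding poly_0 by linarith
      qed
      then have t2: "ell2_norm S (op_poly S p1 T ?y) \<le> (M + 1) * ell2_norm S ?y"
        by (simp add: op_poly_0)
      have "d * ell2_norm S x \<le> e * ell2_norm S x" using d(2) by (rule mult_right_mono) simp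
      then have "ell2_norm S ?y \<le> e * ell2_norm S x" using p2(2)[OF x] by linarith
      then have "(M + 1) * ell2_norm S ?y \<le> (M + 1) * (e * ell2_norm S x)"
        by (rule mult_left_mono) (use M(3) in simp)
      then have "ell2_norm S (op_poly S p1 T ?y) \<le> (M + 1) * (e * ell2_norm S x)" using t2 by
          linarith
      then have t3: "ell2_norm S (\<lambda>i. op_poly S p1 T (op_poly S p2 T x) i - op_poly S p1 T (A2 x) i)
          \<le> (M + 1) * (e * ell2_norm S x)"
        unfolding bounded_ops_diff[OF bounded_ops_op_poly[OF T, of p1] p2x A2x] .
      have "e * (M + 1 + B2) * ell2_norm S x = (M + 1) * (e * ell2_norm S x) + e * (B2 * ell2_norm
          S x)"
        by (simp add: algebra_simps)
      then show ?thesis unfolding eq using t t1 t3 by linarith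
    qed
    ultimately show "\<exists>p. (\<forall>r. c \<le> r \<longrightarrow> r \<le> C \<longrightarrow> \<bar>poly p r - ?h r\<bar> \<le> e) \<and>
        ell2_norm S (\<lambda>i. op_poly S p T x i - ?B x i) \<le> e * (M + 1 + B2) * ell2_norm S x"
      by blast
  qed (use M(3) B2(1) in simp)
  then show ?thesis using A by simp
qed

lemma is_calculus_const: "is_calculus (\<lambda>_. a) (op_poly S [:a:] T)"
  unfolding is_calculus_def using bounded_ops_op_poly[OF T] op_poly_diff_bound[of _ "[:a:]"] by auto

lemma is_calculus_poly_comp:
  assumes A: "is_calculus h A" and h: "continuous_on {c..C} h"
  shows "is_calculus (\<lambda>t. poly q (h t)) (op_poly S q A)"
proof (induction q)
  case 0
  have "op_poly S [:0:] T = op_poly S 0 A" by (auto simp: op_poly_def fun_eq_iff)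
  then show ?case using is_calculus_const[of 0] by simp
next
  case (pCons a q)
  note Ab = is_calculus_bounded_ops[OF A]
  have hq: "continuous_on {c..C} (\<lambda>t. poly q (h t))" using h by (intro continuous_intros)
  have "(\<lambda>x. if x \<in> ell2 S then (\<lambda>i. of_real a * x i + op_poly S q A (A x) i) else (\<lambda>_. 0)) =
      op_poly S (pCons a q) A"
    using op_poly_pCons[OF Ab] by (auto simp: op_poly_outside fun_eq_iff)
  then show ?case
    using is_calculus_const_add_mult[OF pCons.IH A hq h, of a] by (simp add: mult.commute)
qed

end

text \<open>The logarithm of the absolute value is a calculus of a calculus. A polynomial
  \<open>q\<close> near \<open>ln\<close> on \<open>[sqrt c, sqrt C]\<close>, evaluated at the
  square root of \<open>L\<close>, is a single calculus of \<open>L\<close> and thus near some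
  \<open>p(L)\<close>; the factor 1/2 is that of \<open>ln (sqrt r) = ln r / 2\<close>. Closeness is
  asserted on all of \<open>[c, C]\<close> because \<open>p\<close> is later evaluated at
  eigenvalues of compressions, which need not lie in the spectrum of \<open>L\<close>.\<close>

lemma log_abs_poly_approx:
  assumes "S \<noteq> {}" "L \<in> bounded_ops S" "self_adjoint S L" "0 < c"
    and "\<And>x. x \<in> ell2 S \<Longrightarrow> c * (ell2_norm S x)\<^sup>2 \<le> Re (ell2_inner S (L x) x)"
    and "\<And>x. x \<in> ell2 S \<Longrightarrow> Re (ell2_inner S (L x) x) \<le> C * (ell2_norm S x)\<^sup>2"
    and e: "e > 0"
  obtains p where "\<And>r. c \<le> r \<Longrightarrow> r \<le> C \<Longrightarrow> \<bar>poly p r - ln r / 2\<bar> \<le> e"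
    "\<And>x. x \<in> ell2 S \<Longrightarrow> ell2_norm S (\<lambda>i. op_poly S p L x i -
      functional_calculus S ln (functional_calculus S sqrt L) x i) \<le> e * ell2_norm S x"
    "functional_calculus S ln (functional_calculus S sqrt L) \<in> bounded_ops S"
proof -
  interpret L: bounded_self_adjoint S L c C
    using assms by unfold_locales
  have sq: "continuous_on {c..C} sqrt" by (intro continuous_intros)
  obtain A where A: "L.is_calculus sqrt A" using L.is_calculus_exists[OF sq] by blast
  have A_eq: "functional_calculus S sqrt L = A" by (rule L.functional_calculus_eq[OF A sq])
  have A_bounds: "sqrt c \<le> sqrt r \<and> sqrt r \<le> sqrt C" if "c \<le> r" "r \<le> C" for r using that by simp
  interpret A: bounded_self_adjoint S A "sqrt c" "sqrt C"
    using assms(1) L.is_calculus_bounded_ops[OF A] L.is_calculus_self_adjoint[OF A sq]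
      L.is_calculus_inner_bounds[OF A A_bounds] by unfold_locales auto
  have ln: "continuous_on {sqrt c..sqrt C} ln" using \<open>0 < c\<close> by (intro continuous_intros) (auto
      simp: order.strict_trans2[of 0 "sqrt c"])
  obtain B where B: "A.is_calculus ln B" using A.is_calculus_exists[OF ln] by blast
  have B_eq: "functional_calculus S ln A = B" by (rule A.functional_calculus_eq[OF B ln])
  have e2: "e / 2 > 0" using e by simp
  obtain q where q: "\<And>r. sqrt c \<le> r \<Longrightarrow> r \<le> sqrt C \<Longrightarrow> \<bar>poly q r - ln r\<bar> \<le> e / 2"
    "\<And>x. x \<in> ell2 S \<Longrightarrow> ell2_norm S (\<lambda>i. op_poly S q A x i - B x i) \<le> e / 2 * ell2_norm S x"
    using A.is_calculus_approx[OF B ln e2] by blast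
  have qs: "continuous_on {c..C} (\<lambda>t. poly q (sqrt t))" by (intro continuous_intros)
  obtain p where p: "\<And>r. c \<le> r \<Longrightarrow> r \<le> C \<Longrightarrow> \<bar>poly p r - poly q (sqrt r)\<bar> \<le> e / 2"
    "\<And>x. x \<in> ell2 S \<Longrightarrow> ell2_norm S (\<lambda>i. op_poly S p L x i - op_poly S q A x i) \<le> e / 2 * ell2_norm
        S x"
    using L.is_calculus_approx[OF L.is_calculus_poly_comp[OF A sq, of q] qs e2] by blast
  show thesis
  proof (rule that[of p])
    fix r assume r: "c \<le> r" "r \<le> C"
    have "ln (sqrt r) = ln r / 2" using r \<open>0 < c\<close> by (simp add: ln_sqrt)
    moreover have "\<bar>poly q (sqrt r) - ln (sqrt r)\<bar> \<le> e / 2" using r by (intro q(1)) auto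
    ultimately show "\<bar>poly p r - ln r / 2\<bar> \<le> e" using p(1)[OF r] by linarith
  next
    fix x assume x: "x \<in> ell2 S"
    have "ell2_norm S (\<lambda>i. op_poly S p L x i - B x i) \<le> e * ell2_norm S x"
      using ell2_norm_triangle_diff[OF L.op_poly_mem[OF x, of p] A.op_poly_mem[OF x, of q]
        bounded_ops_mem[OF A.is_calculus_bounded_ops[OF B] x]] p(2)[OF x] q(2)[OF x] by simp
    then show "ell2_norm S (\<lambda>i. op_poly S p L x i -
      functional_calculus S ln (functional_calculus S sqrt L) x i) \<le> e * ell2_norm S x"
      by (simp add: A_eq B_eq)
  qed (simp add: A_eq B_eq A.is_calculus_bounded_ops[OF B])
qed

section \<open>Integer matrices: lattice index, eigenvalues and traces\<close>

text \<open>Row operations change neither the determinant nor the lattice spanned by the rows. They lead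
  to a matrix whose first column has a single nonzero entry \<open>a\<close>; each of the \<open>\<bar>a\<bar>\<close> residue classes
  of the first coordinate is then handled by the minor of \<open>a\<close>.\<close>

lemma card_incongruent_le_abs_det:
  fixes A :: "int mat" and x :: "'i \<Rightarrow> nat \<Rightarrow> int"
  assumes "A \<in> carrier_mat n n" and "det A \<noteq> 0" and "finite I"
    and "\<And>a b. a \<in> I \<Longrightarrow> b \<in> I \<Longrightarrow> a \<noteq> b \<Longrightarrow>
      \<not> (\<exists>z. \<forall>j<n. x a j - x b j = (\<Sum>i<n. A $$ (i, j) * z i))"
  shows "int (card I) \<le> \<bar>det A\<bar>"
  using assms
proof (induction n arbitrary: A I x)
  case 0
  \<comment> \<open>In dimension zero the congruence is vacuous, so there is only one class, and the
    determinant is 1.\<close>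
  have "card I \<le> 1"
    using 0(3,4) by (metis card_le_Suc0_iff_eq One_nat_def less_nat_zero_code)
  then show ?case using det_dim_zero[OF 0(1)] by simp
next
  case (Suc n)
  from Suc.prems show ?case
  \<comment> \<open>Euclid's algorithm on the first column, with the sum of its absolute values as
    decreasing measure.\<close>
  proof (induction "\<Sum>i<Suc n. nat \<bar>A $$ (i, 0)\<bar>" arbitrary: A rule: less_induct)
    case (less A)
    note A = less.prems(1)
    consider (red) i j where "i < Suc n" "j < Suc n" "i \<noteq> j" "A $$ (j, 0) \<noteq> 0"
        "\<bar>A $$ (j, 0)\<bar> \<le> \<bar>A $$ (i, 0)\<bar>"
      | (one) i where "i < Suc n" "\<And>j. j < Suc n \<Longrightarrow> j \<noteq> i \<Longrightarrow> A $$ (j, 0) = 0"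
    proof (cases "\<exists>i j. i < Suc n \<and> j < Suc n \<and> i \<noteq> j \<and> A $$ (i, 0) \<noteq> 0 \<and> A $$ (j, 0) \<noteq> 0")
      case True
      then obtain i j where ij: "i < Suc n" "j < Suc n" "i \<noteq> j" "A $$ (i, 0) \<noteq> 0" "A $$ (j, 0) \<noteq> 0"
        by blast
      show thesis
      proof (cases "\<bar>A $$ (j, 0)\<bar> \<le> \<bar>A $$ (i, 0)\<bar>")
        case True
        then show thesis using red[of i j] ij by blast
      next
        case False
        then show thesis using red[of j i] ij by simp
      qed
    next
      case False
      then show thesis using one[of 0] one by (metis zero_less_Suc)
    qed
    then show ?case
    proof cases
      case red
      \<comment> \<open>With this sign, adding \<open>c\<close> times row \<open>j\<close> lowers
        the absolute value of the entry \<open>(i, 0)\<close> by that of the nonzero entry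
        \<open>(j, 0)\<close>.\<close>
      define c :: int where "c = - sgn (A $$ (i, 0)) * sgn (A $$ (j, 0))"
      define B where "B = addrow c i j A"
      have B: "B \<in> carrier_mat (Suc n) (Suc n)" using A by (simp add: B_def)
      have ent: "B $$ (k, l) = (if k = i then c * A $$ (j, l) + A $$ (i, l) else A $$ (k, l))"
        if "k < Suc n" "l < Suc n" for k l
        using that A by (auto simp: B_def)
      have det: "det B = det A" unfolding B_def using red A by (intro det_addrow) auto
      have small: "\<bar>B $$ (i, 0)\<bar> < \<bar>A $$ (i, 0)\<bar>"
        using red ent[of i 0] by (auto simp: c_def sgn_if abs_if split: if_splits)
      have "(\<Sum>k<Suc n. nat \<bar>B $$ (k, 0)\<bar>) < (\<Sum>k<Suc n. nat \<bar>A $$ (k, 0)\<bar>)"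
      proof (rule sum_strict_mono_ex1)
        show "\<forall>k\<in>{..<Suc n}. nat \<bar>B $$ (k, 0)\<bar> \<le> nat \<bar>A $$ (k, 0)\<bar>"
        proof
          fix k assume "k \<in> {..<Suc n}"
          then show "nat \<bar>B $$ (k, 0)\<bar> \<le> nat \<bar>A $$ (k, 0)\<bar>"
            using small ent[of k 0] by (cases "k = i") auto
        qed
        show "\<exists>k\<in>{..<Suc n}. nat \<bar>B $$ (k, 0)\<bar> < nat \<bar>A $$ (k, 0)\<bar>"
          using small red by (intro bexI[of _ i]) auto
      qed simp
      then have "int (card I) \<le> \<bar>det B\<bar>"
      proof (rule less.hyps[OF _ B])
        show "det B \<noteq> 0" using det less.prems by simp
        show "finite I" by fact
        fix a b assume ab: "a \<in> I" "b \<in> I" "a \<noteq> b"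
        show "\<not> (\<exists>z. \<forall>l<Suc n. x a l - x b l = (\<Sum>k<Suc n. B $$ (k, l) * z k))"
        proof
          assume "\<exists>z. \<forall>l<Suc n. x a l - x b l = (\<Sum>k<Suc n. B $$ (k, l) * z k)"
          then obtain z where z: "\<And>l. l<Suc n \<Longrightarrow> x a l - x b l = (\<Sum>k<Suc n. B $$ (k, l) * z k)"
            by blast
          \<comment> \<open>Row \<open>i\<close> of \<open>B\<close> contains \<open>c\<close> times
            row \<open>j\<close> of \<open>A\<close>, so its coefficient is passed on to row
            \<open>j\<close>.\<close>
          define z' where "z' = z(j := z j + c * z i)"
          have "(\<Sum>k<Suc n. B $$ (k, l) * z k) = (\<Sum>k<Suc n. A $$ (k, l) * z' k)" if l: "l < Suc n"
              for l
          proof -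
            have "(\<Sum>k<Suc n. B $$ (k, l) * z k) =
              (\<Sum>k<Suc n. A $$ (k, l) * z k + (if k = i then c * A $$ (j, l) * z i else 0))"
              using ent l by (intro sum.cong) (auto simp: algebra_simps)
            also have "\<dots> = (\<Sum>k<Suc n. A $$ (k, l) * z k) + c * A $$ (j, l) * z i"
              using red by (simp add: sum.distrib del: sum.lessThan_Suc)
            also have "\<dots> = (\<Sum>k<Suc n. A $$ (k, l) * z k + (if k = j then A $$ (j, l) * (c * z i)
                else 0))"
              using red by (simp add: sum.distrib del: sum.lessThan_Suc)
            also have "\<dots> = (\<Sum>k<Suc n. A $$ (k, l) * z' k)"
              by (intro sum.cong) (auto simp: z'_def algebra_simps)
            finally show ?thesis .
          qed
          then show False using less.prems(4)[OF ab] z by metis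
        qed
      qed
      then show ?thesis using det by simp
    next
      case one
      define a where "a = A $$ (i, 0)"
      define B where "B = mat_delete A i 0"
      have B: "B \<in> carrier_mat n n" unfolding B_def using mat_delete_carrier[of A "Suc n" "Suc n"
          i 0] A by simp
      have entB: "B $$ (k, l) = A $$ (insert_index i k, Suc l)" if "k < n" "l < n" for k l
        using mat_delete_index[OF A one(1) zero_less_Suc that] by (simp add: B_def)
      have "det A = (\<Sum>k<Suc n. A $$ (k, 0) * cofactor A k 0)"
        by (rule laplace_expansion_column[OF A]) simp
      also have "\<dots> = (\<Sum>k<Suc n. if k = i then a * cofactor A i 0 else 0)"
        using one(2) by (intro sum.cong) (auto simp: a_def)
      also have "\<dots> = a * cofactor A i 0" using one(1) by (simp del: sum.lessThan_Suc)
      finally have detA: "\<bar>det A\<bar> = \<bar>a\<bar> * \<bar>det B\<bar>"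
        by (simp add: cofactor_def B_def abs_mult power_abs)
      then have a0: "a \<noteq> 0" and detB: "det B \<noteq> 0" using less.prems(2) by auto
      have split: "(\<Sum>k<Suc n. h k) = h i + (\<Sum>k<n. h (insert_index i k))" for h :: "nat \<Rightarrow> int"
      proof -
        have "{..<Suc n} = insert i (insert_index i ` {..<n})"
          using insert_index_image[OF one(1)] one(1) by (auto simp: atLeast0LessThan)
        moreover have "i \<notin> insert_index i ` {..<n}" by (metis imageE insert_index_exclude)
        ultimately show ?thesis
          by (simp add: sum.reindex[OF insert_index_inj_on])
      qed
      define J where "J r = {s\<in>I. x s 0 mod \<bar>a\<bar> = r}" for r
      have cardJ: "int (card (J r)) \<le> \<bar>det B\<bar>" for r
      proof -
        define q where "q s = (x s 0 - r) div a" for s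
        have q: "x s 0 - r = a * q s" if "s \<in> J r" for s
        proof -
          have "a dvd x s 0 - r" using that
            by (auto simp: J_def minus_mod_eq_mult_div)
          then show ?thesis by (simp add: q_def)
        qed
        \<comment> \<open>Subtracting \<open>q s\<close> times row \<open>i\<close> makes the first
          coordinate equal to \<open>r\<close> for every member of the class; congruence within the
          class is then decided by the remaining coordinates and the minor \<open>B\<close>.\<close>
        define y where "y s l = x s (Suc l) - q s * A $$ (i, Suc l)" for s l
        show ?thesis
        proof (rule Suc.IH[OF B detB, where x = y])
          show "finite (J r)" using less.prems(3) by (simp add: J_def)
          fix s t assume st: "s \<in> J r" "t \<in> J r" "s \<noteq> t"
          show "\<not> (\<exists>z. \<forall>l<n. y s l - y t l = (\<Sum>k<n. B $$ (k, l) * z k))"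
          proof
            assume "\<exists>z. \<forall>l<n. y s l - y t l = (\<Sum>k<n. B $$ (k, l) * z k)"
            then obtain z where z: "\<And>l. l<n \<Longrightarrow> y s l - y t l = (\<Sum>k<n. B $$ (k, l) * z k)" by blast
            define z' where "z' k = (if k = i then q s - q t else z (delete_index i k))" for k
            have "x s l - x t l = (\<Sum>k<Suc n. A $$ (k, l) * z' k)" if l: "l < Suc n" for l
            proof (cases l)
              case 0
              have "insert_index i k < Suc n" if "k < n" for k
                using that by (auto simp: insert_index_def)
              then have "(\<Sum>k<n. A $$ (insert_index i k, 0) * z' (insert_index i k)) = 0"
                using one(2) by (intro sum.neutral) auto
              then show ?thesis using 0 q[OF st(1)] q[OF st(2)]
                by (simp add: split z'_def a_def algebra_simps del: sum.lessThan_Suc)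
            next
              case (Suc m)
              then have "y s m - y t m = (\<Sum>k<n. A $$ (insert_index i k, Suc m) * z' (insert_index
                  i k))"
                using z[of m] l by (simp add: z'_def entB)
              then show ?thesis
                by (simp add: split Suc z'_def y_def algebra_simps del: sum.lessThan_Suc)
            qed
            moreover have "s \<in> I" "t \<in> I" using st by (auto simp: J_def)
            ultimately show False using less.prems(4) st(3) by blast
          qed
        qed
      qed
      have "I = (\<Union>r\<in>{0..<\<bar>a\<bar>}. J r)" using a0 by (auto simp: J_def)
      then have "card I \<le> (\<Sum>r\<in>{0..<\<bar>a\<bar>}. card (J r))"
        by (metis card_UN_le finite_atLeastLessThan_int)
      then have "int (card I) \<le> (\<Sum>r\<in>{0..<\<bar>a\<bar>}. int (card (J r)))"
        by (metis of_nat_mono of_nat_sum)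
      also have "\<dots> \<le> (\<Sum>r\<in>{0..<\<bar>a\<bar>}. \<bar>det B\<bar>)" by (intro sum_mono cardJ)
      also have "\<dots> = \<bar>det A\<bar>" by (simp add: detA)
      finally show ?thesis .
    qed
  qed
qed

section \<open>Eigenvalues and power traces of complex matrices\<close>

lemma upper_triangular_pow:
  fixes B :: "'a::comm_semiring_1 mat"
  assumes B: "B \<in> carrier_mat n n" and ut: "upper_triangular B"
  shows "upper_triangular (B ^\<^sub>m k) \<and> (\<forall>i<n. (B ^\<^sub>m k) $$ (i, i) = (B $$ (i, i)) ^ k)"
proof (induction k)
  case 0
  then show ?case using B by (auto intro!: upper_triangularI)
next
  case (Suc k)
  have Bk: "B ^\<^sub>m k \<in> carrier_mat n n" using B by (rule pow_carrier_mat)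
  have ent: "(B ^\<^sub>m Suc k) $$ (i, j) = (\<Sum>l<n. (B ^\<^sub>m k) $$ (i, l) * B $$ (l, j))" if "i < n" "j <
      n" for i j
    using that B Bk by (simp add: scalar_prod_def atLeast0LessThan)
  have z: "(B ^\<^sub>m k) $$ (i, l) = 0" if "l < i" "i < n" for i l
    using Suc that Bk upper_triangularD by (metis carrier_matD(1))
  have z': "B $$ (i, l) = 0" if "l < i" "i < n" for i l
    using ut that B upper_triangularD by (metis carrier_matD(1))
  have "upper_triangular (B ^\<^sub>m Suc k)"
  proof (rule upper_triangularI)
    fix i j assume ij: "j < i" "i < dim_row (B ^\<^sub>m Suc k)"
    then have "i < n" using Bk B by simp
    moreover have "(B ^\<^sub>m k) $$ (i, l) * B $$ (l, j) = 0" if "l < n" for l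
      using z[of l i] z'[of j l] ij(1) \<open>i < n\<close> that by (cases "l < i") auto
    ultimately show "(B ^\<^sub>m Suc k) $$ (i, j) = 0" using ij(1) by (subst ent) auto
  qed
  moreover have "(B ^\<^sub>m Suc k) $$ (i, i) = (B $$ (i, i)) ^ Suc k" if i: "i < n" for i
  proof -
    have "(\<Sum>l<n. (B ^\<^sub>m k) $$ (i, l) * B $$ (l, i)) = (\<Sum>l<n. if l = i then (B ^\<^sub>m k) $$ (i, i) * B
        $$ (i, i) else 0)"
      using z[of _ i] z'[of i] i by (intro sum.cong) (auto, metis linorder_neqE_nat mult_zero_left
          mult_zero_right)
    then show ?thesis using Suc i by (simp add: ent mult.commute del: pow_mat.simps)
  qed
  ultimately show ?case by blast
qed

lemma trace_similar_mat_wit: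
  fixes A :: "'a::comm_ring_1 mat"
  assumes A: "A \<in> carrier_mat n n" and sim: "similar_mat_wit A B P Q"
  shows "(\<Sum>i<n. A $$ (i, i)) = (\<Sum>i<n. B $$ (i, i))"
proof -
  note D = similar_mat_witD2[OF A sim]
  have tr: "(\<Sum>i<n. (X * Y) $$ (i, i)) = (\<Sum>i<n. (Y * X) $$ (i, i))"
    if "X \<in> carrier_mat n n" "Y \<in> carrier_mat n n" for X Y :: "'a mat"
    using that by (simp add: scalar_prod_def atLeast0LessThan) (subst sum.swap, simp add:
        mult.commute)
  have "(\<Sum>i<n. A $$ (i, i)) = (\<Sum>i<n. (Q * (P * B)) $$ (i, i))"
    using D tr[of "P * B" Q] by simp
  also have "Q * (P * B) = B" using assoc_mult_mat[OF D(7,6,5)] D by simp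
  finally show ?thesis .
qed

text \<open>A Schur triangular form carries the eigenvalues on its diagonal, and its powers carry
  their powers. Triangular form is enough: that the eigenvalues of the compressions are real and lie
  in \<open>[c, C]\<close> is obtained from individual eigenvectors.\<close>

lemma eigenvalues_det_trace:
  fixes A :: "complex mat"
  assumes A: "A \<in> carrier_mat n n"
  obtains es where "length es = n" "\<And>e. e \<in> set es \<Longrightarrow> eigenvalue A e" "det A = prod_list es"
    "\<And>k. (\<Sum>i<n. (A ^\<^sub>m k) $$ (i, i)) = (\<Sum>e\<leftarrow>es. e ^ k)"
proof -
  obtain es where es: "char_poly A = (\<Prod>e\<leftarrow>es. [:- e, 1:])" "length es = n"
    using char_poly_factorized[OF A] by blast
  obtain B P Q where "schur_decomposition A es = (B, P, Q)" by (metis prod_cases3)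
  from schur_decomposition[OF A es(1) this]
  have wit: "similar_mat_wit A B P Q" and ut: "upper_triangular B" and dg: "diag_mat B = es" by auto
  note D = similar_mat_witD2[OF A wit]
  have "eigenvalue A e" if "e \<in> set es" for e
  proof -
    have "poly (\<Prod>e\<leftarrow>es. [:- e, 1:]) e = 0" using that
      by (induction es) auto
    then show ?thesis using eigenvalue_root_char_poly[OF A] es(1) by simp
  qed
  moreover have "det A = prod_list es"
    using det_similar[of A B] wit det_upper_triangular[OF ut D(5)] dg unfolding similar_mat_def by
        auto
  moreover have "(\<Sum>i<n. (A ^\<^sub>m k) $$ (i, i)) = (\<Sum>e\<leftarrow>es. e ^ k)" for k
  proof -
    have "(\<Sum>i<n. (A ^\<^sub>m k) $$ (i, i)) = (\<Sum>i<n. (B ^\<^sub>m k) $$ (i, i))"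
      using trace_similar_mat_wit[OF pow_carrier_mat[OF A] similar_mat_wit_pow[OF wit]] .
    also have "\<dots> = (\<Sum>i<n. (B $$ (i, i)) ^ k)"
      using upper_triangular_pow[OF D(5) ut] by simp
    also have "\<dots> = (\<Sum>e\<leftarrow>es. e ^ k)"
      using D(5) by (simp add: dg[symmetric] diag_mat_def sum_list_distinct_conv_sum_set o_def
          atLeast0LessThan)
    finally show ?thesis .
  qed
  ultimately show thesis using that es(2) by blast
qed

section \<open>Convolution operators with finite support\<close>

text \<open>The value type is left open, since the notion serves both real kernels and complex
  vectors.\<close>

definition fin_fun :: "('a, 'c) monoid_scheme \<Rightarrow> ('a \<Rightarrow> 'b::zero) set" where
  "fin_fun G = {a. finite {s. a s \<noteq> 0} \<and> {s. a s \<noteq> 0} \<subseteq> carrier G}"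

definition ell1_norm :: "('a \<Rightarrow> real) \<Rightarrow> real" where
  "ell1_norm a = (\<Sum>t | a t \<noteq> 0. \<bar>a t\<bar>)"

text \<open>For a real-valued kernel the adjoint inverts the group variable and involves no
  conjugation.\<close>

definition conv_adjoint :: "('a, 'c) monoid_scheme \<Rightarrow> ('a \<Rightarrow> real) \<Rightarrow> 'a \<Rightarrow> real" where
  "conv_adjoint G a = (\<lambda>s. if s \<in> carrier G then a (inv\<^bsub>G\<^esub> s) else 0)"

text \<open>Right translations commute with left convolution operators, which makes the diagonal
  coefficients of such operators constant. The orientation is the one that moves
  \<open>point_mass \<one>\<close> to \<open>point_mass u\<close>.\<close>

definition right_translate :: "('a, 'c) monoid_scheme \<Rightarrow> 'a \<Rightarrow> ('a \<Rightarrow> 'b::zero) \<Rightarrow> 'a \<Rightarrow> 'b" where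
  "right_translate G u x = (\<lambda>s. if s \<in> carrier G then x (s \<otimes>\<^bsub>G\<^esub> inv\<^bsub>G\<^esub> u) else 0)"

lemma ell1_norm_nonneg [simp]: "0 \<le> ell1_norm a"
  by (simp add: ell1_norm_def sum_nonneg)

lemma ell1_norm_eq_sum: "finite K \<Longrightarrow> {t. a t \<noteq> 0} \<subseteq> K \<Longrightarrow> ell1_norm a = (\<Sum>t\<in>K. \<bar>a t\<bar>)"
  unfolding ell1_norm_def by (rule sum.mono_neutral_left) auto

context group begin

lemma convolution_eq_sum:
  fixes a x :: "'a \<Rightarrow> 'k::real_normed_field"
  assumes "finite K" "{t. a t \<noteq> 0} \<subseteq> K" "K \<subseteq> carrier G" "s \<in> carrier G"
  shows "convolution G a x s = (\<Sum>t\<in>K. a t * x (inv t \<otimes> s))"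
proof -
  have "(\<Sum>\<^sub>\<infinity>t\<in>carrier G. a t * x (inv t \<otimes> s)) = (\<Sum>\<^sub>\<infinity>t\<in>K. a t * x (inv t \<otimes> s))"
    using assms by (intro infsum_cong_neutral) auto
  then show ?thesis using assms by (simp add: convolution_def)
qed

text \<open>The substitution \<open>t = s \<otimes> inv u\<close> turns a sum governed by the kernel
  into one over the finite support of the vector.\<close>

lemma convolution_eq_sum_right:
  fixes a x :: "'a \<Rightarrow> 'k::real_normed_field"
  assumes "finite K" "{t. x t \<noteq> 0} \<subseteq> K" "K \<subseteq> carrier G" "s \<in> carrier G"
  shows "convolution G a x s = (\<Sum>u\<in>K. a (s \<otimes> inv u) * x u)"
proof -
  have inj: "inj_on (\<lambda>u. s \<otimes> inv u) K"
    using assms(3,4) by (intro inj_onI) (metis Units_eq Units_l_cancel inv_closed inv_inv subsetD)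
  have "(\<Sum>\<^sub>\<infinity>t\<in>carrier G. a t * x (inv t \<otimes> s)) = (\<Sum>\<^sub>\<infinity>t\<in>(\<lambda>u. s \<otimes> inv u) ` K. a t * x (inv t \<otimes> s))"
  proof (rule infsum_cong_neutral)
    fix t assume t: "t \<in> carrier G - (\<lambda>u. s \<otimes> inv u) ` K"
    have "inv t \<otimes> s \<notin> K"
    proof
      assume "inv t \<otimes> s \<in> K"
      moreover have "s \<otimes> inv (inv t \<otimes> s) = t"
        using t assms(4) by (simp add: inv_mult_group m_assoc[symmetric])
      ultimately show False using t by force
    qed
    then have "x (inv t \<otimes> s) = 0" using assms(2) by blast
    then show "a t * x (inv t \<otimes> s) = 0" by simp
  qed (use assms in auto)
  also have "\<dots> = (\<Sum>t\<in>(\<lambda>u. s \<otimes> inv u) ` K. a t * x (inv t \<otimes> s))" using assms(1) by simp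
  also have "\<dots> = (\<Sum>u\<in>K. a (s \<otimes> inv u) * x (inv (s \<otimes> inv u) \<otimes> s))"
    using sum.reindex[OF inj] by (simp add: o_def)
  also have "\<dots> = (\<Sum>u\<in>K. a (s \<otimes> inv u) * x u)"
  proof (rule sum.cong)
    fix u assume "u \<in> K"
    then have u: "u \<in> carrier G" using assms by blast
    then have "inv (s \<otimes> inv u) \<otimes> s = u" using assms(4)
      by (simp add: inv_mult_group m_assoc)
    then show "a (s \<otimes> inv u) * x (inv (s \<otimes> inv u) \<otimes> s) = a (s \<otimes> inv u) * x u" by simp
  qed simp
  finally show ?thesis using assms(4) by (simp add: convolution_def)
qed

lemma convolution_outside: "s \<notin> carrier G \<Longrightarrow> convolution G a x s = 0"
  by (simp add: convolution_def)

lemma fin_funD: "a \<in> fin_fun G \<Longrightarrow> finite {s. a s \<noteq> 0}" "a \<in> fin_fun G \<Longrightarrow> {s. a s \<noteq> 0} \<subseteq> carrier G"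
  by (auto simp: fin_fun_def)

lemma fin_fun_ell2: "x \<in> fin_fun G \<Longrightarrow> x \<in> ell2 (carrier G)"
  by (auto simp: fin_fun_def intro: ell2_finite_support)

lemma convolution_support:
  assumes "a \<in> fin_fun G" "{s. x s \<noteq> 0} \<subseteq> carrier G"
  shows "{s. convolution G a x s \<noteq> 0} \<subseteq> {s. a s \<noteq> 0} <#> {s. x s \<noteq> 0}"
proof
  fix s assume "s \<in> {s. convolution G a x s \<noteq> 0}"
  then have s: "convolution G a x s \<noteq> 0" by simp
  then have sG: "s \<in> carrier G" using convolution_outside by blast
  have "(\<Sum>t | a t \<noteq> 0. a t * x (inv t \<otimes> s)) \<noteq> 0"
    using s convolution_eq_sum[OF fin_funD(1)[OF assms(1)] order_refl fin_funD(2)[OF assms(1)] sG]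
        by simp
  then obtain t where t: "a t \<noteq> 0" "x (inv t \<otimes> s) \<noteq> 0" by (metis (mono_tags, lifting)
      mem_Collect_eq mult_eq_0_iff sum.not_neutral_contains_not_neutral)
  then have "t \<in> carrier G" using fin_funD(2)[OF assms(1)] by blast
  then have "s = t \<otimes> (inv t \<otimes> s)" using sG by (simp add: m_assoc[symmetric])
  then show "s \<in> {s. a s \<noteq> 0} <#> {s. x s \<noteq> 0}" using t by (auto simp: set_mult_def)
qed

lemma finite_set_mult: "finite A \<Longrightarrow> finite B \<Longrightarrow> finite (A <#> B)"
  by (auto simp: set_mult_def)

lemma convolution_fin_fun:
  assumes "a \<in> fin_fun G" "x \<in> fin_fun G"
  shows "convolution G a x \<in> fin_fun G"
proof -
  have "{s. convolution G a x s \<noteq> 0} \<subseteq> carrier G"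
    using convolution_outside by blast
  then show ?thesis
    using finite_subset[OF convolution_support[OF assms(1) fin_funD(2)[OF assms(2)]]] assms
      finite_set_mult fin_funD(1) by (auto simp: fin_fun_def)
qed

lemma conv_adjoint_support: "a \<in> fin_fun G \<Longrightarrow> {s. conv_adjoint G a s \<noteq> 0} = m_inv G ` {s. a s \<noteq> 0}"
  by (force simp: conv_adjoint_def fin_fun_def)

lemma conv_adjoint_fin_fun: "a \<in> fin_fun G \<Longrightarrow> conv_adjoint G a \<in> fin_fun G"
  using conv_adjoint_support[of a] by (auto simp: fin_fun_def)

lemma inj_on_inv: "inj_on (m_inv G) (carrier G)"
  by (intro inj_onI) (metis inv_inv)

lemma ell1_norm_conv_adjoint:
  assumes "a \<in> fin_fun G"
  shows "ell1_norm (conv_adjoint G a) = ell1_norm a"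
proof -
  have inj: "inj_on (m_inv G) {s. a s \<noteq> 0}"
    using inj_on_inv fin_funD(2)[OF assms] by (rule inj_on_subset)
  show ?thesis
    unfolding ell1_norm_def conv_adjoint_support[OF assms] sum.reindex[OF inj]
    using fin_funD(2)[OF assms] by (intro sum.cong) (auto simp: conv_adjoint_def)
qed

section \<open>Left translations and convolution operators\<close>

abbreviation left_translate :: "'a \<Rightarrow> ('a \<Rightarrow> complex) \<Rightarrow> 'a \<Rightarrow> complex" where
  "left_translate t x \<equiv> (\<lambda>s. if s \<in> carrier G then x (inv t \<otimes> s) else 0)"

lemma bij_left_mult: "t \<in> carrier G \<Longrightarrow> bij_betw (\<lambda>s. t \<otimes> s) (carrier G) (carrier G)"
  by (rule bij_betw_byWitness[where f' = "\<lambda>s. inv t \<otimes> s"]) (auto simp: m_assoc[symmetric])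

lemma left_translate_ell2:
  assumes t: "t \<in> carrier G" and x: "x \<in> ell2 (carrier G)"
  shows "left_translate t x \<in> ell2 (carrier G)"
    "ell2_norm (carrier G) (left_translate t x) = ell2_norm (carrier G) x"
proof -
  have bij: "bij_betw (\<lambda>s. inv t \<otimes> s) (carrier G) (carrier G)" using t by (intro bij_left_mult) simp
  have "(\<lambda>s. (cmod (x (inv t \<otimes> s)))\<^sup>2) summable_on carrier G"
    using summable_on_reindex_bij_betw[OF bij, of "\<lambda>s. (cmod (x s))\<^sup>2"] ell2_summable[OF x] by simp
  then have "(\<lambda>s. (cmod (left_translate t x s))\<^sup>2) summable_on carrier G"
    by (rule summable_on_cong[THEN iffD1, rotated]) simp
  then show "left_translate t x \<in> ell2 (carrier G)" by (simp add: ell2_def)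
  have "(\<Sum>\<^sub>\<infinity>s\<in>carrier G. (cmod (left_translate t x s))\<^sup>2) = (\<Sum>\<^sub>\<infinity>s\<in>carrier G. (cmod (x (inv t \<otimes>
      s)))\<^sup>2)"
    by (intro infsum_cong) simp
  also have "\<dots> = (\<Sum>\<^sub>\<infinity>s\<in>carrier G. (cmod (x s))\<^sup>2)"
    using infsum_reindex_bij_betw[OF bij, of "\<lambda>s. (cmod (x s))\<^sup>2"] by simp
  finally show "ell2_norm (carrier G) (left_translate t x) = ell2_norm (carrier G) x"
    by (simp add: ell2_norm_def)
qed

lemma left_translate_inner:
  assumes t: "t \<in> carrier G"
  shows "ell2_inner (carrier G) (left_translate t x) y = ell2_inner (carrier G) x (left_translate
      (inv t) y)"
proof -
  have "ell2_inner (carrier G) (left_translate t x) y = (\<Sum>\<^sub>\<infinity>s\<in>carrier G. x (inv t \<otimes> s) * cnj (y s))"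
    unfolding ell2_inner_def by (intro infsum_cong) simp
  also have "\<dots> = (\<Sum>\<^sub>\<infinity>s\<in>carrier G. x (inv t \<otimes> (t \<otimes> s)) * cnj (y (t \<otimes> s)))"
    using infsum_reindex_bij_betw[OF bij_left_mult[OF t], of "\<lambda>s. x (inv t \<otimes> s) * cnj (y s)"] by
        simp
  also have "\<dots> = ell2_inner (carrier G) x (left_translate (inv t) y)"
    unfolding ell2_inner_def using t by (intro infsum_cong) (simp add: m_assoc[symmetric])
  finally show ?thesis .
qed

text \<open>Writes the operator as a finite combination of left translations, which are isometries;
  boundedness, the adjoint and linearity in the kernel are reduced to this. \<open>K\<close> may
  exceed the support, so that two kernels can share one index set.\<close>

lemma convolution_op_eq_sum:
  assumes a: "a \<in> fin_fun G" and K: "finite K" "{t. a t \<noteq> 0} \<subseteq> K" "K \<subseteq> carrier G"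
    and x: "x \<in> ell2 (carrier G)"
  shows "convolution_op G a x = (\<lambda>s. \<Sum>t\<in>K. of_real (a t) * left_translate t x s)"
proof
  fix s
  show "convolution_op G a x s = (\<Sum>t\<in>K. of_real (a t) * left_translate t x s)"
  proof (cases "s \<in> carrier G")
    case True
    have "{t. complex_of_real (a t) \<noteq> 0} \<subseteq> K" using K by auto
    then show ?thesis
      using True x convolution_eq_sum[OF K(1) _ K(3) True, of "\<lambda>t. complex_of_real (a t)" x]
      by (simp add: convolution_op_def)
  qed (simp add: convolution_op_def convolution_outside)
qed

lemma convolution_op_apply:
  assumes "x \<in> ell2 (carrier G)"
  shows "convolution_op G a x = convolution G (\<lambda>s. complex_of_real (a s)) x"
  using assms by (simp add: convolution_op_def)

lemma convolution_op_bounded: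
  assumes a: "a \<in> fin_fun G"
  shows "convolution_op G a \<in> bounded_ops (carrier G)"
    and "\<And>x. x \<in> ell2 (carrier G) \<Longrightarrow>
      ell2_norm (carrier G) (convolution_op G a x) \<le> ell1_norm a * ell2_norm (carrier G) x"
proof -
  let ?K = "{t. a t \<noteq> 0}"
  note K = fin_funD[OF a]
  note eq = convolution_op_eq_sum[OF a K(1) order_refl K(2)]
  have mem: "(\<lambda>s. of_real (a t) * left_translate t x s) \<in> ell2 (carrier G)"
    if "x \<in> ell2 (carrier G)" "t \<in> ?K" for x t
    using that K(2) left_translate_ell2(1)[of t x] by (intro ell2_scale) auto
  show b: "ell2_norm (carrier G) (convolution_op G a x) \<le> ell1_norm a * ell2_norm (carrier G) x"
    if x: "x \<in> ell2 (carrier G)" for x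
  proof -
    have "ell2_norm (carrier G) (convolution_op G a x)
        \<le> (\<Sum>t\<in>?K. ell2_norm (carrier G) (\<lambda>s. of_real (a t) * left_translate t x s))"
      unfolding eq[OF x] using mem[OF x] by (rule ell2_norm_sum)
    also have "\<dots> = (\<Sum>t\<in>?K. \<bar>a t\<bar> * ell2_norm (carrier G) x)"
    proof (rule sum.cong)
      fix t assume "t \<in> ?K"
      then have "t \<in> carrier G" using K by blast
      then show "ell2_norm (carrier G) (\<lambda>s. of_real (a t) * left_translate t x s) = \<bar>a t\<bar> *
          ell2_norm (carrier G) x"
        by (simp only: ell2_norm_scale norm_of_real left_translate_ell2(2)[OF _ x])
    qed simp
    finally show ?thesis by (simp add: ell1_norm_def sum_distrib_right)
  qed
  show "convolution_op G a \<in> bounded_ops (carrier G)"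
  proof (rule bounded_opsI[OF _ _ _ b])
    fix x assume x: "x \<in> ell2 (carrier G)"
    show "convolution_op G a x \<in> ell2 (carrier G)"
      unfolding eq[OF x] using mem[OF x] by (rule ell2_sum)
    show "convolution_op G a (\<lambda>i. c * x i) = (\<lambda>i. c * convolution_op G a x i)" for c
      unfolding eq[OF x] eq[OF ell2_scale[OF x]] sum_distrib_left
      by (intro ext sum.cong) (auto simp: algebra_simps)
    fix y assume y: "y \<in> ell2 (carrier G)"
    show "convolution_op G a (\<lambda>i. x i + y i) = (\<lambda>i. convolution_op G a x i + convolution_op G a y
        i)"
      unfolding eq[OF x] eq[OF y] eq[OF ell2_add[OF x y]] sum.distrib[symmetric]
      by (intro ext sum.cong) (auto simp: algebra_simps)
  qed (simp_all add: convolution_op_def)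
qed

lemma ell2_inner_sum_left:
  assumes "\<And>k. k \<in> A \<Longrightarrow> f k \<in> ell2 S" "y \<in> ell2 S"
  shows "ell2_inner S (\<lambda>i. \<Sum>k\<in>A. f k i) y = (\<Sum>k\<in>A. ell2_inner S (f k) y)"
  using assms(1)
proof (induction A rule: infinite_finite_induct)
  case (insert a A)
  then show ?case using assms(2)
    by (simp add: ell2_inner_add_left ell2_sum)
qed (auto simp: ell2_inner_def)

lemma convolution_op_adjoint:
  assumes a: "a \<in> fin_fun G" and x: "x \<in> ell2 (carrier G)" and y: "y \<in> ell2 (carrier G)"
  shows "ell2_inner (carrier G) (convolution_op G a x) y =
    ell2_inner (carrier G) x (convolution_op G (conv_adjoint G a) y)"
proof -
  let ?K = "{t. a t \<noteq> 0}"
  note K = fin_funD[OF a]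
  have inj: "inj_on (m_inv G) ?K" using inj_on_inv K(2) by (rule inj_on_subset)
  have KG: "t \<in> carrier G" if "t \<in> ?K" for t using that K by blast
  have "ell2_inner (carrier G) (convolution_op G a x) y =
      (\<Sum>t\<in>?K. ell2_inner (carrier G) (\<lambda>s. of_real (a t) * left_translate t x s) y)"
    unfolding convolution_op_eq_sum[OF a K(1) order_refl K(2) x]
    using left_translate_ell2(1)[OF KG x] by (intro ell2_inner_sum_left ell2_scale y)
  also have "\<dots> = (\<Sum>t\<in>?K. of_real (a t) * ell2_inner (carrier G) x (left_translate (inv t) y))"
    using KG by (intro sum.cong refl) (simp only: ell2_inner_scale_left left_translate_inner)
  also have "\<dots> = cnj (\<Sum>t\<in>?K. of_real (a t) * ell2_inner (carrier G) (left_translate (inv t) y) x)"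
    unfolding cnj_sum by (intro sum.cong refl) (simp add: ell2_inner_commute[of _ x])
  also have "(\<Sum>t\<in>?K. of_real (a t) * ell2_inner (carrier G) (left_translate (inv t) y) x) =
     (\<Sum>t\<in>m_inv G ` ?K. of_real (conv_adjoint G a t) * ell2_inner (carrier G) (left_translate t y)
         x)"
    unfolding sum.reindex[OF inj] using KG by (intro sum.cong refl) (simp add: conv_adjoint_def)
  also have "\<dots> = (\<Sum>t\<in>m_inv G ` ?K. ell2_inner (carrier G) (\<lambda>s. of_real (conv_adjoint G a t) *
      left_translate t y s) x)"
    by (simp only: ell2_inner_scale_left)
  also have "\<dots> = ell2_inner (carrier G) (convolution_op G (conv_adjoint G a) y) x"
  proof -
    have i: "t \<in> carrier G" if "t \<in> m_inv G ` ?K" for t using that KG by auto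
    have "convolution_op G (conv_adjoint G a) y = (\<lambda>s. \<Sum>t\<in>m_inv G ` ?K. of_real (conv_adjoint G a
        t) * left_translate t y s)"
      using conv_adjoint_support[OF a] K(1) i y
      by (intro convolution_op_eq_sum conv_adjoint_fin_fun a) auto
    then show ?thesis
      using left_translate_ell2(1)[OF i y] by (simp only:) (intro ell2_inner_sum_left[symmetric]
          ell2_scale x)
  qed
  finally show ?thesis by (simp add: ell2_inner_commute[of _ x])
qed

text \<open>Associativity of convolution: the finite sums over the two supports are interchanged and
  the inner one is shifted by \<open>v = t \<otimes> u\<close>, so that \<open>x\<close> may be any
  square-summable family.\<close>

lemma convolution_op_compose:
  assumes a: "a \<in> fin_fun G" and b: "b \<in> fin_fun G" and x: "x \<in> ell2 (carrier G)"
  shows "convolution_op G a (convolution_op G b x) = convolution_op G (convolution G a b) x"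
proof
  fix s
  let ?A = "{t. a t \<noteq> 0}" and ?B = "{t. b t \<noteq> 0}"
  note A = fin_funD[OF a] and B = fin_funD[OF b]
  note bx = bounded_ops_mem[OF convolution_op_bounded(1)[OF b] x]
  note ab = convolution_fin_fun[OF a b]
  show "convolution_op G a (convolution_op G b x) s = convolution_op G (convolution G a b) x s"
  proof (cases "s \<in> carrier G")
    case s: True
    have AB: "finite (?A <#> ?B)" "?A <#> ?B \<subseteq> carrier G"
      using A B finite_set_mult by (auto simp: set_mult_def)
    have "convolution_op G (convolution G a b) x s =
        (\<Sum>v\<in>?A <#> ?B. of_real (convolution G a b v) * left_translate v x s)"
      using convolution_op_eq_sum[OF ab AB(1) convolution_support[OF a B(2)] AB(2) x] by simp
    also have "\<dots> = (\<Sum>v\<in>?A <#> ?B. \<Sum>t\<in>?A. of_real (a t) * (of_real (b (inv t \<otimes> v)) * x (inv v \<otimes> s)))"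
    proof (rule sum.cong)
      fix v assume "v \<in> ?A <#> ?B"
      then have "v \<in> carrier G" using AB by blast
      then show "of_real (convolution G a b v) * left_translate v x s =
          (\<Sum>t\<in>?A. of_real (a t) * (of_real (b (inv t \<otimes> v)) * x (inv v \<otimes> s)))"
        using s convolution_eq_sum[OF A(1) order_refl A(2), of v b] by (simp add:
            sum_distrib_right mult.assoc)
    qed simp
    also have "\<dots> = (\<Sum>t\<in>?A. of_real (a t) * (\<Sum>v\<in>?A <#> ?B. of_real (b (inv t \<otimes> v)) * x (inv v \<otimes> s)))"
      by (subst sum.swap) (simp add: sum_distrib_left)
    also have "\<dots> = (\<Sum>t\<in>?A. of_real (a t) * left_translate t (convolution_op G b x) s)"
    proof (rule sum.cong)
      fix t assume t: "t \<in> ?A"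
      then have tG: "t \<in> carrier G" using A by blast
      have inj: "inj_on (\<lambda>u. t \<otimes> u) ?B" using B(2) tG by (intro inj_onI) (metis Units_eq
          Units_l_cancel subsetD)
      have "(\<Sum>v\<in>?A <#> ?B. of_real (b (inv t \<otimes> v)) * x (inv v \<otimes> s)) =
          (\<Sum>v\<in>(\<lambda>u. t \<otimes> u) ` ?B. of_real (b (inv t \<otimes> v)) * x (inv v \<otimes> s))"
      proof (rule sum.mono_neutral_right[OF AB(1)])
        show "(\<lambda>u. t \<otimes> u) ` ?B \<subseteq> ?A <#> ?B" using t by (auto simp: set_mult_def)
        show "\<forall>v\<in>(?A <#> ?B) - (\<lambda>u. t \<otimes> u) ` ?B. of_real (b (inv t \<otimes> v)) * x (inv v \<otimes> s) = 0"
        proof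
          fix v assume v: "v \<in> (?A <#> ?B) - (\<lambda>u. t \<otimes> u) ` ?B"
          then have "v \<in> carrier G" using AB(2) by (meson DiffD1 subsetD)
          then have "v = t \<otimes> (inv t \<otimes> v)" using tG by (simp add: m_assoc[symmetric])
          then have "b (inv t \<otimes> v) = 0" using v by blast
          then show "of_real (b (inv t \<otimes> v)) * x (inv v \<otimes> s) = 0" by simp
        qed
      qed
      also have "\<dots> = (\<Sum>u\<in>?B. of_real (b u) * left_translate u x (inv t \<otimes> s))"
        unfolding sum.reindex[OF inj]
      proof (rule sum.cong)
        fix u assume "u \<in> ?B"
        then have u: "u \<in> carrier G" using B by blast
        have "inv t \<otimes> (t \<otimes> u) = u" using tG u by (simp add: m_assoc[symmetric])
        moreover have "inv (t \<otimes> u) \<otimes> s = inv u \<otimes> (inv t \<otimes> s)"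
          using tG u s by (simp add: inv_mult_group m_assoc)
        ultimately show "((\<lambda>v. of_real (b (inv t \<otimes> v)) * x (inv v \<otimes> s)) \<circ> (\<lambda>u. t \<otimes> u)) u =
            of_real (b u) * left_translate u x (inv t \<otimes> s)" using tG s by simp
      qed simp
      also have "\<dots> = left_translate t (convolution_op G b x) s"
        using convolution_op_eq_sum[OF b B(1) order_refl B(2) x] s by simp
      finally show "of_real (a t) * (\<Sum>v\<in>?A <#> ?B. of_real (b (inv t \<otimes> v)) * x (inv v \<otimes> s)) =
        of_real (a t) * left_translate t (convolution_op G b x) s" by simp
    qed simp
    also have "\<dots> = convolution_op G a (convolution_op G b x) s"
      using convolution_op_eq_sum[OF a A(1) order_refl A(2) bx] by simp
    finally show ?thesis by simp
  qed (simp add: convolution_op_def convolution_outside)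
qed

lemma convolution_op_diff:
  assumes a: "a \<in> fin_fun G" and b: "b \<in> fin_fun G" and x: "x \<in> ell2 (carrier G)"
  shows "(\<lambda>s. a s - b s) \<in> fin_fun G"
    "convolution_op G (\<lambda>s. a s - b s) x = (\<lambda>s. convolution_op G a x s - convolution_op G b x s)"
proof -
  let ?K = "{s. a s \<noteq> 0} \<union> {s. b s \<noteq> 0}"
  have K: "finite ?K" "?K \<subseteq> carrier G" "{s. a s - b s \<noteq> 0} \<subseteq> ?K"
    using fin_funD[OF a] fin_funD[OF b] by auto
  then show d: "(\<lambda>s. a s - b s) \<in> fin_fun G"
    using finite_subset[OF K(3,1)] by (auto simp: fin_fun_def)
  have "{s. a s \<noteq> 0} \<subseteq> ?K" "{s. b s \<noteq> 0} \<subseteq> ?K" by auto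
  note eqs = convolution_op_eq_sum[OF a K(1) this(1) K(2) x] convolution_op_eq_sum[OF b K(1)
      this(2) K(2) x]
    convolution_op_eq_sum[OF d K(1,3,2) x]
  show "convolution_op G (\<lambda>s. a s - b s) x = (\<lambda>s. convolution_op G a x s - convolution_op G b x s)"
    unfolding eqs sum_subtractf[symmetric] by (intro ext sum.cong) (auto simp: algebra_simps)
qed

section \<open>The unit of convolution and right translations\<close>

lemma point_mass_fin_fun: "u \<in> carrier G \<Longrightarrow> point_mass u \<in> fin_fun G"
  by (auto simp: fin_fun_def point_mass_def)

lemma convolution_op_one:
  assumes x: "x \<in> ell2 (carrier G)"
  shows "convolution_op G (point_mass \<one>) x = x"
proof
  fix s
  have "convolution_op G (point_mass \<one>) x = (\<lambda>s. \<Sum>t\<in>{\<one>}. of_real (point_mass \<one> t) * left_translate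
      t x s)"
    by (intro convolution_op_eq_sum point_mass_fin_fun x) (auto simp: point_mass_def)
  then show "convolution_op G (point_mass \<one>) x s = x s"
    using ell2_outside[OF x] by (simp add: point_mass_def)
qed

lemma right_translate_fin_fun:
  assumes u: "u \<in> carrier G" and x: "x \<in> fin_fun G"
  shows "right_translate G u x \<in> fin_fun G"
    "{s. right_translate G u x s \<noteq> 0} = (\<lambda>s. s \<otimes> u) ` {s. x s \<noteq> 0}"
proof -
  show eq: "{s. right_translate G u x s \<noteq> 0} = (\<lambda>s. s \<otimes> u) ` {s. x s \<noteq> 0}"
  proof safe
    fix s assume "right_translate G u x s \<noteq> 0"
    then have "s \<in> carrier G" "x (s \<otimes> inv u) \<noteq> 0" by (auto simp: right_translate_def split:
        if_splits)
    then show "s \<in> (\<lambda>s. s \<otimes> u) ` {s. x s \<noteq> 0}"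
      using u by (intro image_eqI[of _ _ "s \<otimes> inv u"]) (auto simp: m_assoc)
  next
    fix s assume "x s \<noteq> 0" "right_translate G u x (s \<otimes> u) = 0"
    moreover have "s \<in> carrier G" using \<open>x s \<noteq> 0\<close> fin_funD(2)[OF x] by blast
    ultimately show False using u by (simp add: right_translate_def m_assoc)
  qed
  show "right_translate G u x \<in> fin_fun G"
    using fin_funD[OF x] u unfolding fin_fun_def mem_Collect_eq eq by auto
qed

lemma convolution_op_right_translate:
  assumes a: "a \<in> fin_fun G" and u: "u \<in> carrier G" and x: "x \<in> fin_fun G"
  shows "convolution_op G a (right_translate G u x) = right_translate G u (convolution_op G a x)"
proof
  fix s
  note K = fin_funD[OF a]
  note eq = convolution_op_eq_sum[OF a K(1) order_refl K(2)]
  show "convolution_op G a (right_translate G u x) s = right_translate G u (convolution_op G a x) s"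
  proof (cases "s \<in> carrier G")
    case True
    have "left_translate t (right_translate G u x) s = left_translate t x (s \<otimes> inv u)" if "t \<in> {t.
        a t \<noteq> 0}" for t
    proof -
      have "t \<in> carrier G" using that K by blast
      then show ?thesis using True u by (simp add: right_translate_def m_assoc)
    qed
    then show ?thesis
      unfolding eq[OF fin_fun_ell2[OF right_translate_fin_fun(1)[OF u x]]] eq[OF fin_fun_ell2[OF x]]
      using True by (simp add: right_translate_def)
  qed (simp add: convolution_op_def convolution_outside right_translate_def)
qed

lemma right_translate_point_mass_one:
  "u \<in> carrier G \<Longrightarrow> right_translate G u (point_mass \<one>) = point_mass u"
  by (auto simp: right_translate_def point_mass_def fun_eq_iff inv_solve_right' )

end

section \<open>Truncated inverses\<close>

text \<open>A nonzero integer has absolute value at least 1, so the sum of absolute values bounds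
  the number of nonzero values.\<close>

lemma summable_integer_valued_finite_support:
  fixes h :: "'a \<Rightarrow> real"
  assumes "(\<lambda>s. \<bar>h s\<bar>) summable_on S" "\<And>s. s \<notin> S \<Longrightarrow> h s = 0" "\<And>s. h s \<in> \<int>"
  shows "finite {s. h s \<noteq> 0}"
proof -
  have "finite {s. h s \<noteq> 0} \<and> card {s. h s \<noteq> 0} \<le> nat \<lfloor>\<Sum>\<^sub>\<infinity>s\<in>S. \<bar>h s\<bar>\<rfloor>"
  proof (rule finite_if_finite_subsets_card_bdd)
    fix F assume F: "F \<subseteq> {s. h s \<noteq> 0}" "finite F"
    have "real (card F) = (\<Sum>s\<in>F. 1)" by simp
    also have "\<dots> \<le> (\<Sum>s\<in>F. \<bar>h s\<bar>)"
    proof (rule sum_mono)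
      fix s assume "s \<in> F"
      then have "h s \<noteq> 0" using F by blast
      then show "1 \<le> \<bar>h s\<bar>" using assms(3)[of s] by (rule Ints_nonzero_abs_ge1[rotated])
    qed
    also have "\<dots> \<le> (\<Sum>\<^sub>\<infinity>s\<in>S. \<bar>h s\<bar>)"
      using F assms by (intro finite_sum_le_infsum) auto
    finally show "card F \<le> nat \<lfloor>\<Sum>\<^sub>\<infinity>s\<in>S. \<bar>h s\<bar>\<rfloor>" by (simp add: le_nat_floor)
  qed
  then show ?thesis ..
qed

context group begin

lemma int_group_ring_carrier:
  "f \<in> carrier (int_group_ring G) \<longleftrightarrow> f \<in> fin_fun G \<and> (\<forall>s. f s \<in> \<int>)"
  by (auto simp: int_group_ring_def fin_fun_def)

text \<open>If the inverse had only integer values, summability would make its support finite, and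
  it would be a left inverse in the integral group ring.\<close>

lemma ell1_inverse:
  assumes "f \<in> Units (ell1_algebra G)"
    and noinv: "\<not> (\<exists>g\<in>carrier (int_group_ring G). g \<otimes>\<^bsub>int_group_ring G\<^esub> f = \<one>\<^bsub>int_group_ring G\<^esub>)"
  obtains h k where "\<And>s. s \<notin> carrier G \<Longrightarrow> h s = 0" "(\<lambda>s. \<bar>h s\<bar>) summable_on carrier G"
    "convolution G h f = point_mass \<one>" "convolution G f h = point_mass \<one>"
    "k \<in> carrier G" "h k \<notin> \<int>"
proof -
  obtain h where h: "\<And>s. s \<notin> carrier G \<Longrightarrow> h s = 0" "(\<lambda>s. \<bar>h s\<bar>) summable_on carrier G"
    "convolution G h f = point_mass \<one>" "convolution G f h = point_mass \<one>"
    using assms(1) by (auto simp: Units_def ell1_algebra_def)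
  have "\<exists>k. h k \<notin> \<int>"
  proof (rule ccontr)
    assume "\<not> (\<exists>k. h k \<notin> \<int>)"
    then have int: "\<And>s. h s \<in> \<int>" by blast
    have "{s. h s \<noteq> 0} \<subseteq> carrier G" using h(1) by blast
    then have "h \<in> carrier (int_group_ring G)"
      using summable_integer_valued_finite_support[OF h(2,1) int] int
      by (simp add: int_group_ring_carrier fin_fun_def)
    then show False using noinv h(3) by (auto simp: int_group_ring_def ell1_algebra_def)
  qed
  then obtain k where "h k \<notin> \<int>" by blast
  moreover then have "k \<in> carrier G" using h(1) by (metis Ints_0)
  ultimately show thesis using that h by blast
qed

lemma inj_on_right_mult: "t \<in> carrier G \<Longrightarrow> inj_on (\<lambda>s. s \<otimes> t) (carrier G)"
  by (intro inj_onI) simp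

text \<open>Treats the product of \<open>a\<close> with a tail \<open>r\<close> on either side at
  once: \<open>\<phi> t\<close> will be a left or a right translation by \<open>inv t\<close>.
  Smallness of the tail on finite sets suffices because \<open>e\<close> has finite support.\<close>

lemma ell1_norm_le_sum_translates:
  fixes a r e :: "'a \<Rightarrow> real" and \<phi> :: "'a \<Rightarrow> 'a \<Rightarrow> 'a"
  assumes a: "finite {t. a t \<noteq> 0}"
    and e: "finite {s. e s \<noteq> 0}" "\<And>s. e s \<noteq> 0 \<Longrightarrow> \<bar>e s\<bar> \<le> (\<Sum>t | a t \<noteq> 0. \<bar>a t\<bar> * \<bar>r (\<phi> t s)\<bar>)"
    and \<phi>: "\<And>t. a t \<noteq> 0 \<Longrightarrow> inj_on (\<phi> t) {s. e s \<noteq> 0}"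
    and r: "\<And>t Q. a t \<noteq> 0 \<Longrightarrow> finite Q \<Longrightarrow> Q \<subseteq> \<phi> t ` {s. e s \<noteq> 0} \<Longrightarrow> (\<Sum>s\<in>Q. \<bar>r s\<bar>) \<le> \<delta>"
  shows "ell1_norm e \<le> ell1_norm a * \<delta>"
proof -
  have "ell1_norm e \<le> (\<Sum>s | e s \<noteq> 0. \<Sum>t | a t \<noteq> 0. \<bar>a t\<bar> * \<bar>r (\<phi> t s)\<bar>)"
    unfolding ell1_norm_def using e(2) by (intro sum_mono) auto
  also have "\<dots> = (\<Sum>t | a t \<noteq> 0. \<bar>a t\<bar> * (\<Sum>s | e s \<noteq> 0. \<bar>r (\<phi> t s)\<bar>))"
    by (subst sum.swap) (simp add: sum_distrib_left)
  also have "\<dots> \<le> (\<Sum>t | a t \<noteq> 0. \<bar>a t\<bar> * \<delta>)"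
  proof (intro sum_mono mult_left_mono)
    fix t assume t: "t \<in> {t. a t \<noteq> 0}"
    have "(\<Sum>s | e s \<noteq> 0. \<bar>r (\<phi> t s)\<bar>) = (\<Sum>s\<in>\<phi> t ` {s. e s \<noteq> 0}. \<bar>r s\<bar>)"
      using sum.reindex[OF \<phi>[of t], of "\<lambda>s. \<bar>r s\<bar>"] t by (simp add: o_def)
    also have "\<dots> \<le> \<delta>" using t e(1) by (intro r[of t]) auto
    finally show "(\<Sum>s | e s \<noteq> 0. \<bar>r (\<phi> t s)\<bar>) \<le> \<delta>" .
  qed simp
  finally show ?thesis by (simp add: ell1_norm_def sum_distrib_right)
qed

text \<open>Restricting \<open>h\<close> to a large finite set changes its products with
  \<open>f\<close> by at most the norm of \<open>f\<close> times the tail. The bound on the norm of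
  the truncation does not depend on \<eta>, so that \<eta> can later be chosen in terms of
  it.\<close>

lemma truncated_inverse:
  assumes f: "f \<in> fin_fun G"
    and h: "\<And>s. s \<notin> carrier G \<Longrightarrow> h s = 0" "(\<lambda>s. \<bar>h s\<bar>) summable_on carrier G"
      "convolution G h f = point_mass \<one>" "convolution G f h = point_mass \<one>"
    and k: "k \<in> carrier G" and \<eta>: "\<eta> > 0"
  obtains h' where "h' \<in> fin_fun G" "h' k = h k" "ell1_norm h' \<le> (\<Sum>\<^sub>\<infinity>s\<in>carrier G. \<bar>h s\<bar>)"
    "ell1_norm (\<lambda>s. convolution G f h' s - point_mass \<one> s) \<le> \<eta>"
    "ell1_norm (\<lambda>s. convolution G h' f s - point_mass \<one> s) \<le> \<eta>"
proof -
  define \<delta> where "\<delta> = \<eta> / (ell1_norm f + 1)"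
  have f1: "ell1_norm f + 1 > 0" by (simp add: add_nonneg_pos)
  then have \<delta>: "\<delta> > 0" using \<eta> by (simp add: \<delta>_def)
  have "ell1_norm f * \<delta> \<le> (ell1_norm f + 1) * \<delta>" using \<delta> by (intro mult_right_mono) auto
  also have "\<dots> = \<eta>" using f1 by (simp add: \<delta>_def)
  finally have f\<delta>: "ell1_norm f * \<delta> \<le> \<eta>" .
  define H where "H = (\<Sum>\<^sub>\<infinity>s\<in>carrier G. \<bar>h s\<bar>)"
  obtain K0 where K0: "finite K0" "K0 \<subseteq> carrier G" "dist (\<Sum>s\<in>K0. \<bar>h s\<bar>) H \<le> \<delta>"
    using infsum_finite_approximation[OF h(2) \<delta>] unfolding H_def by blast
  \<comment> \<open>\<open>k\<close> is added so that the value of \<open>h\<close> at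
    \<open>k\<close> survives the truncation.\<close>
  define K where "K = insert k K0"
  have K: "finite K" "K \<subseteq> carrier G" using K0 k by (auto simp: K_def)
  define h' where "h' s = (if s \<in> K then h s else 0)" for s
  define r where "r s = h' s - h s" for s
  have h'F: "h' \<in> fin_fun G"
    using K finite_subset[of "{s. h' s \<noteq> 0}" K] by (auto simp: fin_fun_def h'_def)
  have small: "(\<Sum>s\<in>Q. \<bar>r s\<bar>) \<le> \<delta>" if Q: "finite Q" "Q \<subseteq> carrier G" for Q
  proof -
    have "(\<Sum>s\<in>Q. \<bar>r s\<bar>) = (\<Sum>s\<in>Q - K. \<bar>h s\<bar>)"
      using Q by (intro sum.mono_neutral_cong_right) (auto simp: r_def h'_def)
    also have "\<dots> \<le> (\<Sum>s\<in>Q - K0. \<bar>h s\<bar>)"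
      using Q by (intro sum_mono2) (auto simp: K_def)
    also have "\<dots> = (\<Sum>s\<in>(Q - K0) \<union> K0. \<bar>h s\<bar>) - (\<Sum>s\<in>K0. \<bar>h s\<bar>)"
      using Q K0 by (subst sum.union_disjoint) auto
    also have "(\<Sum>s\<in>(Q - K0) \<union> K0. \<bar>h s\<bar>) \<le> H"
      unfolding H_def using h(2) Q K0 by (intro finite_sum_le_infsum) auto
    finally show ?thesis using K0(3) by (simp add: dist_real_def)
  qed
  show thesis
  proof (rule that[OF h'F])
    show "h' k = h k" by (simp add: h'_def K_def)
    have "ell1_norm h' = (\<Sum>s\<in>K. \<bar>h' s\<bar>)" by (rule ell1_norm_eq_sum) (use K in \<open>auto simp: h'_def\<close>)
    also have "\<dots> = (\<Sum>s\<in>K. \<bar>h s\<bar>)" by (simp add: h'_def)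
    also have "\<dots> \<le> H" unfolding H_def using h(2) K by (intro finite_sum_le_infsum) auto
    finally show "ell1_norm h' \<le> (\<Sum>\<^sub>\<infinity>s\<in>carrier G. \<bar>h s\<bar>)" by (simp add: H_def)
    note fs = fin_funD[OF f]
    have out: "s \<in> carrier G" if "convolution G a b s - point_mass \<one> s \<noteq> 0" for a b :: "'a \<Rightarrow> real"
        and s
      using that convolution_outside[of s a b] by (auto simp: point_mass_def split: if_splits)
    have "ell1_norm (\<lambda>s. convolution G f h' s - point_mass \<one> s) \<le> ell1_norm f * \<delta>"
    proof (rule ell1_norm_le_sum_translates[where r = r and \<phi> = "\<lambda>t s. inv t \<otimes> s"])
      show "finite {t. f t \<noteq> 0}" by (rule fs)
      show "finite {s. convolution G f h' s - point_mass \<one> s \<noteq> 0}"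
        by (rule finite_subset[of _ "{s. convolution G f h' s \<noteq> 0} \<union> {\<one>}"])
           (use fin_funD(1)[OF convolution_fin_fun[OF f h'F]] in \<open>auto simp: point_mass_def\<close>)
      fix s assume "convolution G f h' s - point_mass \<one> s \<noteq> 0"
      then have s: "s \<in> carrier G" by (rule out)
      have "convolution G f h' s - point_mass \<one> s = (\<Sum>t | f t \<noteq> 0. f t * h' (inv t \<otimes> s)) - (\<Sum>t | f
          t \<noteq> 0. f t * h (inv t \<otimes> s))"
        unfolding h(4)[symmetric] using s fs by (simp add: convolution_eq_sum[where K = "{t. f t \<noteq>
            0}"])
      also have "\<dots> = (\<Sum>t | f t \<noteq> 0. f t * r (inv t \<otimes> s))"
        by (simp add: sum_subtractf[symmetric] r_def right_diff_distrib)
      finally show "\<bar>convolution G f h' s - point_mass \<one> s\<bar> \<le> (\<Sum>t | f t \<noteq> 0. \<bar>f t\<bar> * \<bar>r (inv t \<otimes>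
          s)\<bar>)"
        by (metis (no_types, lifting) abs_mult sum.cong sum_abs)
    next
      fix t assume "f t \<noteq> 0"
      then have t: "t \<in> carrier G" using fs by blast
      show "inj_on (\<lambda>s. inv t \<otimes> s) {s. convolution G f h' s - point_mass \<one> s \<noteq> 0}"
        using bij_betw_imp_inj_on[OF bij_left_mult[of "inv t"]] t out by (blast intro:
            inj_on_subset)
      fix Q assume Q: "finite Q" "Q \<subseteq> (\<lambda>s. inv t \<otimes> s) ` {s. convolution G f h' s - point_mass \<one> s
          \<noteq> 0}"
      have "Q \<subseteq> carrier G" using Q(2) t out by fastforce
      then show "(\<Sum>s\<in>Q. \<bar>r s\<bar>) \<le> \<delta>" using small Q(1) by blast
    qed
    then show "ell1_norm (\<lambda>s. convolution G f h' s - point_mass \<one> s) \<le> \<eta>" using f\<delta> by linarith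
    have "ell1_norm (\<lambda>s. convolution G h' f s - point_mass \<one> s) \<le> ell1_norm f * \<delta>"
    proof (rule ell1_norm_le_sum_translates[where r = r and \<phi> = "\<lambda>t s. s \<otimes> inv t"])
      show "finite {t. f t \<noteq> 0}" by (rule fs)
      show "finite {s. convolution G h' f s - point_mass \<one> s \<noteq> 0}"
        by (rule finite_subset[of _ "{s. convolution G h' f s \<noteq> 0} \<union> {\<one>}"])
           (use fin_funD(1)[OF convolution_fin_fun[OF h'F f]] in \<open>auto simp: point_mass_def\<close>)
      fix s assume "convolution G h' f s - point_mass \<one> s \<noteq> 0"
      then have s: "s \<in> carrier G" by (rule out)
      have "convolution G h' f s - point_mass \<one> s = (\<Sum>t | f t \<noteq> 0. h' (s \<otimes> inv t) * f t) - (\<Sum>t | f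
          t \<noteq> 0. h (s \<otimes> inv t) * f t)"
        unfolding h(3)[symmetric] using s fs by (simp add: convolution_eq_sum_right[where K = "{t.
            f t \<noteq> 0}"])
      also have "\<dots> = (\<Sum>t | f t \<noteq> 0. f t * r (s \<otimes> inv t))"
        by (simp add: sum_subtractf[symmetric] r_def right_diff_distrib mult.commute)
      finally show "\<bar>convolution G h' f s - point_mass \<one> s\<bar> \<le> (\<Sum>t | f t \<noteq> 0. \<bar>f t\<bar> * \<bar>r (s \<otimes> inv
          t)\<bar>)"
        by (metis (no_types, lifting) abs_mult sum.cong sum_abs)
    next
      fix t assume "f t \<noteq> 0"
      then have t: "t \<in> carrier G" using fs by blast
      show "inj_on (\<lambda>s. s \<otimes> inv t) {s. convolution G h' f s - point_mass \<one> s \<noteq> 0}"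
        using inj_on_right_mult[of "inv t"] t out by (blast intro: inj_on_subset)
      fix Q assume Q: "finite Q" "Q \<subseteq> (\<lambda>s. s \<otimes> inv t) ` {s. convolution G h' f s - point_mass \<one> s
          \<noteq> 0}"
      have "Q \<subseteq> carrier G" using Q(2) t out by fastforce
      then show "(\<Sum>s\<in>Q. \<bar>r s\<bar>) \<le> \<delta>" using small Q(1) by blast
    qed
    then show "ell1_norm (\<lambda>s. convolution G h' f s - point_mass \<one> s) \<le> \<eta>" using f\<delta> by linarith
  qed
qed

lemma convolution_op_near_identity:
  assumes a: "a \<in> fin_fun G" and b: "b \<in> fin_fun G" and x: "x \<in> ell2 (carrier G)"
    and e: "ell1_norm (\<lambda>s. convolution G a b s - point_mass \<one> s) \<le> \<eta>"
  shows "ell2_norm (carrier G) (\<lambda>s. convolution_op G a (convolution_op G b x) s - x s) \<le> \<eta> *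
      ell2_norm (carrier G) x"
proof -
  note d = convolution_op_diff[OF convolution_fin_fun[OF a b] point_mass_fin_fun[OF one_closed] x]
  have "(\<lambda>s. convolution_op G a (convolution_op G b x) s - x s) =
      convolution_op G (\<lambda>s. convolution G a b s - point_mass \<one> s) x"
    by (simp add: d(2) convolution_op_compose[OF a b x] convolution_op_one[OF x])
  then show ?thesis
    using convolution_op_bounded(2)[OF d(1) x] mult_right_mono[OF e ell2_norm_nonneg[of "carrier
        G" x]] by simp
qed

text \<open>If \<open>h' f x\<close> is within half the norm of \<open>x\<close> from
  \<open>x\<close>, then the norm of \<open>x\<close> is at most twice the norm of \<open>h'\<close>
  times that of \<open>f x\<close>. The extra 1 in \<open>m\<close> keeps it positive.\<close>

lemma convolution_op_bounded_below:
  assumes f: "f \<in> fin_fun G" and h': "h' \<in> fin_fun G"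
    and e: "ell1_norm (\<lambda>s. convolution G h' f s - point_mass \<one> s) \<le> 1 / 2"
  obtains c where "c > 0" "\<And>x. x \<in> ell2 (carrier G) \<Longrightarrow>
    c * (ell2_norm (carrier G) x)\<^sup>2 \<le> (ell2_norm (carrier G) (convolution_op G f x))\<^sup>2"
proof -
  define m where "m = 2 * ell1_norm h' + 1"
  have m: "m > 0" by (simp add: m_def add_nonneg_pos)
  have "1 / m\<^sup>2 * (ell2_norm (carrier G) x)\<^sup>2 \<le> (ell2_norm (carrier G) (convolution_op G f x))\<^sup>2"
    if x: "x \<in> ell2 (carrier G)" for x
  proof -
    note fx = bounded_ops_mem[OF convolution_op_bounded(1)[OF f] x]
    note hfx = bounded_ops_mem[OF convolution_op_bounded(1)[OF h'] fx]
    have "ell2_norm (carrier G) x \<le> 1 / 2 * ell2_norm (carrier G) x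
        + ell2_norm (carrier G) (convolution_op G h' (convolution_op G f x))"
      using ell2_norm_triangle'[OF x hfx] convolution_op_near_identity[OF h' f x e]
      by (simp add: ell2_norm_minus_commute[of _ x])
    also have "ell2_norm (carrier G) (convolution_op G h' (convolution_op G f x))
        \<le> ell1_norm h' * ell2_norm (carrier G) (convolution_op G f x)"
      by (rule convolution_op_bounded(2)[OF h' fx])
    finally have "ell2_norm (carrier G) x \<le> 2 * ell1_norm h' * ell2_norm (carrier G)
        (convolution_op G f x)"
      by simp
    also have "\<dots> \<le> m * ell2_norm (carrier G) (convolution_op G f x)"
      by (intro mult_right_mono) (auto simp: m_def)
    finally have "(ell2_norm (carrier G) x)\<^sup>2 \<le> (m * ell2_norm (carrier G) (convolution_op G f
        x))\<^sup>2"
      by (intro power_mono) auto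
    then show ?thesis using m by (simp add: power_mult_distrib field_simps)
  qed
  then show thesis using that[of "1 / m\<^sup>2"] m by simp
qed

end

section \<open>Integral independence of separated points\<close>

context group begin

text \<open>An integral solution \<open>w\<close> of the compressed equation must be close to the convolution of
  \<open>\<epsilon>\<close> with the true inverse of \<open>f\<^sup>* f\<close>, so \<open>f w\<close> is close to the convolution of \<open>\<epsilon>\<close>
  with the truncated inverse of \<open>f\<^sup>*\<close>; but the latter has a value far from the integers at each
  of the points \<open>inv k \<otimes> \<gamma>\<close> with \<open>\<epsilon> \<gamma> \<noteq> 0\<close>.\<close>

lemma compressed_equation_no_integral_solution:
  fixes \<epsilon> z :: "'a \<Rightarrow> int"
  assumes f: "f \<in> fin_fun G" and fint: "\<And>s. f s \<in> \<int>"
    and c: "c > 0" "\<And>x. x \<in> ell2 (carrier G) \<Longrightarrow>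
      c * (ell2_norm (carrier G) x)\<^sup>2 \<le> (ell2_norm (carrier G) (convolution_op G f x))\<^sup>2"
    and h: "h \<in> fin_fun G" "ell1_norm h \<le> H" and \<eta>: "0 \<le> \<eta>"
    and fh: "ell1_norm (\<lambda>s. convolution G f h s - point_mass \<one> s) \<le> \<eta>"
    and hf: "ell1_norm (\<lambda>s. convolution G h f s - point_mass \<one> s) \<le> \<eta>"
    and k: "k \<in> carrier G" "\<And>n::int. d \<le> \<bar>h k - of_int n\<bar>" "0 \<le> d"
    and small: "ell1_norm f * ((ell1_norm f * H + 1) * \<eta>) / c + \<eta> * H < d"
    and F: "finite F" "F \<subseteq> carrier G" "A \<subseteq> F"
    and inside: "\<And>\<gamma> u v. \<gamma> \<in> A \<Longrightarrow> h u \<noteq> 0 \<Longrightarrow> h v \<noteq> 0 \<Longrightarrow> u \<otimes> (inv v \<otimes> \<gamma>) \<in> F"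
    and sep: "\<And>\<gamma> \<gamma>' v. \<gamma> \<in> A \<Longrightarrow> \<gamma>' \<in> A \<Longrightarrow> h v \<noteq> 0 \<Longrightarrow> inv k \<otimes> \<gamma> = inv v \<otimes> \<gamma>' \<Longrightarrow> \<gamma> = \<gamma>'"
    and \<epsilon>: "\<And>\<gamma>. \<gamma> \<in> A \<Longrightarrow> \<epsilon> \<gamma> \<in> {-1, 0, 1}"
    and eq: "\<And>s. s \<in> F \<Longrightarrow>
      convolution_op G (conv_adjoint G f) (convolution_op G f (\<lambda>s. if s \<in> F then of_int (z s) else
          0)) s =
      (if s \<in> A then of_int (\<epsilon> s) else 0)"
    and \<gamma>: "\<gamma> \<in> A"
  shows "\<epsilon> \<gamma> = 0"
proof (rule ccontr)
  assume "\<epsilon> \<gamma> \<noteq> 0"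
  let ?S = "carrier G"
  let ?n = "ell2_norm (carrier G)"
  let ?f = "convolution_op G f" and ?f' = "convolution_op G (conv_adjoint G f)"
  let ?h = "convolution_op G h" and ?h' = "convolution_op G (conv_adjoint G h)"
  note fa = conv_adjoint_fin_fun[OF f] and ha = conv_adjoint_fin_fun[OF h(1)]
  note bf = convolution_op_bounded[OF f] and bf' = convolution_op_bounded[OF fa]
    and bh = convolution_op_bounded[OF h(1)] and bh' = convolution_op_bounded[OF ha]
  note nf' = ell1_norm_conv_adjoint[OF f] and nh' = ell1_norm_conv_adjoint[OF h(1)]
  define V :: "'a \<Rightarrow> complex" where "V s = (if s \<in> A then of_int (\<epsilon> s) else 0)" for s
  define w :: "'a \<Rightarrow> complex" where "w s = (if s \<in> F then of_int (z s) else 0)" for s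
  \<comment> \<open>The values of \<open>V\<close> on its support \<open>E\<close> are signs, so the
    squared norm of \<open>V\<close> is the number of elements of \<open>E\<close>; all estimates
    below are measured in units of this norm.\<close>
  define E where "E = {\<gamma>\<in>A. \<epsilon> \<gamma> \<noteq> 0}"
  have A: "finite A" "A \<subseteq> ?S" using F finite_subset by auto
  have E: "finite E" "E \<subseteq> A" using A by (auto simp: E_def)
  have suppV: "{s. V s \<noteq> 0} = E" by (auto simp: V_def E_def)
  have VF: "V \<in> fin_fun G" using suppV E A by (auto simp: fin_fun_def)
  have wF: "w \<in> fin_fun G" using F finite_subset[of "{s. w s \<noteq> 0}" F]
    by (auto simp: fin_fun_def w_def split: if_splits)
  note V = fin_fun_ell2[OF VF] and w = fin_fun_ell2[OF wF]
  have absV: "cmod (V s) = 1" if "s \<in> E" for s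
    using \<epsilon>[of s] that by (auto simp: V_def E_def)
  have nV: "(?n V)\<^sup>2 = card E"
    using ell2_norm_finite_support[of E V ?S] E A suppV absV by simp
  have "E \<noteq> {}" using \<gamma> \<open>\<epsilon> \<gamma> \<noteq> 0\<close> by (auto simp: E_def)
  then have nVpos: "?n V > 0" using nV E(1)
    by (metis card_gt_0_iff ell2_norm_nonneg less_eq_real_def of_nat_0_less_iff power_zero_numeral
        zero_less_iff_neq_zero)
  \<comment> \<open>\<open>Y\<close> approximates the inverse of the adjoint of \<open>f\<close>
    applied to \<open>V\<close>, and \<open>X\<close> the inverse of the full product applied to
    \<open>V\<close>, with the truncation \<open>h\<close> in place of the true inverse of
    \<open>f\<close>.\<close>
  define Y where "Y = ?h' V"
  define X where "X = ?h Y"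
  have Y: "Y \<in> ell2 ?S" unfolding Y_def by (rule bounded_ops_mem[OF bh'(1) V])
  have X: "X \<in> ell2 ?S" unfolding X_def by (rule bounded_ops_mem[OF bh(1) Y])
  have H0: "0 \<le> H" using h(2) ell1_norm_nonneg[of h] by linarith
  have nY: "?n Y \<le> H * ?n V"
    using bh'(2)[OF V] mult_right_mono[OF h(2) ell2_norm_nonneg[of ?S V]] by (simp add: Y_def nh')
  \<comment> \<open>By \<open>inside\<close> the approximate solution \<open>X\<close> does not
    leave \<open>F\<close>. This is what makes it comparable with \<open>w\<close>, for which the
    equation is known on \<open>F\<close> only.\<close>
  have suppX: "X s = 0" if "s \<notin> F" for s
  proof (rule ccontr)
    assume "X s \<noteq> 0"
    have Xeq: "X = convolution G (\<lambda>s. complex_of_real (h s)) Y" unfolding X_def using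
        convolution_op_apply[OF Y] .
    have Yeq: "Y = convolution G (\<lambda>s. complex_of_real (conv_adjoint G h s)) V" unfolding Y_def
        using convolution_op_apply[OF V] .
    have hc: "(\<lambda>s. complex_of_real (h s)) \<in> fin_fun G" "(\<lambda>s. complex_of_real (conv_adjoint G h s))
        \<in> fin_fun G"
      using h(1) ha by (auto simp: fin_fun_def)
    have sY: "{s. Y s \<noteq> 0} \<subseteq> {s. conv_adjoint G h s \<noteq> 0} <#> E"
      using convolution_support[OF hc(2), of V] suppV E A by (auto simp: Yeq)
    have "{s. Y s \<noteq> 0} \<subseteq> ?S" using ell2_outside[OF Y] by blast
    from convolution_support[OF hc(1) this] \<open>X s \<noteq> 0\<close>
    obtain u y where u: "h u \<noteq> 0" "Y y \<noteq> 0" "s = u \<otimes> y"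
      by (auto simp: Xeq[symmetric] set_mult_def)
    then obtain v g where v: "conv_adjoint G h v \<noteq> 0" "g \<in> E" "y = v \<otimes> g"
      using sY by (auto simp: set_mult_def)
    have "v \<in> ?S" "h (inv v) \<noteq> 0" using v(1) by (auto simp: conv_adjoint_def split: if_splits)
    then have "u \<otimes> (inv (inv v) \<otimes> g) \<in> F" using inside[of g u "inv v"] u(1) v(2) E by auto
    then show False using that u(3) v(3) \<open>v \<in> ?S\<close> by simp
  qed
  have fXm: "?f X \<in> ell2 ?S" by (rule bounded_ops_mem[OF bf(1) X])
  have fX: "?n (\<lambda>s. ?f X s - Y s) \<le> \<eta> * (H * ?n V)"
    using convolution_op_near_identity[OF f h(1) Y fh] mult_left_mono[OF nY \<eta>]
    by (simp add: X_def)
  define Z where "Z = (\<lambda>s. ?f' Y s - V s)"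
  note f'Y = bounded_ops_mem[OF bf'(1) Y]
  have Z: "Z \<in> ell2 ?S" unfolding Z_def by (rule ell2_diff[OF f'Y V])
  \<comment> \<open>The estimate for the adjoints is obtained by duality: moving both operators to
    the other side gives \<open><Z, Z> = <h f Z - Z, V>\<close>, where \<open>hf\<close>
    applies.\<close>
  have nZ: "?n Z \<le> \<eta> * ?n V"
  proof -
    note fZ = bounded_ops_mem[OF bf(1) Z]
    note hfZ = bounded_ops_mem[OF bh(1) fZ]
    have "ell2_inner ?S Z (?f' Y) = ell2_inner ?S (?h (?f Z)) V"
      using convolution_op_adjoint[OF f Z Y] convolution_op_adjoint[OF h(1) fZ V] by (simp add:
          Y_def)
    then have "ell2_inner ?S Z Z = ell2_inner ?S (\<lambda>s. ?h (?f Z) s - Z s) V"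
      using ell2_inner_diff_right[OF f'Y V Z] ell2_inner_diff_left[OF hfZ Z V] by (simp add: Z_def)
    then have "(?n Z)\<^sup>2 = cmod (ell2_inner ?S (\<lambda>s. ?h (?f Z) s - Z s) V)"
      using ell2_inner_self[OF Z] by (metis norm_of_real abs_power2)
    also have "\<dots> \<le> ?n (\<lambda>s. ?h (?f Z) s - Z s) * ?n V"
      by (rule ell2_Cauchy_Schwarz[OF ell2_diff[OF hfZ Z] V])
    also have "\<dots> \<le> (\<eta> * ?n Z) * ?n V"
      using convolution_op_near_identity[OF h(1) f Z hf] by (intro mult_right_mono) auto
    finally have "?n Z * ?n Z \<le> (\<eta> * ?n V) * ?n Z" by (simp add: power2_eq_square algebra_simps)
    then show ?thesis using \<eta> nVpos
      by (cases "?n Z = 0") (auto simp: mult_le_cancel_right less_le)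
  qed
  have LXm: "?f' (?f X) \<in> ell2 ?S" by (rule bounded_ops_mem[OF bf'(1) fXm])
  have LX: "?n (\<lambda>s. ?f' (?f X) s - V s) \<le> (ell1_norm f * H + 1) * \<eta> * ?n V"
  proof -
    have "?n (\<lambda>s. ?f' (?f X) s - V s) \<le> ?n (\<lambda>s. ?f' (?f X) s - ?f' Y s) + ?n (\<lambda>s. ?f' Y s - V s)"
      by (rule ell2_norm_triangle_diff[OF LXm f'Y V])
    also have "?n (\<lambda>s. ?f' (?f X) s - ?f' Y s) \<le> ell1_norm f * (\<eta> * (H * ?n V))"
      using bf'(2)[OF ell2_diff[OF fXm Y]] mult_left_mono[OF fX ell1_norm_nonneg[of f]]
      by (simp add: nf' bounded_ops_diff[OF bf'(1) fXm Y])
    finally show ?thesis using nZ by (simp add: Z_def algebra_simps)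
  qed
  define D where "D = (\<lambda>s. X s - w s)"
  have D: "D \<in> ell2 ?S" unfolding D_def by (rule ell2_diff[OF X w])
  note fD = bounded_ops_mem[OF bf(1) D]
  have nD: "?n D \<le> (ell1_norm f * H + 1) * \<eta> * ?n V / c"
  proof -
    have Dsupp: "D s = 0" if "s \<notin> F" for s using suppX[OF that] that by (simp add: D_def w_def)
    note fw = bounded_ops_mem[OF bf(1) w]
    note Lw = bounded_ops_mem[OF bf'(1) fw]
    \<comment> \<open>\<open>D\<close> vanishes off \<open>F\<close>, so pairing with
      \<open>D\<close> sees only points at which the compressed equation holds.\<close>
    have "ell2_inner ?S (\<lambda>s. ?f' (?f w) s - V s) D = (\<Sum>i\<in>F. (?f' (?f w) i - V i) * cnj (D i))"
      using Dsupp F by (intro ell2_inner_finite_support) auto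
    also have "\<dots> = 0" using eq by (intro sum.neutral) (auto simp: w_def[symmetric] V_def)
    finally have zero: "ell2_inner ?S (?f' (?f w)) D = ell2_inner ?S V D"
      by (simp add: ell2_inner_diff_left[OF Lw V D])
    have LD: "?f' (?f D) = (\<lambda>s. ?f' (?f X) s - ?f' (?f w) s)"
      unfolding D_def bounded_ops_diff[OF bf(1) X w] bounded_ops_diff[OF bf'(1) fXm fw] ..
    \<comment> \<open>Coercivity: the squared norm of \<open>f D\<close> equals the absolute value
      of the pairing of the residual of \<open>X\<close> with \<open>D\<close>, and it dominates
      \<open>c\<close> times the squared norm of \<open>D\<close>.\<close>
    have "ell2_inner ?S (?f D) (?f D) = ell2_inner ?S D (?f' (?f D))"
      by (rule convolution_op_adjoint[OF f D fD])
    also have "\<dots> = cnj (ell2_inner ?S (?f' (?f D)) D)" by (rule ell2_inner_commute)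
    also have "ell2_inner ?S (?f' (?f D)) D = ell2_inner ?S (\<lambda>s. ?f' (?f X) s - V s) D"
      unfolding LD ell2_inner_diff_left[OF LXm Lw D] ell2_inner_diff_left[OF LXm V D] zero ..
    finally have "(?n (?f D))\<^sup>2 = cmod (ell2_inner ?S (\<lambda>s. ?f' (?f X) s - V s) D)"
      using ell2_inner_self[OF fD] by (metis norm_of_real abs_power2 complex_mod_cnj)
    also have "\<dots> \<le> ?n (\<lambda>s. ?f' (?f X) s - V s) * ?n D"
      by (rule ell2_Cauchy_Schwarz[OF ell2_diff[OF LXm V] D])
    also have "\<dots> \<le> (ell1_norm f * H + 1) * \<eta> * ?n V * ?n D"
      using LX by (intro mult_right_mono) auto
    finally have "c * (?n D)\<^sup>2 \<le> (ell1_norm f * H + 1) * \<eta> * ?n V * ?n D"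
      using c(2)[OF D] by linarith
    then have le: "(c * ?n D) * ?n D \<le> ((ell1_norm f * H + 1) * \<eta> * ?n V) * ?n D"
      by (simp add: power2_eq_square algebra_simps)
    have "c * ?n D \<le> (ell1_norm f * H + 1) * \<eta> * ?n V"
    proof (cases "?n D = 0")
      case True
      then show ?thesis using \<eta> H0 nVpos by (simp add: add_nonneg_nonneg)
    next
      case False
      then have "?n D > 0" using ell2_norm_nonneg[of ?S D] by linarith
      then show ?thesis using le by (simp add: mult_le_cancel_right)
    qed
    then show ?thesis using c(1) by (simp add: field_simps)
  qed
  note fw = bounded_ops_mem[OF bf(1) w]
  have upper: "?n (\<lambda>s. ?f w s - Y s) < d * ?n V"
  proof -
    have "?n (\<lambda>s. ?f w s - Y s) \<le> ?n (\<lambda>s. ?f w s - ?f X s) + ?n (\<lambda>s. ?f X s - Y s)"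
      by (rule ell2_norm_triangle_diff[OF fw fXm Y])
    also have "?n (\<lambda>s. ?f w s - ?f X s) = ?n (?f D)"
      unfolding D_def bounded_ops_diff[OF bf(1) X w] by (rule ell2_norm_minus_commute)
    also have "?n (?f D) \<le> ell1_norm f * ((ell1_norm f * H + 1) * \<eta> * ?n V / c)"
      using bf(2)[OF D] mult_left_mono[OF nD ell1_norm_nonneg[of f]] by linarith
    finally have "?n (\<lambda>s. ?f w s - Y s) \<le> (ell1_norm f * ((ell1_norm f * H + 1) * \<eta>) / c + \<eta> * H)
        * ?n V"
      using fX by (simp add: algebra_simps)
    also have "\<dots> < d * ?n V" using small nVpos by (rule mult_strict_right_mono)
    finally show ?thesis .
  qed
  have fw_int: "\<exists>n::int. ?f w s = of_int n" for s
  proof (cases "s \<in> ?S")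
    case True
    have "?f w s = (\<Sum>t | f t \<noteq> 0. of_real (f t) * (if s \<in> ?S then w (inv t \<otimes> s) else 0))"
      using convolution_op_eq_sum[OF f fin_funD(1)[OF f] order_refl fin_funD(2)[OF f] w] by simp
    also have "\<dots> \<in> \<int>"
    proof (intro Ints_sum Ints_mult)
      show "complex_of_real (f t) \<in> \<int>" for t using fint[of t] by (auto elim!: Ints_cases)
    qed (auto simp: w_def)
    finally show ?thesis by (auto elim: Ints_cases)
  qed (auto simp: convolution_op_def convolution_outside intro: exI[of _ 0])
  have lowerpt: "d \<le> cmod (?f w (inv k \<otimes> g) - Y (inv k \<otimes> g))" if g: "g \<in> E" for g
  proof -
    have gG: "g \<in> ?S" "g \<in> A" using g E A by auto
    let ?B = "{s. conv_adjoint G h s \<noteq> 0}"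
    have kB: "finite (insert (inv k) ?B)" "insert (inv k) ?B \<subseteq> ?S" using fin_funD[OF ha] k by auto
    have "?h' V = (\<lambda>s. \<Sum>t\<in>insert (inv k) ?B. of_real (conv_adjoint G h t) * left_translate t V s)"
      using kB by (intro convolution_op_eq_sum ha V) auto
    then have "Y (inv k \<otimes> g) = (\<Sum>t\<in>insert (inv k) ?B. of_real (conv_adjoint G h t) * V (inv t \<otimes>
        (inv k \<otimes> g)))"
      using gG k unfolding Y_def by simp
    \<comment> \<open>By \<open>sep\<close> only the term \<open>t = inv k\<close> meets the support
      of \<open>V\<close>, so at this point \<open>Y\<close> equals plus or minus
      \<open>h k\<close>.\<close>
    also have "\<dots> = (\<Sum>t\<in>insert (inv k) ?B. if t = inv k then of_real (h k) * V g else 0)"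
    proof (rule sum.cong)
      fix t assume t: "t \<in> insert (inv k) ?B"
      then have tG: "t \<in> ?S" using kB by blast
      show "of_real (conv_adjoint G h t) * V (inv t \<otimes> (inv k \<otimes> g)) = (if t = inv k then of_real (h
          k) * V g else 0)"
      proof (cases "t = inv k")
        case True
        then show ?thesis using gG k by (simp add: conv_adjoint_def m_assoc[symmetric])
      next
        case False
        have "V (inv t \<otimes> (inv k \<otimes> g)) = 0"
        proof (rule ccontr)
          assume nz: "V (inv t \<otimes> (inv k \<otimes> g)) \<noteq> 0"
          define g' where "g' = inv t \<otimes> (inv k \<otimes> g)"
          have g': "g' \<in> A" using nz suppV E by (auto simp: g'_def)
          have tg: "t \<otimes> g' = inv k \<otimes> g" unfolding g'_def using tG gG k by (simp add:
              m_assoc[symmetric])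
          have "h (inv t) \<noteq> 0" using t False tG by (auto simp: conv_adjoint_def)
          then have "g = g'" using sep[OF gG(2) g', of "inv t"] tg tG by simp
          then show False using tg False tG gG k by simp
        qed
        then show ?thesis using False by simp
      qed
    qed simp
    also have "\<dots> = of_real (h k) * V g" using kB by simp
    finally have Yk: "Y (inv k \<otimes> g) = of_real (h k) * V g" .
    obtain n :: int where n: "?f w (inv k \<otimes> g) = of_int n" using fw_int by blast
    have "V g = 1 \<or> V g = -1" using \<epsilon>[OF gG(2)] g gG by (auto simp: V_def E_def)
    then show ?thesis
    proof
      assume "V g = 1"
      then have "?f w (inv k \<otimes> g) - Y (inv k \<otimes> g) = of_real (of_int n - h k)" by (simp add: n Yk)
      then show ?thesis using k(2)[of n] by (simp only: norm_of_real)
    next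
      assume "V g = -1"
      then have "?f w (inv k \<otimes> g) - Y (inv k \<otimes> g) = of_real (h k - of_int (- n))" by (simp add: n
          Yk)
      then show ?thesis using k(2)[of "- n"] by (simp only: norm_of_real)
    qed
  qed
  have inj: "inj_on (\<lambda>g. inv k \<otimes> g) E" using E A k by (intro inj_onI) (metis Units_eq
      Units_l_cancel inv_closed subsetD)
  \<comment> \<open>The points \<open>inv k \<otimes> g\<close> are distinct, so the squared
    deviations add up to at least the square of \<open>d\<close> times the norm of \<open>V\<close>,
    contradicting \<open>upper\<close>.\<close>
  have "d\<^sup>2 * (?n V)\<^sup>2 = (\<Sum>g\<in>E. d\<^sup>2)" by (simp add: nV)
  also have "\<dots> \<le> (\<Sum>g\<in>E. (cmod (?f w (inv k \<otimes> g) - Y (inv k \<otimes> g)))\<^sup>2)"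
    using lowerpt k(3) by (intro sum_mono power_mono)
  also have "\<dots> = (\<Sum>s\<in>(\<lambda>g. inv k \<otimes> g) ` E. (cmod (?f w s - Y s))\<^sup>2)"
    by (simp add: sum.reindex[OF inj])
  also have "\<dots> \<le> (?n (\<lambda>s. ?f w s - Y s))\<^sup>2"
    using E A k by (intro finite_sum_le_ell2_norm_sq ell2_diff[OF fw Y]) auto
  also have "\<dots> < (d * ?n V)\<^sup>2" using upper by (intro power_strict_mono) auto
  finally show False by (simp add: power_mult_distrib)
qed

end

section \<open>Compressions to finite sets\<close>

lemma pow_mat_Suc_left:
  fixes A :: "'a::semiring_1 mat"
  assumes A: "A \<in> carrier_mat n n"
  shows "A ^\<^sub>m Suc k = A * A ^\<^sub>m k"
proof (induction k)
  case 0
  then show ?case using A by simp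
next
  case (Suc k)
  have "A ^\<^sub>m Suc (Suc k) = A * A ^\<^sub>m k * A" using Suc by simp
  also have "\<dots> = A * (A ^\<^sub>m k * A)" using assoc_mult_mat[OF A pow_carrier_mat[OF A] A] .
  finally show ?case by simp
qed

lemma mat_mult_entry:
  assumes "A \<in> carrier_mat n m" "B \<in> carrier_mat m k" "i < n" "j < k"
  shows "(A * B) $$ (i, j) = (\<Sum>l<m. A $$ (i, l) * B $$ (l, j))"
  using assms by (simp add: scalar_prod_def atLeast0LessThan)

lemma mat_vec_entry:
  assumes "A \<in> carrier_mat n m" "v \<in> carrier_vec m" "i < n"
  shows "vec_index (A *\<^sub>v v) i = (\<Sum>j<m. A $$ (i, j) * vec_index v j)"
  using assms by (simp add: scalar_prod_def atLeast0LessThan)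

context group begin

text \<open>The values -1, 0, 1 are those of a difference of two indicator functions of subsets of
  \<open>A\<close>. The notion separates the arithmetic input of the determinant bound from the
  analytic constants needed to establish it.\<close>

definition integrally_independent :: "('a \<Rightarrow> real) \<Rightarrow> 'a set \<Rightarrow> 'a set \<Rightarrow> bool" where
  "integrally_independent f F A \<longleftrightarrow> (\<forall>\<epsilon> z :: 'a \<Rightarrow> int.
    (\<forall>\<gamma>\<in>A. \<epsilon> \<gamma> \<in> {-1, 0, 1}) \<and>
    (\<forall>s\<in>F. convolution_op G (conv_adjoint G f) (convolution_op G f (\<lambda>s. if s \<in> F then of_int (z s)
        else 0)) s =
      (if s \<in> A then of_int (\<epsilon> s) else 0)) \<longrightarrow> (\<forall>\<gamma>\<in>A. \<epsilon> \<gamma> = 0))"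

lemma integrally_independentD:
  assumes "integrally_independent f F A" "\<forall>\<gamma>\<in>A. \<epsilon> \<gamma> \<in> {-1, 0, 1}"
    "\<forall>s\<in>F. convolution_op G (conv_adjoint G f) (convolution_op G f (\<lambda>s. if s \<in> F then of_int (z s)
        else 0)) s =
      (if s \<in> A then of_int (\<epsilon> s) else 0)"
  shows "\<forall>\<gamma>\<in>A. \<epsilon> \<gamma> = 0"
  using assms unfolding integrally_independent_def by blast

definition gram :: "('a \<Rightarrow> real) \<Rightarrow> 'a \<Rightarrow> real" where
  "gram f = convolution G (conv_adjoint G f) f"

abbreviation gram_op :: "('a \<Rightarrow> real) \<Rightarrow> 'a ell2_op" where
  "gram_op f \<equiv> convolution_op G (gram f)"

context
  fixes f :: "'a \<Rightarrow> real"
  assumes f: "f \<in> fin_fun G" and fint: "\<And>s. f s \<in> \<int>"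
begin

section \<open>The operator of the product of the adjoint of \<open>f\<close> with
  \<open>f\<close>\<close>

lemma gram_fin_fun: "gram f \<in> fin_fun G"
  unfolding gram_def by (intro convolution_fin_fun conv_adjoint_fin_fun f)

lemma gram_op_eq: "x \<in> ell2 (carrier G) \<Longrightarrow> gram_op f x = convolution_op G (conv_adjoint G f)
    (convolution_op G f x)"
  unfolding gram_def by (intro convolution_op_compose[symmetric] conv_adjoint_fin_fun f)

lemma gram_op_mem: "x \<in> ell2 (carrier G) \<Longrightarrow> gram_op f x \<in> ell2 (carrier G)"
  by (rule bounded_ops_mem[OF convolution_op_bounded(1)[OF gram_fin_fun]])

lemma gram_op_inner:
  assumes x: "x \<in> ell2 (carrier G)"
  shows "ell2_inner (carrier G) (gram_op f x) x = of_real ((ell2_norm (carrier G) (convolution_op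
      G f x))\<^sup>2)"
proof -
  note fx = bounded_ops_mem[OF convolution_op_bounded(1)[OF f] x]
  have "ell2_inner (carrier G) (convolution_op G f x) (convolution_op G f x) = ell2_inner (carrier
      G) x (gram_op f x)"
    unfolding gram_op_eq[OF x] by (rule convolution_op_adjoint[OF f x fx])
  then show ?thesis
    using ell2_inner_self[OF fx] ell2_inner_commute[of _ "gram_op f x" x]
    by (metis complex_cnj_complex_of_real)
qed

lemma gram_op_self_adjoint: "self_adjoint (carrier G) (gram_op f)"
  unfolding self_adjoint_def
proof (intro ballI)
  fix x y assume x: "x \<in> ell2 (carrier G)" and y: "y \<in> ell2 (carrier G)"
  note fx = bounded_ops_mem[OF convolution_op_bounded(1)[OF f] x]
    and fy = bounded_ops_mem[OF convolution_op_bounded(1)[OF f] y]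
  have "ell2_inner (carrier G) (gram_op f x) y = cnj (ell2_inner (carrier G) y (gram_op f x))"
    by (rule ell2_inner_commute)
  also have "\<dots> = cnj (ell2_inner (carrier G) (convolution_op G f y) (convolution_op G f x))"
    unfolding gram_op_eq[OF x] using convolution_op_adjoint[OF f y fx] by simp
  also have "\<dots> = ell2_inner (carrier G) (convolution_op G f x) (convolution_op G f y)"
    by (rule ell2_inner_commute[symmetric])
  also have "\<dots> = ell2_inner (carrier G) x (gram_op f y)"
    unfolding gram_op_eq[OF y] by (rule convolution_op_adjoint[OF f x fy])
  finally show "ell2_inner (carrier G) (gram_op f x) y = ell2_inner (carrier G) x (gram_op f y)" .
qed

lemma gram_op_bound:
  assumes x: "x \<in> ell2 (carrier G)"
  shows "ell2_norm (carrier G) (gram_op f x) \<le> (ell1_norm f)\<^sup>2 * ell2_norm (carrier G) x"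
proof -
  note fx = bounded_ops_mem[OF convolution_op_bounded(1)[OF f] x]
  have "ell2_norm (carrier G) (gram_op f x) \<le> ell1_norm f * ell2_norm (carrier G) (convolution_op
      G f x)"
    using convolution_op_bounded(2)[OF conv_adjoint_fin_fun[OF f] fx]
    by (simp add: gram_op_eq[OF x] ell1_norm_conv_adjoint[OF f])
  also have "\<dots> \<le> ell1_norm f * (ell1_norm f * ell2_norm (carrier G) x)"
    by (intro mult_left_mono convolution_op_bounded(2)[OF f x]) simp
  finally show ?thesis by (simp add: power2_eq_square)
qed

lemma gram_op_fin_fun:
  assumes "x \<in> fin_fun G"
  shows "gram_op f x \<in> fin_fun G"
proof -
  have "(\<lambda>s. complex_of_real (gram f s)) \<in> fin_fun G" using gram_fin_fun by (simp add: fin_fun_def)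
  then show ?thesis
    unfolding convolution_op_apply[OF fin_fun_ell2[OF assms]] using assms by (rule
        convolution_fin_fun)
qed

text \<open>Self-adjointness evaluated at two point masses, the coefficients being real. The lattice
  bound combines rows of the matrix whereas the operator combines columns, and symmetry reconciles
  the two.\<close>

lemma gram_symmetric:
  assumes s: "s \<in> carrier G" and t: "t \<in> carrier G"
  shows "gram f (s \<otimes> inv t) = gram f (t \<otimes> inv s)"
proof -
  have pm: "point_mass u \<in> ell2 (carrier G)" if "u \<in> carrier G" for u
    using that by (intro fin_fun_ell2 point_mass_fin_fun)
  have ent: "gram_op f (point_mass u) v = of_real (gram f (v \<otimes> inv u))" if "u \<in> carrier G" "v \<in>
      carrier G" for u v
    using convolution_eq_sum_right[of "{u}" "point_mass u" v "\<lambda>s. complex_of_real (gram f s)"]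
        that pm
    by (simp add: convolution_op_apply point_mass_def)
  have "ell2_inner (carrier G) (gram_op f (point_mass t)) (point_mass s) = gram_op f (point_mass
      t) s"
    using s by (subst ell2_inner_finite_support[of "{s}"]) (auto simp: point_mass_def)
  moreover have "ell2_inner (carrier G) (point_mass t) (gram_op f (point_mass s)) = cnj (gram_op f
      (point_mass s) t)"
    using t by (subst ell2_inner_finite_support[of "{t}"]) (auto simp: point_mass_def)
  ultimately have "gram_op f (point_mass t) s = cnj (gram_op f (point_mass s) t)"
    using gram_op_self_adjoint pm s t unfolding self_adjoint_def by metis
  then show ?thesis using s t by (simp add: ent)
qed

lemma gram_int: "gram f s \<in> \<int>"
proof (cases "s \<in> carrier G")
  case True
  note fa = conv_adjoint_fin_fun[OF f]
  have "gram f s = (\<Sum>t | conv_adjoint G f t \<noteq> 0. conv_adjoint G f t * f (inv t \<otimes> s))"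
    unfolding gram_def by (rule convolution_eq_sum[OF fin_funD(1)[OF fa] order_refl fin_funD(2)[OF
        fa] True])
  also have "\<dots> \<in> \<int>" using fint by (intro Ints_sum Ints_mult) (auto simp: conv_adjoint_def)
  finally show ?thesis .
qed (simp add: gram_def convolution_outside)

text \<open>Powers of a left convolution operator commute with right translations and thus look
  alike from every point of the group; hence all their diagonal coefficients equal the
  trace.\<close>

lemma gram_op_pow_translate:
  assumes u: "u \<in> carrier G"
  shows "(gram_op f ^^ k) (point_mass \<one>) \<in> fin_fun G"
    "(gram_op f ^^ k) (point_mass u) = right_translate G u ((gram_op f ^^ k) (point_mass \<one>))"
proof -
  show fin: "(gram_op f ^^ k) (point_mass \<one>) \<in> fin_fun G" for k
    by (induction k) (auto intro: gram_op_fin_fun point_mass_fin_fun)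
  show "(gram_op f ^^ k) (point_mass u) = right_translate G u ((gram_op f ^^ k) (point_mass \<one>))"
  proof (induction k)
    case 0
    then show ?case by (simp add: right_translate_point_mass_one[OF u])
  next
    case (Suc k)
    then show ?case using convolution_op_right_translate[OF gram_fin_fun u fin[of k]] by simp
  qed
qed

lemma gram_op_pow_diagonal:
  assumes u: "u \<in> carrier G"
  shows "(gram_op f ^^ k) (point_mass u) u = (gram_op f ^^ k) (point_mass \<one>) \<one>"
  unfolding gram_op_pow_translate(2)[OF u, of k] using u by (simp add: right_translate_def)

context
  fixes F :: "'a set" and n :: nat and e :: "nat \<Rightarrow> 'a"
  assumes F: "finite F" "F \<subseteq> carrier G" and e: "bij_betw e {..<n} F"
begin

text \<open>Kept as an operator on functions, so that its powers can be compared with those of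
  \<open>gram_op f\<close> without passing through indices.\<close>

definition compression :: "('a \<Rightarrow> complex) \<Rightarrow> 'a \<Rightarrow> complex" where
  "compression w = (\<lambda>s. if s \<in> F then gram_op f w s else 0)"

text \<open>The values of \<open>gram f\<close> are integers, so the floor only changes the type to
  the one required by the lattice count. \<open>e\<close> is an arbitrary enumeration of
  \<open>F\<close>.\<close>

definition compressed_mat :: "int mat" where
  "compressed_mat = mat n n (\<lambda>(i, j). \<lfloor>gram f (e i \<otimes> inv (e j))\<rfloor>)"

lemma gram_op_sum:
  assumes w: "{s. w s \<noteq> 0} \<subseteq> F" and s: "s \<in> carrier G"
  shows "gram_op f w s = (\<Sum>j<n. of_real (gram f (s \<otimes> inv (e j))) * w (e j))"
proof -
  have "w \<in> fin_fun G" using w F finite_subset by (auto simp: fin_fun_def)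
  then have "gram_op f w s = (\<Sum>u\<in>F. of_real (gram f (s \<otimes> inv u)) * w u)"
    using convolution_eq_sum_right[OF F(1) w F(2) s, of "\<lambda>s. of_real (gram f s)"]
    by (simp add: convolution_op_apply fin_fun_ell2)
  also have "\<dots> = (\<Sum>j<n. of_real (gram f (s \<otimes> inv (e j))) * w (e j))"
    by (rule sum.reindex_bij_betw[OF e, symmetric])
  finally show ?thesis .
qed

lemma e_mem: "j < n \<Longrightarrow> e j \<in> F" "j < n \<Longrightarrow> e j \<in> carrier G"
  using e F by (auto simp: bij_betw_def)

lemma e_inj: "i < n \<Longrightarrow> j < n \<Longrightarrow> e i = e j \<longleftrightarrow> i = j"
  using e by (auto simp: bij_betw_def inj_on_def)

lemma compressed_mat_carrier [simp]: "compressed_mat \<in> carrier_mat n n"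
  by (simp add: compressed_mat_def)

lemma compressed_mat_entry:
  "i < n \<Longrightarrow> j < n \<Longrightarrow> real_of_int (compressed_mat $$ (i, j)) = gram f (e i \<otimes> inv (e j))"
  using gram_int by (simp add: compressed_mat_def)

lemma compressed_mat_entry_symmetric:
  "i < n \<Longrightarrow> j < n \<Longrightarrow> compressed_mat $$ (i, j) = compressed_mat $$ (j, i)"
  using gram_symmetric[OF e_mem(2) e_mem(2), of i j] by (simp add: compressed_mat_def)

abbreviation compressed_cmat :: "complex mat" where
  "compressed_cmat \<equiv> map_mat of_int compressed_mat"

lemma compressed_cmat_entry:
  "i < n \<Longrightarrow> j < n \<Longrightarrow> compressed_cmat $$ (i, j) = of_real (gram f (e i \<otimes> inv (e j)))"
  using compressed_mat_carrier compressed_mat_entry[of i j]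
  by (metis carrier_matD index_map_mat(1) of_real_of_int_eq)

lemma compressed_cmat_carrier: "compressed_cmat \<in> carrier_mat n n"
  using compressed_mat_carrier by simp

lemma compression_apply: "s \<in> F \<Longrightarrow> compression w s = gram_op f w s"
  by (simp add: compression_def)

lemma compression_support: "{s. compression w s \<noteq> 0} \<subseteq> F"
  by (auto simp: compression_def)

lemma compression_pow_support: "u \<in> F \<Longrightarrow> {s. (compression ^^ k) (point_mass u) s \<noteq> 0} \<subseteq> F"
  by (cases k) (use compression_support in \<open>auto simp: point_mass_def split: if_splits\<close>)

lemma compressed_cmat_pow_entry:
  assumes "i < n" "j < n"
  shows "(compressed_cmat ^\<^sub>m k) $$ (i, j) = (compression ^^ k) (point_mass (e j)) (e i)"
  using assms
proof (induction k arbitrary: i)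
  case 0
  then show ?case using e_inj carrier_matD[OF compressed_mat_carrier] by (simp add: point_mass_def)
next
  case (Suc k)
  let ?M = compressed_cmat
  have "(?M ^\<^sub>m Suc k) $$ (i, j) = (\<Sum>l<n. ?M $$ (i, l) * (?M ^\<^sub>m k) $$ (l, j))"
    unfolding pow_mat_Suc_left[OF compressed_cmat_carrier]
    by (rule mat_mult_entry[OF compressed_cmat_carrier pow_carrier_mat[OF compressed_cmat_carrier]
        Suc.prems])
  also have "\<dots> = (\<Sum>l<n. of_real (gram f (e i \<otimes> inv (e l))) * (compression ^^ k) (point_mass (e j))
      (e l))"
    using Suc by (intro sum.cong) (simp_all add: compressed_cmat_entry del: index_map_mat)
  also have "\<dots> = gram_op f ((compression ^^ k) (point_mass (e j))) (e i)"
    using gram_op_sum[OF compression_pow_support[OF e_mem(1)] e_mem(2)] Suc.prems by simp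
  finally show ?case using compression_apply[OF e_mem(1)] Suc.prems by simp
qed

text \<open>Cutting off to \<open>F\<close> does not increase the norm. The bound serves at points
  near the boundary of \<open>F\<close>, where powers of the compression and of the full operator
  may differ.\<close>

lemma compression_pow_bound:
  assumes u: "u \<in> F"
  shows "(compression ^^ k) (point_mass u) \<in> ell2 (carrier G)"
    "ell2_norm (carrier G) ((compression ^^ k) (point_mass u)) \<le> (ell1_norm f)\<^sup>2 ^ k"
proof -
  show mem: "(compression ^^ k) (point_mass u) \<in> ell2 (carrier G)" for k
    by (rule ell2_finite_support) (use compression_pow_support[OF u, of k] F finite_subset in auto)
  show "ell2_norm (carrier G) ((compression ^^ k) (point_mass u)) \<le> (ell1_norm f)\<^sup>2 ^ k"
  proof (induction k)
    case 0
    have "(ell2_norm (carrier G) (point_mass u))\<^sup>2 = 1"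
      using u F by (subst ell2_norm_finite_support[of "{u}"]) (auto simp: point_mass_def)
    then have "ell2_norm (carrier G) (point_mass u) = 1"
      using ell2_norm_nonneg[of "carrier G" "point_mass u"] by (simp add: power2_eq_1_iff)
    then show ?case by simp
  next
    case (Suc k)
    let ?x = "(compression ^^ k) (point_mass u)"
    have "(ell2_norm (carrier G) (compression ?x))\<^sup>2 = (\<Sum>i\<in>F. (cmod (compression ?x i))\<^sup>2)"
      using F compression_support by (intro ell2_norm_finite_support) auto
    also have "\<dots> = (\<Sum>i\<in>F. (cmod (gram_op f ?x i))\<^sup>2)" by (simp add: compression_def)
    also have "\<dots> \<le> (ell2_norm (carrier G) (gram_op f ?x))\<^sup>2"
      by (rule finite_sum_le_ell2_norm_sq[OF gram_op_mem[OF mem] F])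
    finally have "ell2_norm (carrier G) (compression ?x) \<le> ell2_norm (carrier G) (gram_op f ?x)"
      by (rule power2_le_imp_le) simp
    also have "\<dots> \<le> (ell1_norm f)\<^sup>2 * ell2_norm (carrier G) ?x" by (rule gram_op_bound[OF mem])
    also have "\<dots> \<le> (ell1_norm f)\<^sup>2 * (ell1_norm f)\<^sup>2 ^ k" using Suc by (intro mult_left_mono) auto
    finally show ?case by simp
  qed
qed

text \<open>As long as all powers up to \<open>k\<close>, applied to the mass at \<open>u\<close>,
  stay supported in \<open>F\<close>, the cut-off never takes effect.\<close>

lemma compression_pow_interior:
  assumes u: "u \<in> F" and inside: "\<And>j s. j \<le> k \<Longrightarrow> (gram_op f ^^ j) (point_mass \<one>) s \<noteq> 0 \<Longrightarrow> s \<otimes> u \<in> F"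
  shows "(compression ^^ k) (point_mass u) = (gram_op f ^^ k) (point_mass u)"
  using inside
proof (induction k)
  case (Suc k)
  have uG: "u \<in> carrier G" using u F by blast
  have "(gram_op f ^^ Suc k) (point_mass u) s = 0" if "s \<notin> F" for s
  proof (rule ccontr)
    assume nz: "(gram_op f ^^ Suc k) (point_mass u) s \<noteq> 0"
    then have "s \<in> {s. right_translate G u ((gram_op f ^^ Suc k) (point_mass \<one>)) s \<noteq> 0}"
      unfolding gram_op_pow_translate(2)[OF uG] by simp
    then obtain t where "s = t \<otimes> u" "(gram_op f ^^ Suc k) (point_mass \<one>) t \<noteq> 0"
      unfolding right_translate_fin_fun(2)[OF uG gram_op_pow_translate(1)[OF uG]] by blast
    then show False using Suc.prems[of "Suc k" t] that by auto
  qed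
  moreover have "(compression ^^ k) (point_mass u) = (gram_op f ^^ k) (point_mass u)"
  proof (rule Suc.IH)
    fix j s assume "j \<le> k" "(gram_op f ^^ j) (point_mass \<one>) s \<noteq> 0"
    then show "s \<otimes> u \<in> F" using Suc.prems[of j s] by simp
  qed
  moreover have "compression x = gram_op f x" if "\<And>s. s \<notin> F \<Longrightarrow> gram_op f x s = 0" for x
    using that by (auto simp: compression_def)
  ultimately show ?case by simp
qed simp

text \<open>Extended by zero off \<open>F\<close>, an eigenvector exhibits its eigenvalue as the
  Rayleigh quotient \<open>|f w|^2 / |w|^2\<close>, so every compression inherits the bounds of the
  full operator, uniformly in \<open>F\<close>.\<close>

lemma eigenvalue_bounds:
  assumes c: "\<And>x. x \<in> ell2 (carrier G) \<Longrightarrow>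
      c * (ell2_norm (carrier G) x)\<^sup>2 \<le> (ell2_norm (carrier G) (convolution_op G f x))\<^sup>2"
    and ev: "eigenvalue compressed_cmat \<mu>"
  shows "\<mu> = of_real (Re \<mu>)" "c \<le> Re \<mu>" "Re \<mu> \<le> (ell1_norm f)\<^sup>2"
proof -
  let ?M = compressed_cmat
  let ?n = "ell2_norm (carrier G)"
  obtain v where v: "v \<in> carrier_vec n" "v \<noteq> 0\<^sub>v n" "?M *\<^sub>v v = \<mu> \<cdot>\<^sub>v v"
    using ev carrier_matD[OF compressed_mat_carrier] unfolding eigenvalue_def eigenvector_def by
        auto
  define idx where "idx = the_inv_into {..<n} e"
  have idx: "idx (e i) = i" if "i < n" for i
    unfolding idx_def using e that by (simp add: bij_betw_def the_inv_into_f_f)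
  define w where "w s = (if s \<in> F then vec_index v (idx s) else 0)" for s
  have wF: "{s. w s \<noteq> 0} \<subseteq> F" by (auto simp: w_def)
  have we: "w (e i) = vec_index v i" if "i < n" for i using that by (simp add: w_def idx e_mem)
  have w: "w \<in> ell2 (carrier G)" by (rule ell2_finite_support) (use wF F finite_subset in auto)
  have Lw: "gram_op f w (e i) = \<mu> * w (e i)" if i: "i < n" for i
  proof -
    have "gram_op f w (e i) = (\<Sum>j<n. ?M $$ (i, j) * vec_index v j)"
      unfolding gram_op_sum[OF wF e_mem(2)[OF i]]
      using i by (intro sum.cong) (simp_all add: compressed_cmat_entry we del: index_map_mat)
    also have "\<dots> = vec_index (?M *\<^sub>v v) i"
      using mat_vec_entry[OF compressed_cmat_carrier v(1) i] by simp
    also have "\<dots> = \<mu> * w (e i)" unfolding v(3) using i v(1) by (simp add: we)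
    finally show ?thesis .
  qed
  have "ell2_inner (carrier G) (gram_op f w) w = (\<Sum>s\<in>F. gram_op f w s * cnj (w s))"
    using F wF by (intro ell2_inner_finite_support) auto
  also have "\<dots> = (\<Sum>s\<in>F. \<mu> * w s * cnj (w s))"
  proof (rule sum.cong)
    fix s assume "s \<in> F"
    then obtain i where "i < n" "s = e i" using e by (auto simp: bij_betw_def)
    then show "gram_op f w s * cnj (w s) = \<mu> * w s * cnj (w s)" using Lw by simp
  qed simp
  also have "\<dots> = \<mu> * ell2_inner (carrier G) w w"
    using F wF by (subst ell2_inner_finite_support[of F]) (auto simp: sum_distrib_left mult.assoc)
  finally have eq: "of_real ((?n (convolution_op G f w))\<^sup>2) = \<mu> * of_real ((?n w)\<^sup>2)"
    by (simp add: gram_op_inner[OF w] ell2_inner_self[OF w])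
  have "\<exists>i<n. vec_index v i \<noteq> 0"
  proof (rule ccontr)
    assume "\<not> (\<exists>i<n. vec_index v i \<noteq> 0)"
    then have "v = 0\<^sub>v n" using v(1) by (intro eq_vecI) auto
    then show False using v(2) by blast
  qed
  then obtain i where "i < n" "w (e i) \<noteq> 0" using we by auto
  then have pos: "(?n w)\<^sup>2 > 0" using ell2_norm_eq_0[OF w] ell2_norm_nonneg[of "carrier G" w]
    by (metis zero_less_power2)
  define r where "r = (?n (convolution_op G f w))\<^sup>2 / (?n w)\<^sup>2"
  have "\<mu> = of_real r"
    using eq pos unfolding r_def of_real_divide by (simp add: field_simps)
  moreover have "c \<le> r" using c[OF w] pos by (simp add: r_def field_simps)
  moreover have "r \<le> (ell1_norm f)\<^sup>2"
    using power_mono[OF convolution_op_bounded(2)[OF f w] ell2_norm_nonneg, of 2] pos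
    by (simp add: r_def field_simps power_mult_distrib)
  ultimately show "\<mu> = of_real (Re \<mu>)" "c \<le> Re \<mu>" "Re \<mu> \<le> (ell1_norm f)\<^sup>2" by auto
qed

lemma compressed_det_lower_bound:
  assumes A: "A \<subseteq> F" and det: "det compressed_mat \<noteq> 0"
    and no_solution: "integrally_independent f F A"
  shows "2 ^ card A \<le> \<bar>det compressed_mat\<bar>"
proof -
  have fA: "finite A" using A F finite_subset by blast
  have "int (card (Pow A)) \<le> \<bar>det compressed_mat\<bar>"
  proof (rule card_incongruent_le_abs_det[OF compressed_mat_carrier det,
      where x = "\<lambda>B j. if e j \<in> B then 1 else 0"])
    show "finite (Pow A)" using fA by simp
    fix B B' assume B: "B \<in> Pow A" "B' \<in> Pow A" "B \<noteq> B'"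
    show "\<not> (\<exists>z. \<forall>j<n. (if e j \<in> B then 1 else 0) - (if e j \<in> B' then 1 else 0) = (\<Sum>i<n.
        compressed_mat $$ (i, j) * z i))"
    proof
      assume "\<exists>z. \<forall>j<n. (if e j \<in> B then 1 else 0) - (if e j \<in> B' then 1 else 0) = (\<Sum>i<n.
          compressed_mat $$ (i, j) * z i)"
      then obtain z where z: "\<And>j. j < n \<Longrightarrow> (if e j \<in> B then 1 else 0) - (if e j \<in> B' then 1 else 0)
          = (\<Sum>i<n. compressed_mat $$ (i, j) * z i)"
        by blast
      define idx where "idx = the_inv_into {..<n} e"
      have idx: "idx (e i) = i" if "i < n" for i
        unfolding idx_def using e that by (simp add: bij_betw_def the_inv_into_f_f)
      define \<epsilon> :: "'a \<Rightarrow> int" where "\<epsilon> s = (if s \<in> B then 1 else 0) - (if s \<in> B' then 1 else 0)"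
          for s
      define w :: "'a \<Rightarrow> complex" where "w s = (if s \<in> F then of_int (z (idx s)) else 0)" for s
      have wF: "{s. w s \<noteq> 0} \<subseteq> F" by (auto simp: w_def)
      have w: "w \<in> ell2 (carrier G)" by (rule ell2_finite_support) (use wF F finite_subset in auto)
      have "\<forall>\<gamma>\<in>A. \<epsilon> \<gamma> = 0"
      proof (rule integrally_independentD[OF no_solution, of _ "\<lambda>s. z (idx s)"])
        show "\<forall>g\<in>A. \<epsilon> g \<in> {-1, 0, 1}" by (auto simp: \<epsilon>_def)
        show "\<forall>s\<in>F. convolution_op G (conv_adjoint G f) (convolution_op G f (\<lambda>s. if s \<in> F then
            of_int (z (idx s)) else 0)) s =
            (if s \<in> A then of_int (\<epsilon> s) else 0)"
        proof
          fix s assume s: "s \<in> F"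
          then obtain j where j: "j < n" "s = e j" using e by (auto simp: bij_betw_def)
          have "gram_op f w s = (\<Sum>i<n. of_real (gram f (e j \<otimes> inv (e i))) * w (e i))"
            using gram_op_sum[OF wF, of s] j e_mem by simp
          also have "\<dots> = (\<Sum>i<n. of_int (compressed_mat $$ (i, j) * z i))"
          proof (rule sum.cong)
            fix i assume "i \<in> {..<n}"
            then have i: "i < n" by simp
            \<comment> \<open>The lattice relation supplies the entry \<open>(i, j)\<close> while
              the operator needs \<open>(j, i)\<close>; symmetry identifies them.\<close>
            have "complex_of_real (gram f (e j \<otimes> inv (e i))) = of_int (compressed_mat $$ (i, j))"
              using compressed_mat_entry[OF j(1) i] compressed_mat_entry_symmetric[OF i j(1)]
              by (metis of_real_of_int_eq)
            then show "of_real (gram f (e j \<otimes> inv (e i))) * w (e i) = of_int (compressed_mat $$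
                (i, j) * z i)"
              using i by (simp add: w_def e_mem idx)
          qed simp
          also have "\<dots> = of_int (\<epsilon> s)" using z[OF j(1)] j(2) by (simp only: of_int_sum[symmetric]
              \<epsilon>_def)
          also have "\<dots> = (if s \<in> A then of_int (\<epsilon> s) else 0)" using B by (auto simp: \<epsilon>_def)
          finally show "convolution_op G (conv_adjoint G f) (convolution_op G f (\<lambda>s. if s \<in> F then
              of_int (z (idx s)) else 0)) s =
              (if s \<in> A then of_int (\<epsilon> s) else 0)"
            unfolding gram_op_eq[OF w] unfolding w_def .
        qed
      qed
      then have "\<gamma> \<in> B \<longleftrightarrow> \<gamma> \<in> B'" if "\<gamma> \<in> A" for \<gamma> using that by (fastforce simp: \<epsilon>_def split:
          if_splits)
      then show False using B by blast
    qed
  qed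
  then show ?thesis by (simp add: card_Pow[OF fA])
qed

text \<open>Replacing half the logarithm by \<open>p\<close> costs \<delta> per eigenvalue and
  leaves the trace of \<open>p\<close> of the matrix. Along the diagonal, each point off
  \<open>bad\<close> contributes exactly the trace of \<open>p\<close> of the full operator, while
  points of \<open>bad\<close> are given only a crude bound.\<close>

lemma log_det_le_trace:
  fixes p :: "real poly" and \<delta> :: real
  assumes A: "A \<subseteq> F" and c: "c > 0" "\<And>x. x \<in> ell2 (carrier G) \<Longrightarrow>
      c * (ell2_norm (carrier G) x)\<^sup>2 \<le> (ell2_norm (carrier G) (convolution_op G f x))\<^sup>2"
    and no_solution: "integrally_independent f F A"
    and p: "\<And>r. c \<le> r \<Longrightarrow> r \<le> (ell1_norm f)\<^sup>2 \<Longrightarrow> \<bar>poly p r - ln r / 2\<bar> \<le> \<delta>"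
    and bad: "bad \<subseteq> F" "\<And>u j s. u \<in> F - bad \<Longrightarrow> j \<le> degree p \<Longrightarrow>
      (gram_op f ^^ j) (point_mass \<one>) s \<noteq> 0 \<Longrightarrow> s \<otimes> u \<in> F"
  shows "real (card A) * ln 2 / 2 \<le> real n * \<delta>
    + real (n - card bad) * Re (group_trace G (op_poly (carrier G) p (gram_op f)))
    + real (card bad) * (\<Sum>k\<le>degree p. \<bar>coeff p k\<bar> * (ell1_norm f)\<^sup>2 ^ k)"
proof -
  let ?M = compressed_cmat
  obtain es where es: "length es = n" "\<And>\<mu>. \<mu> \<in> set es \<Longrightarrow> eigenvalue ?M \<mu>" "det ?M = prod_list es"
    "\<And>k. (\<Sum>i<n. (?M ^\<^sub>m k) $$ (i, i)) = (\<Sum>\<mu>\<leftarrow>es. \<mu> ^ k)"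
    using eigenvalues_det_trace[OF compressed_cmat_carrier] by blast
  note ev = eigenvalue_bounds[OF c(2) es(2)]
  define rs where "rs = map Re es"
  have rs: "c \<le> r" "r \<le> (ell1_norm f)\<^sup>2" if "r \<in> set rs" for r
    using that ev(2,3) by (auto simp: rs_def)
  have es_rs: "es = map of_real rs"
    unfolding rs_def map_map using ev(1) by (intro map_idI[symmetric]) simp
  have prod_pos: "prod_list xs > 0" if "\<And>x. x \<in> set xs \<Longrightarrow> x > 0" for xs :: "real list"
    using that by (induction xs) auto
  have pos: "prod_list rs > 0" using rs(1) c(1) by (intro prod_pos) (auto intro: less_le_trans)
  have "complex_of_real (prod_list rs) = prod_list es" unfolding es_rs by (induction rs) auto
  moreover have "det ?M = of_int (det compressed_mat)" by (rule of_int_hom.hom_det)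
  ultimately have "complex_of_real (prod_list rs) = of_real (of_int (det compressed_mat))" using
      es(3) by simp
  then have det: "prod_list rs = of_int (det compressed_mat)" by (simp only: of_real_eq_iff)
  then have "2 ^ card A \<le> \<bar>det compressed_mat\<bar>"
    using pos by (intro compressed_det_lower_bound[OF A _ no_solution]) auto
  then have "2 ^ card A \<le> prod_list rs" using pos unfolding det by (metis abs_of_pos
      of_int_0_less_iff of_int_le_iff of_int_numeral of_int_power)
  then have "ln (2 ^ card A) \<le> ln (prod_list rs)" using pos by (subst ln_le_cancel_iff) auto
  also have "ln (prod_list rs) = (\<Sum>r\<leftarrow>rs. ln r)"
    using rs(1) c(1)
  proof (induction rs)
    case (Cons r rs)
    have "r > 0" "prod_list rs > 0"
      using Cons.prems by (auto intro!: prod_pos intro: less_le_trans)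
    then have "ln (r * prod_list rs) = ln r + ln (prod_list rs)" by (rule ln_mult_pos)
    then show ?case using Cons by simp
  qed simp
  finally have "card A * ln 2 / 2 \<le> (\<Sum>r\<leftarrow>rs. ln r) / 2" by (simp add: ln_realpow)
  also have "\<dots> \<le> (\<Sum>r\<leftarrow>rs. poly p r + \<delta>)"
    using rs
  proof (induction rs)
    case (Cons r rs)
    have "ln r / 2 \<le> poly p r + \<delta>" using p[of r] Cons.prems by auto
    then show ?case using Cons by auto
  qed simp
  also have "\<dots> = (\<Sum>r\<leftarrow>rs. poly p r) + n * \<delta>"
  proof -
    have "(\<Sum>r\<leftarrow>xs. poly p r + \<delta>) = (\<Sum>r\<leftarrow>xs. poly p r) + length xs * \<delta>" for xs
      by (induction xs) (auto simp: algebra_simps)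
    moreover have "length rs = n" using es(1) by (simp add: rs_def)
    ultimately show ?thesis by metis
  qed
  finally have main: "card A * ln 2 / 2 \<le> (\<Sum>r\<leftarrow>rs. poly p r) + n * \<delta>" .
  \<comment> \<open>\<open>d u\<close> is the real part of the diagonal coefficient at
    \<open>u\<close> of \<open>p\<close> of the compression; summed over \<open>F\<close> it gives
    the sum of \<open>p\<close> over the eigenvalues.\<close>
  define d where "d u = (\<Sum>k\<le>degree p. coeff p k * Re ((compression ^^ k) (point_mass u) u))" for u
  have "(\<Sum>r\<leftarrow>rs. poly p r) = (\<Sum>k\<le>degree p. coeff p k * (\<Sum>r\<leftarrow>rs. r ^ k))"
    by (induction rs) (simp_all add: poly_altdef sum.distrib distrib_left)
  also have "\<dots> = (\<Sum>k\<le>degree p. coeff p k * (\<Sum>i<n. Re ((compression ^^ k) (point_mass (e i)) (e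
      i))))"
  proof (intro sum.cong refl arg_cong2[of _ _ _ _ "(*)"])
    fix k
    have "complex_of_real (\<Sum>r\<leftarrow>rs. r ^ k) = (\<Sum>\<mu>\<leftarrow>es. \<mu> ^ k)" unfolding es_rs by (induction rs) auto
    then have "(\<Sum>r\<leftarrow>rs. r ^ k) = Re (\<Sum>i<n. (?M ^\<^sub>m k) $$ (i, i))" unfolding es(4) by (metis
        Re_complex_of_real)
    also have "\<dots> = (\<Sum>i<n. Re ((compression ^^ k) (point_mass (e i)) (e i)))"
      using compressed_cmat_pow_entry by simp
    finally show "(\<Sum>r\<leftarrow>rs. r ^ k) = (\<Sum>i<n. Re ((compression ^^ k) (point_mass (e i)) (e i)))" .
  qed
  also have "\<dots> = (\<Sum>i<n. d (e i))" unfolding d_def sum_distrib_left by (rule sum.swap)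
  also have "\<dots> = (\<Sum>u\<in>F. d u)" by (rule sum.reindex_bij_betw[OF e])
  also have "\<dots> = (\<Sum>u\<in>F - bad. d u) + (\<Sum>u\<in>bad. d u)"
    using F bad(1) by (simp add: sum.subset_diff)
  also have "(\<Sum>u\<in>bad. d u) \<le> card bad * (\<Sum>k\<le>degree p. \<bar>coeff p k\<bar> * (ell1_norm f)\<^sup>2 ^ k)"
  proof (rule sum_bounded_above)
    fix u assume "u \<in> bad"
    then have u: "u \<in> F" using bad(1) by blast
    show "d u \<le> (\<Sum>k\<le>degree p. \<bar>coeff p k\<bar> * (ell1_norm f)\<^sup>2 ^ k)"
      unfolding d_def
    proof (rule sum_mono)
      fix k
      have "\<bar>Re ((compression ^^ k) (point_mass u) u)\<bar> \<le> (ell1_norm f)\<^sup>2 ^ k"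
        using abs_Re_le_cmod cmod_le_ell2_norm[OF compression_pow_bound(1)[OF u, of k], of u]
          compression_pow_bound(2)[OF u, of k] by (meson order_trans)
      then have "\<bar>coeff p k * Re ((compression ^^ k) (point_mass u) u)\<bar> \<le> \<bar>coeff p k\<bar> * (ell1_norm
          f)\<^sup>2 ^ k"
        unfolding abs_mult by (rule mult_left_mono) simp
      then show "coeff p k * Re ((compression ^^ k) (point_mass u) u) \<le> \<bar>coeff p k\<bar> * (ell1_norm
          f)\<^sup>2 ^ k"
        by linarith
    qed
  qed
  also have "(\<Sum>u\<in>F - bad. d u) = (\<Sum>u\<in>F - bad. Re (group_trace G (op_poly (carrier G) p (gram_op
      f))))"
  proof (rule sum.cong)
    fix u assume u: "u \<in> F - bad"
    then have uF: "u \<in> F" "u \<in> carrier G" using F by auto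
    have "(compression ^^ k) (point_mass u) u = (gram_op f ^^ k) (point_mass \<one>) \<one>" if "k \<le> degree
        p" for k
    proof -
      have "(compression ^^ k) (point_mass u) = (gram_op f ^^ k) (point_mass u)"
      proof (rule compression_pow_interior[OF uF(1)])
        fix j s assume "j \<le> k" "(gram_op f ^^ j) (point_mass \<one>) s \<noteq> 0"
        then show "s \<otimes> u \<in> F" using bad(2)[OF u, of j s] that by simp
      qed
      then show ?thesis using gram_op_pow_diagonal[OF uF(2), of k] by simp
    qed
    then have "d u = (\<Sum>k\<le>degree p. coeff p k * Re ((gram_op f ^^ k) (point_mass \<one>) \<one>))"
      by (simp add: d_def)
    also have "\<dots> = Re (op_poly (carrier G) p (gram_op f) (point_mass \<one>) \<one>)"
      using fin_fun_ell2[OF point_mass_fin_fun[OF one_closed]] by (simp add: op_poly_def)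
    also have "op_poly (carrier G) p (gram_op f) (point_mass \<one>) \<one> = group_trace G (op_poly
        (carrier G) p (gram_op f))"
      unfolding group_trace_def by (subst ell2_inner_finite_support[of "{\<one>}"]) (auto simp:
          point_mass_def)
    finally show "d u = Re (group_trace G (op_poly (carrier G) p (gram_op f)))" .
  qed simp
  also have "\<dots> = (n - card bad) * Re (group_trace G (op_poly (carrier G) p (gram_op f)))"
    using F bad(1) bij_betw_same_card[OF e] by (simp add: card_Diff_subset finite_subset)
  finally show ?thesis using main by (simp add: algebra_simps)
qed

end

end

end

section \<open>Separated sets and Folner sets\<close>

context group begin

text \<open>A separated subset of largest cardinality is maximal, so every point of \<open>X\<close>
  lies in \<open>A\<close> or is reached from a point of \<open>A\<close> by some \<open>z\<close>
  or \<open>inv z\<close> with \<open>z\<close> in \<open>Z\<close>. Thus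
  \<open>2 * card Z + 1\<close> translates of \<open>A\<close> cover \<open>X\<close>.\<close>

lemma separated_subset:
  assumes X: "finite X" "X \<subseteq> carrier G" and Z: "finite Z" "Z \<subseteq> carrier G"
  obtains A where "A \<subseteq> X" "\<And>a b z. a \<in> A \<Longrightarrow> b \<in> A \<Longrightarrow> z \<in> Z \<Longrightarrow> a = z \<otimes> b \<Longrightarrow> a = b"
    "card X \<le> card A * (2 * card Z + 1)"
proof -
  define sep where "sep A \<longleftrightarrow> A \<subseteq> X \<and> (\<forall>a\<in>A. \<forall>b\<in>A. \<forall>z\<in>Z. a = z \<otimes> b \<longrightarrow> a = b)" for A
  have "sep {}" by (simp add: sep_def)
  moreover have "\<forall>B. sep B \<longrightarrow> card B < Suc (card X)" using X by (auto simp: sep_def less_Suc_eq_le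
      intro: card_mono)
  ultimately have "\<exists>A. sep A \<and> (\<forall>B. sep B \<longrightarrow> card B \<le> card A)"
    using ex_has_greatest_nat[of sep "{}" card "Suc (card X)"] by blast
  then obtain A where A: "sep A" "\<And>B. sep B \<Longrightarrow> card B \<le> card A" by blast
  have fA: "finite A" "A \<subseteq> X" using A(1) X finite_subset by (auto simp: sep_def)
  have "X \<subseteq> (\<Union>a\<in>A. insert a ((\<lambda>z. z \<otimes> a) ` Z \<union> (\<lambda>z. inv z \<otimes> a) ` Z))"
  proof
    fix x assume x: "x \<in> X"
    show "x \<in> (\<Union>a\<in>A. insert a ((\<lambda>z. z \<otimes> a) ` Z \<union> (\<lambda>z. inv z \<otimes> a) ` Z))"
    proof (cases "x \<in> A")
      case False
      have "\<not> sep (insert x A)" using A(2)[of "insert x A"] fA False by auto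
      then obtain a b z where abz: "a \<in> insert x A" "b \<in> insert x A" "z \<in> Z" "a = z \<otimes> b" "a \<noteq> b"
        using x fA by (auto simp: sep_def)
      have "\<not> (a \<in> A \<and> b \<in> A)" using A(1) abz by (auto simp: sep_def)
      then consider "a = x" "b \<in> A" | "b = x" "a \<in> A" using abz(1,2,5) by blast
      then show ?thesis
      proof cases
        case 1
        then have "x \<in> (\<lambda>z. z \<otimes> b) ` Z" using abz(3,4) by blast
        then show ?thesis using 1(2) by blast
      next
        case 2
        have "z \<in> carrier G" "x \<in> carrier G" using abz Z X x by auto
        then have "x = inv z \<otimes> a" using abz(4) 2(1) by (simp add: m_assoc[symmetric])
        then have "x \<in> (\<lambda>z. inv z \<otimes> a) ` Z" using abz(3) by blast
        then show ?thesis using 2(2) by blast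
      qed
    qed auto
  qed
  then have "card X \<le> card (\<Union>a\<in>A. insert a ((\<lambda>z. z \<otimes> a) ` Z \<union> (\<lambda>z. inv z \<otimes> a) ` Z))"
    using fA Z by (intro card_mono) auto
  also have "\<dots> \<le> (\<Sum>a\<in>A. card (insert a ((\<lambda>z. z \<otimes> a) ` Z \<union> (\<lambda>z. inv z \<otimes> a) ` Z)))"
    by (rule card_UN_le[OF fA(1)])
  also have "\<dots> \<le> (\<Sum>a\<in>A. 2 * card Z + 1)"
  proof (rule sum_mono)
    fix a
    have "card (insert a ((\<lambda>z. z \<otimes> a) ` Z \<union> (\<lambda>z. inv z \<otimes> a) ` Z)) \<le> Suc (card ((\<lambda>z. z \<otimes> a) ` Z \<union>
        (\<lambda>z. inv z \<otimes> a) ` Z))"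
      by (rule card_insert_le_m1[of "Suc (card _)", simplified]) simp
    also have "card ((\<lambda>z. z \<otimes> a) ` Z \<union> (\<lambda>z. inv z \<otimes> a) ` Z) \<le> card Z + card Z"
      by (rule order_trans[OF card_Un_le add_mono]) (auto intro: card_image_le Z)
    finally show "card (insert a ((\<lambda>z. z \<otimes> a) ` Z \<union> (\<lambda>z. inv z \<otimes> a) ` Z)) \<le> 2 * card Z + 1" by simp
  qed
  finally have "card X \<le> card A * (2 * card Z + 1)" by simp
  then show thesis using that[of A] A(1) fA(2) unfolding sep_def by blast
qed

text \<open>For each \<open>w\<close>, the points of \<open>F\<close> moved out of \<open>F\<close>
  inject into the symmetric difference of \<open>w <# F\<close> and \<open>F\<close>. The errors are
  summed over \<open>W\<close>, whence \<sigma> is divided by \<open>card W + 1\<close>.\<close>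

lemma Folner_interior:
  fixes \<sigma> :: real
  assumes "amenable G" and W: "finite W" "W \<subseteq> carrier G" and \<sigma>: "\<sigma> > 0"
  obtains F where "finite F" "F \<noteq> {}" "F \<subseteq> carrier G"
    "real (card {u\<in>F. \<exists>w\<in>W. w \<otimes> u \<notin> F}) \<le> \<sigma> * real (card F)"
proof -
  define \<epsilon> where "\<epsilon> = \<sigma> / (card W + 1)"
  have "\<epsilon> > 0" using \<sigma> by (simp add: \<epsilon>_def)
  then obtain F where F: "finite F" "F \<noteq> {}" "F \<subseteq> carrier G"
    "\<And>w. w \<in> W \<Longrightarrow> real (card (sym_diff (w <# F) F)) \<le> \<epsilon> * real (card F)"
    using assms unfolding amenable_def by meson
  have "card {u\<in>F. \<exists>w\<in>W. w \<otimes> u \<notin> F} \<le> card (\<Union>w\<in>W. {u\<in>F. w \<otimes> u \<notin> F})"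
    using F W by (intro card_mono) auto
  also have "\<dots> \<le> (\<Sum>w\<in>W. card {u\<in>F. w \<otimes> u \<notin> F})" by (rule card_UN_le[OF W(1)])
  finally have "real (card {u\<in>F. \<exists>w\<in>W. w \<otimes> u \<notin> F}) \<le> real (\<Sum>w\<in>W. card {u\<in>F. w \<otimes> u \<notin> F})"
    by (rule of_nat_mono)
  also have "\<dots> = (\<Sum>w\<in>W. real (card {u\<in>F. w \<otimes> u \<notin> F}))" by simp
  also have "\<dots> \<le> (\<Sum>w\<in>W. \<epsilon> * real (card F))"
  proof (rule sum_mono)
    fix w assume w: "w \<in> W"
    then have wG: "w \<in> carrier G" using W by blast
    have fin: "finite (sym_diff (w <# F) F)" using F by (simp add: l_coset_def)
    have inj: "inj_on (\<lambda>u. w \<otimes> u) {u\<in>F. w \<otimes> u \<notin> F}"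
      using F(3) wG by (intro inj_onI) (metis (no_types, lifting) Units_eq Units_l_cancel
          mem_Collect_eq subsetD)
    have "(\<lambda>u. w \<otimes> u) ` {u\<in>F. w \<otimes> u \<notin> F} \<subseteq> sym_diff (w <# F) F" by (auto simp: l_coset_def)
    then have "card {u\<in>F. w \<otimes> u \<notin> F} \<le> card (sym_diff (w <# F) F)"
      using card_inj_on_le[OF inj _ fin] by blast
    then show "real (card {u\<in>F. w \<otimes> u \<notin> F}) \<le> \<epsilon> * real (card F)" using F(4)[OF w] by linarith
  qed
  also have "\<dots> = \<sigma> * real (card F) * (real (card W) / (real (card W) + 1))" by (simp add: \<epsilon>_def
      add.commute)
  also have "\<dots> \<le> \<sigma> * real (card F) * 1" using \<sigma> by (intro mult_left_mono) auto
  finally show thesis using that F by simp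
qed

section \<open>The absolute value of a convolution operator and continuity of the trace\<close>

lemma op_adjoint_convolution_op:
  assumes f: "f \<in> fin_fun G"
  shows "op_adjoint (carrier G) (convolution_op G f) = convolution_op G (conv_adjoint G f)"
  unfolding op_adjoint_def
proof (rule the_equality)
  note b = convolution_op_bounded(1)[OF conv_adjoint_fin_fun[OF f]]
  show "convolution_op G (conv_adjoint G f) \<in> bounded_ops (carrier G) \<and> (\<forall>x\<in>ell2 (carrier G).
      \<forall>y\<in>ell2 (carrier G).
      ell2_inner (carrier G) (convolution_op G f x) y = ell2_inner (carrier G) x (convolution_op G
          (conv_adjoint G f) y))"
    using b convolution_op_adjoint[OF f] by blast
  fix T assume T: "T \<in> bounded_ops (carrier G) \<and> (\<forall>x\<in>ell2 (carrier G). \<forall>y\<in>ell2 (carrier G).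
      ell2_inner (carrier G) (convolution_op G f x) y = ell2_inner (carrier G) x (T y))"
  show "T = convolution_op G (conv_adjoint G f)"
  proof (rule bounded_ops_eqI[OF _ b])
    fix y assume y: "y \<in> ell2 (carrier G)"
    show "T y = convolution_op G (conv_adjoint G f) y"
    proof (rule ell2_eqI_inner[OF bounded_ops_mem[OF _ y] bounded_ops_mem[OF b y]])
      fix x assume "x \<in> ell2 (carrier G)"
      then show "ell2_inner (carrier G) x (T y) = ell2_inner (carrier G) x (convolution_op G
          (conv_adjoint G f) y)"
        using T y convolution_op_adjoint[OF f _ y, of x] by metis
    qed (use T in blast)
  qed (use T in blast)
qed

lemma op_abs_convolution_op:
  assumes f: "f \<in> fin_fun G"
  shows "op_abs (carrier G) (convolution_op G f) = functional_calculus (carrier G) sqrt (gram_op f)"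
proof -
  note b = convolution_op_bounded(1)[OF f] and b' = convolution_op_bounded(1)[OF
      conv_adjoint_fin_fun[OF f]]
  have "convolution_op G (conv_adjoint G f) \<circ> convolution_op G f = gram_op f"
  proof
    fix x
    show "(convolution_op G (conv_adjoint G f) \<circ> convolution_op G f) x = convolution_op G (gram f)
        x"
    proof (cases "x \<in> ell2 (carrier G)")
      case True
      then show ?thesis unfolding gram_def
        using convolution_op_compose[OF conv_adjoint_fin_fun[OF f] f] by simp
    next
      case False
      \<comment> \<open>The functional calculus takes the operator as a function on all families, so
        agreement is also required off \<open>ell2\<close>; there the inner operator returns zero,
        and the outer one preserves it.\<close>
      then show ?thesis using bounded_ops_zero[OF b'] by (simp add: convolution_op_def)
    qed
  qed
  then show ?thesis unfolding op_abs_def op_adjoint_convolution_op[OF f] by simp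
qed

text \<open>The trace is a coordinate of the image of the unit vector
  \<open>point_mass \<one>\<close>, and a coordinate is bounded by the norm.\<close>

lemma trace_diff_bound:
  assumes "\<And>x. x \<in> ell2 (carrier G) \<Longrightarrow> ell2_norm (carrier G) (\<lambda>i. A x i - B x i) \<le> e * ell2_norm
      (carrier G) x"
    and mem: "A (point_mass \<one>) \<in> ell2 (carrier G)" "B (point_mass \<one>) \<in> ell2 (carrier G)"
  shows "\<bar>Re (group_trace G A) - Re (group_trace G B)\<bar> \<le> e"
proof -
  let ?\<delta> = "point_mass \<one> :: 'a \<Rightarrow> complex"
  have \<delta>: "?\<delta> \<in> ell2 (carrier G)" by (intro fin_fun_ell2 point_mass_fin_fun) simp
  have "(ell2_norm (carrier G) ?\<delta>)\<^sup>2 = 1"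
    by (subst ell2_norm_finite_support[of "{\<one>}"]) (auto simp: point_mass_def)
  then have n1: "ell2_norm (carrier G) ?\<delta> = 1"
    using ell2_norm_nonneg[of "carrier G" ?\<delta>] by (simp add: power2_eq_1_iff)
  have tr: "group_trace G T = T ?\<delta> \<one>" for T
    unfolding group_trace_def by (subst ell2_inner_finite_support[of "{\<one>}"]) (auto simp:
        point_mass_def)
  have "\<bar>Re (A ?\<delta> \<one> - B ?\<delta> \<one>)\<bar> \<le> cmod (A ?\<delta> \<one> - B ?\<delta> \<one>)" by (rule abs_Re_le_cmod)
  also have "\<dots> \<le> ell2_norm (carrier G) (\<lambda>i. A ?\<delta> i - B ?\<delta> i)"
    using cmod_le_ell2_norm[OF ell2_diff[OF mem]] .
  also have "\<dots> \<le> e" using assms(1)[OF \<delta>] n1 by simp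
  finally show ?thesis by (simp add: tr)
qed

end

lemma distance_to_integers_positive:
  fixes x :: real
  assumes "x \<notin> \<int>"
  obtains d where "d > 0" "\<And>n::int. d \<le> \<bar>x - of_int n\<bar>"
proof
  have "frac x \<noteq> 0" using assms by simp
  then show "min (frac x) (1 - frac x) > 0"
    using frac_ge_0[of x] frac_lt_1[of x] by (simp add: min_def)
  fix n :: int
  show "min (frac x) (1 - frac x) \<le> \<bar>x - of_int n\<bar>"
  proof (cases "n \<le> \<lfloor>x\<rfloor>")
    case True
    then have "real_of_int n \<le> of_int \<lfloor>x\<rfloor>" by simp
    then show ?thesis by (simp add: frac_def)
  next
    case False
    then have "of_int \<lfloor>x\<rfloor> + 1 \<le> real_of_int n" by linarith
    then show ?thesis by (simp add: frac_def)
  qed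
qed

section \<open>Positivity of the logarithm of the determinant\<close>

theorem corollary7p9:
  fixes \<Gamma> :: "('a, 'c) monoid_scheme" and f :: "'a \<Rightarrow> real"
  assumes "group \<Gamma>" and "countable (carrier \<Gamma>)" and "amenable \<Gamma>"
    and "f \<in> carrier (int_group_ring \<Gamma>)"
    and "f \<in> Units (ell1_algebra \<Gamma>)"
    and "\<not> (\<exists>g\<in>carrier (int_group_ring \<Gamma>).
            g \<otimes>\<^bsub>int_group_ring \<Gamma>\<^esub> f = \<one>\<^bsub>int_group_ring \<Gamma>\<^esub>)"
  shows "fuglede_kadison_det \<Gamma> (convolution_op \<Gamma> f) > 1"
proof -
  interpret group \<Gamma> by fact
  let ?S = "carrier \<Gamma>"
  let ?n = "ell2_norm ?S"
  have f: "f \<in> fin_fun \<Gamma>" and fint: "\<And>s. f s \<in> \<int>"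
    using assms(4) by (auto simp: int_group_ring_carrier)
  obtain h k where h: "\<And>s. s \<notin> ?S \<Longrightarrow> h s = 0" "(\<lambda>s. \<bar>h s\<bar>) summable_on ?S"
    "convolution \<Gamma> h f = point_mass \<one>\<^bsub>\<Gamma>\<^esub>" "convolution \<Gamma> f h = point_mass \<one>\<^bsub>\<Gamma>\<^esub>"
    and k: "k \<in> ?S" "h k \<notin> \<int>"
    using ell1_inverse[OF assms(5,6)] by blast
  define H where "H = (\<Sum>\<^sub>\<infinity>s\<in>?S. \<bar>h s\<bar>)"
  have H: "0 \<le> H" unfolding H_def by (intro infsum_nonneg) auto
  obtain d where d: "d > 0" "\<And>n::int. d \<le> \<bar>h k - of_int n\<bar>"
    using distance_to_integers_positive[OF k(2)] by blast
  \<comment> \<open>A first truncation, with error 1/2, serves only to produce \<open>c\<close>; the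
    second one needs an accuracy \<eta> that depends on \<open>c\<close>.\<close>
  have half: "(0::real) < 1 / 2" by simp
  obtain h1 where h1: "h1 \<in> fin_fun \<Gamma>"
    "ell1_norm (\<lambda>s. convolution \<Gamma> h1 f s - point_mass \<one>\<^bsub>\<Gamma>\<^esub> s) \<le> 1 / 2"
    using truncated_inverse[OF f h k(1) half] by blast
  obtain c where c: "c > 0" "\<And>x. x \<in> ell2 ?S \<Longrightarrow> c * (?n x)\<^sup>2 \<le> (?n (convolution_op \<Gamma> f x))\<^sup>2"
    using convolution_op_bounded_below[OF f h1] by blast
  \<comment> \<open>The left side of \<open>small\<close> is linear in \<eta>, with factor
    \<open>Q\<close>. As \<open>Q\<close> involves only \<open>H\<close>, \<open>c\<close> and the
    norm of \<open>f\<close>, the accuracy \<eta> can be fixed before the second truncation is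
    made.\<close>
  define Q where "Q = ell1_norm f * (ell1_norm f * H + 1) / c + H"
  have Q: "0 \<le> Q" unfolding Q_def using H c(1) by simp
  define \<eta> where "\<eta> = d / (Q + 1)"
  have \<eta>: "\<eta> > 0" using d(1) Q by (simp add: \<eta>_def)
  have "ell1_norm f * ((ell1_norm f * H + 1) * \<eta>) / c + \<eta> * H = \<eta> * Q"
    by (simp add: Q_def algebra_simps)
  also have "\<dots> < \<eta> * (Q + 1)" using \<eta> by simp
  also have "\<dots> = d" using Q by (simp add: \<eta>_def)
  finally have small: "ell1_norm f * ((ell1_norm f * H + 1) * \<eta>) / c + \<eta> * H < d" .
  obtain h' where h': "h' \<in> fin_fun \<Gamma>" "h' k = h k" "ell1_norm h' \<le> H"
    "ell1_norm (\<lambda>s. convolution \<Gamma> f h' s - point_mass \<one>\<^bsub>\<Gamma>\<^esub> s) \<le> \<eta>"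
    "ell1_norm (\<lambda>s. convolution \<Gamma> h' f s - point_mass \<one>\<^bsub>\<Gamma>\<^esub> s) \<le> \<eta>"
    using truncated_inverse[OF f h k(1) \<eta>] unfolding H_def by blast
  have d': "\<And>n::int. d \<le> \<bar>h' k - of_int n\<bar>" using d(2) h'(2) by simp
  have supp_h': "finite {v. h' v \<noteq> 0}" "\<And>v. h' v \<noteq> 0 \<Longrightarrow> v \<in> ?S" using fin_funD[OF h'(1)] by auto

  \<comment> \<open>\<open>inv k \<otimes> \<gamma> = inv v \<otimes> \<gamma>'\<close> means
    \<open>\<gamma> = z \<otimes> \<gamma>'\<close> with \<open>z = k \<otimes> inv v\<close>;
    separation by these finitely many \<open>z\<close> keeps the contributions of different points
    of \<open>A\<close> apart.\<close>
  define Z where "Z = (\<lambda>v. k \<otimes>\<^bsub>\<Gamma>\<^esub> inv\<^bsub>\<Gamma>\<^esub> v) ` {v. h' v \<noteq> 0}"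
  have Z: "finite Z" "Z \<subseteq> ?S" using supp_h' k(1) by (auto simp: Z_def)
  define D where "D = real (2 * card Z + 1)"
  have D: "D > 0" by (simp add: D_def)
  \<comment> \<open>At least the proportion \<open>1 / D\<close> of the interior points is kept in
    \<open>A\<close>, so \<kappa> is the guaranteed gain per interior point: \<open>ln 2\<close>
    over \<open>D\<close>, halved as the logarithm in \<open>ln r / 2\<close> is.\<close>
  define \<kappa> where "\<kappa> = ln 2 / (2 * D)"
  have \<kappa>: "\<kappa> > 0" using D by (simp add: \<kappa>_def)
  \<comment> \<open>A quarter of the gain is spent on the polynomial approximation in the eigenvalue
    sum, and a quarter in returning from \<tau> to \<open>t\<close>.\<close>
  define \<epsilon> where "\<epsilon> = \<kappa> / 4"
  have \<epsilon>: "\<epsilon> > 0" using \<kappa> by (simp add: \<epsilon>_def)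

  define L where "L = gram_op f"
  define lnL where "lnL = functional_calculus ?S ln (functional_calculus ?S sqrt L)"
  have S: "?S \<noteq> {}" using one_closed by blast
  have L: "L \<in> bounded_ops ?S" "self_adjoint ?S L"
    unfolding L_def by (rule convolution_op_bounded(1)[OF gram_fin_fun[OF f fint]], rule
        gram_op_self_adjoint[OF f fint])
  have L_inner: "Re (ell2_inner ?S (L x) x) = (?n (convolution_op \<Gamma> f x))\<^sup>2" if "x \<in> ell2 ?S" for x
    unfolding L_def by (simp add: gram_op_inner[OF f fint that])
  have lower: "c * (?n x)\<^sup>2 \<le> Re (ell2_inner ?S (L x) x)" if "x \<in> ell2 ?S" for x
    using c(2)[OF that] L_inner[OF that] by simp
  have upper: "Re (ell2_inner ?S (L x) x) \<le> (ell1_norm f)\<^sup>2 * (?n x)\<^sup>2" if "x \<in> ell2 ?S" for x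
    using power_mono[OF convolution_op_bounded(2)[OF f that] ell2_norm_nonneg, of 2] L_inner[OF
        that]
    by (simp add: power_mult_distrib)
  obtain p where p: "\<And>r. c \<le> r \<Longrightarrow> r \<le> (ell1_norm f)\<^sup>2 \<Longrightarrow> \<bar>poly p r - ln r / 2\<bar> \<le> \<epsilon>"
    "\<And>x. x \<in> ell2 ?S \<Longrightarrow> ?n (\<lambda>i. op_poly ?S p L x i - lnL x i) \<le> \<epsilon> * ?n x"
    "lnL \<in> bounded_ops ?S"
    unfolding lnL_def using log_abs_poly_approx[OF S L c(1) lower upper \<epsilon>] by blast
  define t where "t = Re (group_trace \<Gamma> lnL)"
  define \<tau> where "\<tau> = Re (group_trace \<Gamma> (op_poly ?S p L))"
  have \<delta>: "point_mass \<one>\<^bsub>\<Gamma>\<^esub> \<in> ell2 ?S" by (intro fin_fun_ell2 point_mass_fin_fun) simp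
  have t\<tau>: "\<bar>\<tau> - t\<bar> \<le> \<epsilon>"
    unfolding t_def \<tau>_def
    by (rule trace_diff_bound[OF p(2) bounded_ops_mem[OF bounded_ops_op_poly[OF L(1)] \<delta>]
        bounded_ops_mem[OF p(3) \<delta>]])
  have det: "fuglede_kadison_det \<Gamma> (convolution_op \<Gamma> f) = exp t"
    unfolding fuglede_kadison_det_def op_abs_convolution_op[OF f] t_def lnL_def L_def ..

  define B where "B = (\<Sum>k\<le>degree p. \<bar>coeff p k\<bar> * (ell1_norm f)\<^sup>2 ^ k)"
  have B: "0 \<le> B" unfolding B_def by (intro sum_nonneg) auto
  \<comment> \<open>One finite set for two requirements on interior points: powers of
    \<open>L\<close> up to the degree of \<open>p\<close> must not notice the boundary, and the
    approximate solutions must stay in \<open>F\<close>.\<close>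
  define W where "W = (\<Union>j\<le>degree p. {s. (L ^^ j) (point_mass \<one>\<^bsub>\<Gamma>\<^esub>) s \<noteq> 0}) \<union>
    (\<lambda>(u, v). u \<otimes>\<^bsub>\<Gamma>\<^esub> inv\<^bsub>\<Gamma>\<^esub> v) ` ({v. h' v \<noteq> 0} \<times> {v. h' v \<noteq> 0})"
  have Lj: "(L ^^ j) (point_mass \<one>\<^bsub>\<Gamma>\<^esub>) \<in> fin_fun \<Gamma>" for j
    unfolding L_def by (rule gram_op_pow_translate(1)[OF f fint one_closed])
  have W: "finite W" "W \<subseteq> ?S"
    using fin_funD[OF Lj] supp_h' by (auto simp: W_def)
  \<comment> \<open>The first entry keeps at least half of \<open>F\<close> interior; the second
    limits the contribution of the bad points to \<open>\<kappa> / 16\<close> per point of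
    \<open>F\<close>.\<close>
  define \<sigma> where "\<sigma> = min (1 / 2) (\<kappa> / (16 * (B + 1)))"
  have \<sigma>: "\<sigma> > 0" using \<kappa> B by (simp add: \<sigma>_def)
  have "\<sigma> \<le> \<kappa> / (16 * (B + 1))" by (simp add: \<sigma>_def)
  then have "\<sigma> * (16 * (B + 1)) \<le> \<kappa>" using B by (subst (asm) pos_le_divide_eq) auto
  then have \<sigma>B: "\<sigma> * B \<le> \<kappa> / 16" using \<sigma> by (simp add: algebra_simps)
  obtain F where F: "finite F" "F \<noteq> {}" "F \<subseteq> ?S"
    "real (card {u\<in>F. \<exists>w\<in>W. w \<otimes>\<^bsub>\<Gamma>\<^esub> u \<notin> F}) \<le> \<sigma> * real (card F)"
    using Folner_interior[OF assms(3) W \<sigma>] by blast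
  define bad where "bad = {u\<in>F. \<exists>w\<in>W. w \<otimes>\<^bsub>\<Gamma>\<^esub> u \<notin> F}"
  have bad: "bad \<subseteq> F" "finite bad" using F(1) by (auto simp: bad_def)
  have good: "finite (F - bad)" "F - bad \<subseteq> ?S" using F by auto
  obtain A where A: "A \<subseteq> F - bad" "\<And>a b z. a \<in> A \<Longrightarrow> b \<in> A \<Longrightarrow> z \<in> Z \<Longrightarrow> a = z \<otimes>\<^bsub>\<Gamma>\<^esub> b \<Longrightarrow> a = b"
    "card (F - bad) \<le> card A * (2 * card Z + 1)"
    using separated_subset[OF good Z] by blast
  have AF: "A \<subseteq> F" using A(1) by blast
  have "integrally_independent f F A"
    unfolding integrally_independent_def
  proof (intro allI impI ballI)
    fix \<epsilon> z :: "'a \<Rightarrow> int" and \<gamma>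
    assume *: "(\<forall>\<gamma>\<in>A. \<epsilon> \<gamma> \<in> {-1, 0, 1}) \<and> (\<forall>s\<in>F.
      convolution_op \<Gamma> (conv_adjoint \<Gamma> f) (convolution_op \<Gamma> f (\<lambda>s. if s \<in> F then of_int (z s) else
          0)) s =
      (if s \<in> A then of_int (\<epsilon> s) else 0))" and \<gamma>: "\<gamma> \<in> A"
    show "\<epsilon> \<gamma> = 0"
    proof (rule compressed_equation_no_integral_solution[OF f fint c h'(1,3) less_imp_le[OF \<eta>]
        h'(4,5)
          k(1) d' less_imp_le[OF d(1)] small F(1,3) AF, where z = z])
      fix \<gamma> u v assume g: "\<gamma> \<in> A" and u: "h' u \<noteq> 0" and v: "h' v \<noteq> 0"
      then have "u \<otimes>\<^bsub>\<Gamma>\<^esub> inv\<^bsub>\<Gamma>\<^esub> v \<in> W" by (auto simp: W_def)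
      moreover have "\<gamma> \<in> F" "\<gamma> \<notin> bad" using g A(1) by auto
      ultimately have "u \<otimes>\<^bsub>\<Gamma>\<^esub> inv\<^bsub>\<Gamma>\<^esub> v \<otimes>\<^bsub>\<Gamma>\<^esub> \<gamma> \<in> F" by (auto simp: bad_def)
      then show "u \<otimes>\<^bsub>\<Gamma>\<^esub> (inv\<^bsub>\<Gamma>\<^esub> v \<otimes>\<^bsub>\<Gamma>\<^esub> \<gamma>) \<in> F"
        using supp_h'(2)[OF u] supp_h'(2)[OF v] \<open>\<gamma> \<in> F\<close> F(3) by (auto simp: m_assoc)
    next
      fix \<gamma> \<gamma>' v
      assume g: "\<gamma> \<in> A" "\<gamma>' \<in> A" "h' v \<noteq> 0" and eq: "inv\<^bsub>\<Gamma>\<^esub> k \<otimes>\<^bsub>\<Gamma>\<^esub> \<gamma> = inv\<^bsub>\<Gamma>\<^esub> v \<otimes>\<^bsub>\<Gamma>\<^esub> \<gamma>'"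
      have G: "\<gamma> \<in> ?S" "\<gamma>' \<in> ?S" "v \<in> ?S" using g AF F(3) supp_h'(2) by auto
      have "\<gamma> = k \<otimes>\<^bsub>\<Gamma>\<^esub> (inv\<^bsub>\<Gamma>\<^esub> k \<otimes>\<^bsub>\<Gamma>\<^esub> \<gamma>)" using G k(1) by (simp add: m_assoc[symmetric])
      also have "\<dots> = k \<otimes>\<^bsub>\<Gamma>\<^esub> inv\<^bsub>\<Gamma>\<^esub> v \<otimes>\<^bsub>\<Gamma>\<^esub> \<gamma>'" unfolding eq using G k(1) by (simp add: m_assoc)
      finally show "\<gamma> = \<gamma>'" using A(2)[OF g(1,2)] g(3) by (auto simp: Z_def)
    qed (use * \<gamma> in auto)
  qed
  note indep = this
  define n where "n = card F"
  have n: "n > 0" using F by (simp add: n_def card_gt_0_iff)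
  obtain e where e: "bij_betw e {..<n} F"
    using ex_bij_betw_nat_finite[OF F(1)] by (auto simp: n_def atLeast0LessThan)
  have "real (card A) * ln 2 / 2 \<le> real n * \<epsilon> + real (n - card bad) * \<tau> + real (card bad) * B"
    unfolding \<tau>_def B_def L_def
  proof (rule log_det_le_trace[OF f fint F(1,3) e AF c indep p(1) bad(1)])
    fix u j s assume u: "u \<in> F - bad" and j: "j \<le> degree p" "(gram_op f ^^ j) (point_mass \<one>\<^bsub>\<Gamma>\<^esub>) s
        \<noteq> 0"
    then have "s \<in> W" by (auto simp: W_def L_def)
    then show "s \<otimes>\<^bsub>\<Gamma>\<^esub> u \<in> F" using u by (auto simp: bad_def)
  qed
  moreover define g where "g = real (n - card bad)"
  have "g \<le> real (card A) * D"
    using A(3) bad F(1) unfolding g_def D_def n_def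
    by (simp only: card_Diff_subset of_nat_mult[symmetric] of_nat_le_iff)
  then have "g * \<kappa> \<le> real (card A) * ln 2 / 2" using D by (simp add: \<kappa>_def field_simps)
  moreover have b: "real (card bad) \<le> \<sigma> * real n" using F(4) by (simp add: bad_def n_def)
  then have "real (card bad) * B \<le> \<sigma> * real n * B" using B by (rule mult_right_mono)
  moreover have "\<sigma> * real n * B \<le> real n * (\<kappa> / 16)"
    using mult_left_mono[OF \<sigma>B, of "real n"] by (simp add: algebra_simps)
  ultimately have main: "g * (\<kappa> - \<tau>) \<le> real n * (\<kappa> / 4 + \<kappa> / 16)"
    by (simp add: g_def \<epsilon>_def algebra_simps)
  \<comment> \<open>Otherwise \<open>\<kappa> - \<tau> \<ge> 3 * \<kappa> / 4\<close>, and with at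
    least half of the points interior \<open>main\<close> would give \<open>3/8 \<le> 5/16\<close>
    after division by \<open>n * \<kappa>\<close>. The threshold equals \<epsilon>, the possible
    distance from \<tau> to \<open>t\<close>.\<close>
  have "\<tau> > \<kappa> / 4"
  proof (rule ccontr)
    assume "\<not> \<tau> > \<kappa> / 4"
    then have \<tau>: "\<kappa> - \<tau> \<ge> 3 * \<kappa> / 4" by simp
    have "\<sigma> \<le> 1 / 2" unfolding \<sigma>_def by (rule min.cobounded1)
    then have "\<sigma> * real n \<le> 1 / 2 * real n" by (rule mult_right_mono) simp
    moreover have "card bad \<le> n" using bad F(1) by (simp add: n_def card_mono)
    ultimately have "g \<ge> real n / 2" using b by (simp add: g_def of_nat_diff)
    then have "real n / 2 * (3 * \<kappa> / 4) \<le> g * (\<kappa> - \<tau>)" using \<tau> \<kappa> by (intro mult_mono) auto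
    then have "real n / 2 * (3 * \<kappa> / 4) \<le> real n * (\<kappa> / 4 + \<kappa> / 16)"
      using main by (rule order_trans)
    then have "real n * \<kappa> \<le> 0" by (simp add: algebra_simps)
    then show False using n \<kappa> by (simp add: mult_le_0_iff)
  qed
  then have "t > 0" using t\<tau> unfolding \<epsilon>_def by linarith
  then show ?thesis by (simp add: det)
qed

end
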